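(* Let $\mathcal H$ be a complex separable Hilbert space, let $S\in\mathcal S(\mathcal H)$ with polar decomposition $S=J\Delta^{1/2}$, let $T\in\mathcal C_S$, and let $\psi_1,\ldots,\psi_4\in\mathcal H$. Then the function $T^{\psi_1\psi_2}_{\psi_3\psi_4}:\mathbb R\to\mathbb C$ defined by $$T^{\psi_1\psi_2}_{\psi_3\psi_4}(t):=\langle\psi_1\otimes\psi_2,\,T(t)(\psi_3\otimes\psi_4)\rangle,\qquad T(t):=(1\otimes\Delta^{-it})\,T\,(\Delta^{it}\otimes1),$$ has a bounded analytic extension to the strip $\mathbb S_{1/2}:=\{z\in\mathbb C:0<\mathrm{Im}(z)<\tfrac12\}$ satisfying the boundary condition, for all $t\in\mathbb R$, $$T^{\psi_1\psi_2}_{\psi_3\psi_4}\bigl(t+\tfrac i2\bigr)=\bigl\langle J\psi_3\otimes\psi_1,\,(\Delta^{-it}\otimes1)\,\mathrm{Cr}_S(T)\,(1\otimes\Delta^{it})(\psi_4\otimes J\psi_2)\bigr\rangle.$$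
   Context: Inner products are antilinear in the first and linear in the second argument. $\mathcal S(\mathcal H)$ is the set of densely defined closed antilinear involutions $S$ on $\mathcal H$ (possibly unbounded). Each $S\in\mathcal S(\mathcal H)$ has a polar decomposition $S=J\Delta^{1/2}$ with $J$ an antiunitary involution, $\Delta$ strictly positive (self-adjoint, injective), $J\Delta=\Delta^{-1}J$, and $S^*=J\Delta^{-1/2}$; the adjoint of an antilinear operator satisfies $\langle v,Sw\rangle=\langle w,S^*v\rangle$. An operator $T\in\mathcal B(\mathcal H\otimes\mathcal H)$ is $S$-crossable, written $T\in\mathcal C_S$, if there is a (necessarily unique) bounded operator $\mathrm{Cr}_S(T)\in\mathcal B(\mathcal H\otimes\mathcal H)$ with $$\langle\varphi_2\otimes S^*\psi_2,\,T(S\varphi_1\otimes\psi_1)\rangle=\langle\varphi_1\otimes\varphi_2,\,\mathrm{Cr}_S(T)(\psi_1\otimes\psi_2)\rangle$$ for all $\varphi_1,\psi_1\in\mathrm{dom}(S)$ and $\varphi_2,\psi_2\in\mathrm{dom}(S^* )$. "Bounded analytic extension to the strip with boundary condition" is meant in the usual sense of KMS conditions: a function that is bounded and continuous on the closed strip $\{0\le\mathrm{Im}(z)\le\frac12\}$, analytic in the open strip, equal to the given function on $\mathbb R$, and with the stated values on $\mathbb R+\frac i2$. *)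

theory Defs
  imports "HOL-Analysis.Analysis"
begin

section \<open>Complex Hilbert spaces\<close>

text \<open>The inner product is antilinear in the first and linear in the second argument.\<close>

class complex_hilbert = banach +
  fixes scaleC :: "complex \<Rightarrow> 'a \<Rightarrow> 'a" (infixr "*\<^sub>C" 75)
    and cinner :: "'a \<Rightarrow> 'a \<Rightarrow> complex"
  assumes scaleC_add_right: "c *\<^sub>C (x + y) = c *\<^sub>C x + c *\<^sub>C y"
    and scaleC_add_left: "(c + d) *\<^sub>C x = c *\<^sub>C x + d *\<^sub>C x"
    and scaleC_scaleC: "c *\<^sub>C (d *\<^sub>C x) = (c * d) *\<^sub>C x"
    and scaleC_of_real: "complex_of_real r *\<^sub>C x = r *\<^sub>R x"
    and cinner_commute: "cinner x y = cnj (cinner y x)"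
    and cinner_add_right: "cinner x (y + z) = cinner x y + cinner x z"
    and cinner_scaleC_right: "cinner x (c *\<^sub>C y) = c * cinner x y"
    and cinner_self: "cinner x x = complex_of_real ((norm x)\<^sup>2)"

definition bounded_clinear :: "('a::complex_hilbert \<Rightarrow> 'b::complex_hilbert) \<Rightarrow> bool" where
  "bounded_clinear A \<longleftrightarrow> bounded_linear A \<and> (\<forall>c x. A (c *\<^sub>C x) = c *\<^sub>C A x)"

definition antiunitary_involution :: "('a::complex_hilbert \<Rightarrow> 'a) \<Rightarrow> bool" where
  "antiunitary_involution J \<longleftrightarrow>
     (\<forall>x y. J (x + y) = J x + J y) \<and>
     (\<forall>c x. J (c *\<^sub>C x) = cnj c *\<^sub>C J x) \<and>
     (\<forall>x y. cinner (J x) (J y) = cinner y x) \<and>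
     (\<forall>x. J (J x) = x)"


section \<open>Tensor products\<close>

text \<open>\<open>'c\<close>, together with the map \<open>\<otimes>\<close>, is a Hilbert space tensor product of \<open>'a\<close> and
  \<open>'b\<close>; this determines it up to a unique unitary. The real span of the elementary tensors is
  already their complex span, because \<open>c *\<^sub>C (x \<otimes> y) = (c *\<^sub>C x) \<otimes> y\<close>.\<close>

definition hilbert_tensor ::
  "('a::complex_hilbert \<Rightarrow> 'b::complex_hilbert \<Rightarrow> 'c::complex_hilbert) \<Rightarrow> bool" where
  "hilbert_tensor tens \<longleftrightarrow>
     (\<forall>x x' y. tens (x + x') y = tens x y + tens x' y) \<and>
     (\<forall>x y y'. tens x (y + y') = tens x y + tens x y') \<and>
     (\<forall>c x y. tens (c *\<^sub>C x) y = c *\<^sub>C tens x y) \<and>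
     (\<forall>c x y. tens x (c *\<^sub>C y) = c *\<^sub>C tens x y) \<and>
     (\<forall>x y x' y'. cinner (tens x y) (tens x' y') = cinner x x' * cinner y y') \<and>
     closure (span {tens x y | x y. True}) = UNIV"

definition tensor_op ::
  "('a::complex_hilbert \<Rightarrow> 'b::complex_hilbert \<Rightarrow> 'c::complex_hilbert) \<Rightarrow>
   ('a \<Rightarrow> 'a) \<Rightarrow> ('b \<Rightarrow> 'b) \<Rightarrow> 'c \<Rightarrow> 'c" where
  "tensor_op tens A B =
     (THE R. bounded_clinear R \<and> (\<forall>x y. R (tens x y) = tens (A x) (B y)))"


section \<open>Unbounded operators\<close>

text \<open>An unbounded operator is represented by its graph; its domain is \<^const>\<open>Domain\<close> of the graph.\<close>

type_synonym 'a unbounded_op = "('a \<times> 'a) set"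

definition op_apply :: "'a unbounded_op \<Rightarrow> 'a \<Rightarrow> 'a" (infixr "\<rhd>" 90) where
  "A \<rhd> v = (THE u. (v, u) \<in> A)"

definition linear_op :: "'a::complex_hilbert unbounded_op \<Rightarrow> bool" where
  "linear_op A \<longleftrightarrow> single_valued A \<and> (0, 0) \<in> A \<and>
     (\<forall>v u w x. (v, u) \<in> A \<longrightarrow> (w, x) \<in> A \<longrightarrow> (v + w, u + x) \<in> A) \<and>
     (\<forall>c v u. (v, u) \<in> A \<longrightarrow> (c *\<^sub>C v, c *\<^sub>C u) \<in> A)"

definition antilinear_op :: "'a::complex_hilbert unbounded_op \<Rightarrow> bool" where
  "antilinear_op A \<longleftrightarrow> single_valued A \<and> (0, 0) \<in> A \<and>
     (\<forall>v u w x. (v, u) \<in> A \<longrightarrow> (w, x) \<in> A \<longrightarrow> (v + w, u + x) \<in> A) \<and>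
     (\<forall>c v u. (v, u) \<in> A \<longrightarrow> (c *\<^sub>C v, cnj c *\<^sub>C u) \<in> A)"

definition densely_defined :: "'a::complex_hilbert unbounded_op \<Rightarrow> bool" where
  "densely_defined A \<longleftrightarrow> closure (Domain A) = UNIV"

definition adjoint_op :: "'a::complex_hilbert unbounded_op \<Rightarrow> 'a unbounded_op" where
  "adjoint_op A = {(v, w). \<forall>(x, y)\<in>A. cinner v y = cinner w x}"

text \<open>The adjoint of an antilinear operator: \<open>\<langle>v, S x\<rangle> = \<langle>x, S\<^sup>* v\<rangle>\<close>.\<close>

definition antilinear_adjoint :: "'a::complex_hilbert unbounded_op \<Rightarrow> 'a unbounded_op" where
  "antilinear_adjoint S = {(v, w). \<forall>(x, y)\<in>S. cinner v y = cinner x w}"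

text \<open>The last conjunct says that \<open>S\<close> maps its domain into itself and satisfies
  \<open>S (S v) = v\<close> there.\<close>

definition closed_antilinear_involution :: "'a::complex_hilbert unbounded_op \<Rightarrow> bool" where
  "closed_antilinear_involution S \<longleftrightarrow>
     antilinear_op S \<and> densely_defined S \<and> closed S \<and> (\<forall>v u. (v, u) \<in> S \<longrightarrow> (u, v) \<in> S)"

definition strictly_positive_op :: "'a::complex_hilbert unbounded_op \<Rightarrow> bool" where
  "strictly_positive_op A \<longleftrightarrow>
     linear_op A \<and> densely_defined A \<and> adjoint_op A = A \<and>
     (\<forall>(v, u)\<in>A. 0 \<le> Re (cinner v u)) \<and>
     (\<forall>v. (v, 0) \<in> A \<longrightarrow> v = 0)"


section \<open>Functional calculus\<close>

definition orthogonal_projection :: "('a::complex_hilbert \<Rightarrow> 'a) \<Rightarrow> bool" where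
  "orthogonal_projection P \<longleftrightarrow> bounded_clinear P \<and> (\<forall>x. P (P x) = P x) \<and>
     (\<forall>x y. cinner x (P y) = cinner (P x) y)"

definition projection_valued_measure :: "(real set \<Rightarrow> 'a::complex_hilbert \<Rightarrow> 'a) \<Rightarrow> bool" where
  "projection_valued_measure E \<longleftrightarrow>
     (\<forall>B\<in>sets borel. orthogonal_projection (E B)) \<and>
     (\<forall>v. E UNIV v = v) \<and>
     (\<forall>B :: nat \<Rightarrow> real set. range B \<subseteq> sets borel \<longrightarrow> disjoint_family B \<longrightarrow>
        (\<forall>v. (\<lambda>n. E (B n) v) sums E (\<Union>n. B n) v))"

definition scalar_measure :: "(real set \<Rightarrow> 'a::complex_hilbert \<Rightarrow> 'a) \<Rightarrow> 'a \<Rightarrow> real measure" where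
  "scalar_measure E v = measure_of UNIV (sets borel) (\<lambda>B. ennreal (Re (cinner v (E B v))))"

definition spectral_domain ::
  "(real set \<Rightarrow> 'a::complex_hilbert \<Rightarrow> 'a) \<Rightarrow> (real \<Rightarrow> complex) \<Rightarrow> 'a set" where
  "spectral_domain E f = {v. integrable (scalar_measure E v) (\<lambda>x. (cmod (f x))\<^sup>2)}"

text \<open>The integral of \<open>f\<close> against the complex measure \<open>B \<mapsto> \<langle>w, E B v\<rangle>\<close>, by polarization.\<close>

definition spectral_form ::
  "(real set \<Rightarrow> 'a::complex_hilbert \<Rightarrow> 'a) \<Rightarrow> (real \<Rightarrow> complex) \<Rightarrow> 'a \<Rightarrow> 'a \<Rightarrow> complex" where
  "spectral_form E f w v =
     (\<Sum>k<4. \<i> ^ k * integral\<^sup>L (scalar_measure E (v + \<i> ^ k *\<^sub>C w)) f) / 4"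

text \<open>The (graph of the) normal operator \<open>\<integral> f dE\<close>.\<close>

definition spectral_integral ::
  "(real set \<Rightarrow> 'a::complex_hilbert \<Rightarrow> 'a) \<Rightarrow> (real \<Rightarrow> complex) \<Rightarrow> 'a unbounded_op" where
  "spectral_integral E f =
     {(v, u). v \<in> spectral_domain E f \<and>
              (\<forall>w\<in>spectral_domain E f. cinner w u = spectral_form E f w v)}"

definition spectral_measure_of ::
  "'a::complex_hilbert unbounded_op \<Rightarrow> (real set \<Rightarrow> 'a \<Rightarrow> 'a) \<Rightarrow> bool" where
  "spectral_measure_of A E \<longleftrightarrow>
     projection_valued_measure E \<and> spectral_integral E complex_of_real = A"

text \<open>The operator \<open>f(A)\<close> for self-adjoint \<open>A\<close>. By the spectral theorem \<open>A\<close> has exactly one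
  spectral measure on the Borel sets, so all \<open>E\<close> below yield the same operator.\<close>

definition functional_calculus ::
  "'a::complex_hilbert unbounded_op \<Rightarrow> (real \<Rightarrow> complex) \<Rightarrow> 'a unbounded_op" where
  "functional_calculus A f = (\<Union>E\<in>{E. spectral_measure_of A E}. spectral_integral E f)"

text \<open>For strictly positive \<open>A\<close> the spectral measure is concentrated on \<open>(0, \<infinity>)\<close>, so the
  values of \<open>powr\<close> off this half-line play no role.\<close>

definition op_power :: "'a::complex_hilbert unbounded_op \<Rightarrow> complex \<Rightarrow> 'a unbounded_op" where
  "op_power A z = functional_calculus A (\<lambda>x. complex_of_real x powr z)"

text \<open>The everywhere defined unitary \<open>A\<^sup>i\<^sup>t\<close>, as a function.\<close>

definition imaginary_power :: "'a::complex_hilbert unbounded_op \<Rightarrow> real \<Rightarrow> 'a \<Rightarrow> 'a" where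
  "imaginary_power A t v = op_power A (\<i> * complex_of_real t) \<rhd> v"

definition polar_decomposition ::
  "'a::complex_hilbert unbounded_op \<Rightarrow> ('a \<Rightarrow> 'a) \<Rightarrow> 'a unbounded_op \<Rightarrow> bool" where
  "polar_decomposition S J \<Delta> \<longleftrightarrow>
     antiunitary_involution J \<and> strictly_positive_op \<Delta> \<and>
     S = {(v, J u) | v u. (v, u) \<in> op_power \<Delta> (1/2)}"


section \<open>Crossing\<close>

definition crossing_partner ::
  "('h::complex_hilbert \<Rightarrow> 'h \<Rightarrow> 'k::complex_hilbert) \<Rightarrow> 'h unbounded_op \<Rightarrow>
   ('k \<Rightarrow> 'k) \<Rightarrow> ('k \<Rightarrow> 'k) \<Rightarrow> bool" where
  "crossing_partner tens S T R \<longleftrightarrow> bounded_clinear R \<and>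
     (\<forall>\<phi>1\<in>Domain S. \<forall>\<psi>1\<in>Domain S.
      \<forall>\<phi>2\<in>Domain (antilinear_adjoint S). \<forall>\<psi>2\<in>Domain (antilinear_adjoint S).
        cinner (tens \<phi>2 (antilinear_adjoint S \<rhd> \<psi>2)) (T (tens (S \<rhd> \<phi>1) \<psi>1)) =
        cinner (tens \<phi>1 \<phi>2) (R (tens \<psi>1 \<psi>2)))"

definition crossable ::
  "('h::complex_hilbert \<Rightarrow> 'h \<Rightarrow> 'k::complex_hilbert) \<Rightarrow> 'h unbounded_op \<Rightarrow>
   ('k \<Rightarrow> 'k) \<Rightarrow> bool" where
  "crossable tens S T \<longleftrightarrow> bounded_clinear T \<and> (\<exists>R. crossing_partner tens S T R)"

definition Cr ::
  "('h::complex_hilbert \<Rightarrow> 'h \<Rightarrow> 'k::complex_hilbert) \<Rightarrow> 'h unbounded_op \<Rightarrow>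
   ('k \<Rightarrow> 'k) \<Rightarrow> 'k \<Rightarrow> 'k" where
  "Cr tens S T = (THE R. crossing_partner tens S T R)"


section \<open>Analytic extension to the strip\<close>

text \<open>\<open>f\<close> has a bounded analytic extension to the strip \<open>0 < Im z < 1/2\<close>, with boundary
  values \<open>g t\<close> at \<open>t + \<i>/2\<close>.\<close>

definition strip_extension :: "(real \<Rightarrow> complex) \<Rightarrow> (real \<Rightarrow> complex) \<Rightarrow> bool" where
  "strip_extension f g \<longleftrightarrow>
     (\<exists>F. continuous_on {z. 0 \<le> Im z \<and> Im z \<le> 1/2} F \<and>
          bounded (F ` {z. 0 \<le> Im z \<and> Im z \<le> 1/2}) \<and>
          F analytic_on {z. 0 < Im z \<and> Im z < 1/2} \<and>
          (\<forall>t. F (complex_of_real t) = f t) \<and>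
          (\<forall>t. F (complex_of_real t + \<i>/2) = g t))"

end

theory Submission
  imports Defs "HOL-Complex_Analysis.Complex_Analysis"
begin

text \<open>
  For vectors in the range of the spectral projection \<open>E[1/n, n]\<close> of \<open>\<Delta>\<close>, the function
  \<open>z \<mapsto> \<langle>\<psi>1 \<otimes> \<Delta>\<^sup>i\<^sup>z\<^sup>* \<psi>2, T (\<Delta>\<^sup>i\<^sup>z \<psi>3 \<otimes> \<psi>4)\<rangle>\<close> (with \<open>z\<^sup>*\<close> the conjugate of \<open>z\<close>) is entire and bounded
  on the strip. At \<open>z = t + \<i>/2\<close> one has \<open>\<Delta>\<^sup>i\<^sup>z \<psi>3 = S (\<Delta>\<^sup>i\<^sup>t J \<psi>3)\<close> and
  \<open>\<Delta>\<^sup>i\<^sup>z\<^sup>* \<psi>2 = S\<^sup>* (\<Delta>\<^sup>i\<^sup>t J \<psi>2)\<close>, so the defining relation of \<open>Cr\<close> yields the boundary value. As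
  \<open>\<Delta>\<^sup>i\<^sup>t\<close> is unitary, cutting off with \<open>E[1/n, n]\<close> converges uniformly on both boundary lines, hence
  on the whole strip by the maximum principle.

  The spectral theorem is not needed, since \<open>op_power \<Delta> (1/2)\<close> is nonempty only if \<open>\<Delta>\<close> has a
  spectral measure; its uniqueness, and \<open>J f(\<Delta>) J = f\<^sup>*(\<Delta>\<^sup>-\<^sup>1)\<close>, hold because one resolvent
  generates the whole bounded Borel calculus.
\<close>

section \<open>Complex Hilbert spaces\<close>

text \<open>The four vectors are arbitrary, so they need not lie in the domain of
  \<open>\<Delta>^(1/2)\<close> or its inverse, and nothing is known about how \<open>T\<close> acts
  on such domains. The cut-off must therefore make every complex power bounded and must also be
  respected by \<open>J\<close>. As \<open>J\<close> inverts the spectrum, intervals symmetric under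
  \<open>x -> 1/x\<close> are used. The bound of a cut-off function on the strip grows with the
  cut-off. This is harmless: the maximum principle needs only some bound, while its estimate comes
  from the two boundary lines.

  The relation between \<open>J\<close> and \<open>\<Delta>\<close> is not part of
  \<open>polar_decomposition\<close>; it has to be extracted from \<open>S\<close> being an
  involution. Going through the resolvent turns this into an identity of bounded operators: for
  \<open>r = h / (1 + h)\<close> with \<open>h\<close> the square root, replacing \<open>x\<close>
  by \<open>1/x\<close> turns \<open>r\<close> into \<open>1 - r\<close>, and exchanging the two
  components of a graph does the same. Since \<open>spectral_form\<close> is given by polarization
  only, sesquilinearity, multiplicativity and the norm formula of the calculus all have to be
  derived from the projections.\<close>

lemma scaleC_zero_left [simp]: "0 *\<^sub>C (x::'a::complex_hilbert) = 0"
  using scaleC_of_real[of 0 x] by simp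

lemma scaleC_one [simp]: "1 *\<^sub>C (x::'a::complex_hilbert) = x"
  using scaleC_of_real[of 1 x] by simp

lemma scaleC_zero_right [simp]: "c *\<^sub>C (0::'a::complex_hilbert) = 0"
  using scaleC_add_right[of c 0 "0::'a"] by simp

lemma scaleC_minus_left: "(- c) *\<^sub>C (x::'a::complex_hilbert) = - (c *\<^sub>C x)"
  using scaleC_add_left[of "-c" c x] by (simp add: eq_neg_iff_add_eq_0)

lemma cinner_add_left: "cinner (x + y) (z::'a::complex_hilbert) = cinner x z + cinner y z"
  by (metis cinner_add_right cinner_commute complex_cnj_add)

lemma cinner_scaleC_left: "cinner (c *\<^sub>C x) (y::'a::complex_hilbert) = cnj c * cinner x y"
  by (metis cinner_scaleC_right cinner_commute complex_cnj_mult)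

lemma cinner_scaleR_right: "cinner x (r *\<^sub>R (y::'a::complex_hilbert)) = r *\<^sub>R cinner x y"
  by (metis cinner_scaleC_right scaleC_of_real scaleR_conv_of_real)

lemma cinner_scaleR_left: "cinner (r *\<^sub>R x) (y::'a::complex_hilbert) = r *\<^sub>R cinner x y"
  by (metis cinner_scaleC_left scaleC_of_real scaleR_conv_of_real complex_cnj_complex_of_real)

lemma cinner_zero_left [simp]: "cinner 0 (y::'a::complex_hilbert) = 0"
  using cinner_scaleR_left[of 0 0 y] by simp

lemma cinner_zero_right [simp]: "cinner (y::'a::complex_hilbert) 0 = 0"
  using cinner_scaleR_right[of y 0 0] by simp

lemma cinner_minus_right: "cinner x (- y::'a::complex_hilbert) = - cinner x y"
  using cinner_scaleR_right[of x "-1" y] by simp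

lemma cinner_diff_right: "cinner x (y - z::'a::complex_hilbert) = cinner x y - cinner x z"
  using cinner_add_right[of x y "-z"] by (simp add: cinner_minus_right)

lemma Re_cinner_self: "Re (cinner x (x::'a::complex_hilbert)) = (norm x)\<^sup>2"
  by (simp add: cinner_self)

lemma norm_add_sq:
  "(norm (x + y))\<^sup>2 = (norm x)\<^sup>2 + (norm (y::'a::complex_hilbert))\<^sup>2 + 2 * Re (cinner x y)"
proof -
  have "Re (cinner y x) = Re (cinner x y)"
    by (subst cinner_commute) simp
  then show ?thesis
    unfolding Re_cinner_self[symmetric] by (simp add: cinner_add_left cinner_add_right)
qed

lemma norm_scaleC [simp]: "norm (c *\<^sub>C (x::'a::complex_hilbert)) = cmod c * norm x"
proof -
  have "cinner (c *\<^sub>C x) (c *\<^sub>C x) = (c * cnj c) * cinner x x"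
    by (simp add: cinner_scaleC_left cinner_scaleC_right)
  then have "complex_of_real ((norm (c *\<^sub>C x))\<^sup>2) = complex_of_real ((cmod c * norm x)\<^sup>2)"
    unfolding cinner_self complex_norm_square[symmetric] by (simp add: power_mult_distrib)
  then have "(norm (c *\<^sub>C x))\<^sup>2 = (cmod c * norm x)\<^sup>2"
    using of_real_eq_iff by blast
  then show ?thesis
    by (metis norm_ge_zero power2_eq_iff_nonneg zero_le_mult_iff)
qed

lemma cinner_cauchy_schwarz: "cmod (cinner x (y::'a::complex_hilbert)) \<le> norm x * norm y"
proof (cases "y = 0")
  case False
  \<comment> \<open>\<open>c *\<^sub>C y\<close> is the orthogonal projection of \<open>x\<close>
    onto the line through \<open>y\<close>; its distance to \<open>x\<close> is nonnegative.\<close>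
  define c where "c = cinner y x / complex_of_real ((norm y)\<^sup>2)"
  have ny: "(norm y)\<^sup>2 > 0"
    using False by simp
  have cc: "cinner y x * cinner x y = complex_of_real ((cmod (cinner x y))\<^sup>2)"
    by (metis cinner_commute complex_norm_square mult.commute)
  have "Re (cinner x (- (c *\<^sub>C y))) = - ((cmod (cinner x y))\<^sup>2 / (norm y)\<^sup>2)"
    using cc by (simp add: cinner_minus_right cinner_scaleC_right c_def del: of_real_power)
  moreover have "cmod c = cmod (cinner x y) / (norm y)\<^sup>2"
    by (subst cinner_commute) (simp add: c_def norm_divide norm_power)
  then have "(norm (- (c *\<^sub>C y)))\<^sup>2 = (cmod (cinner x y))\<^sup>2 / (norm y)\<^sup>2"
    using False by (simp add: power_mult_distrib power_divide field_simps power2_eq_square)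
  ultimately have "(norm (x + - (c *\<^sub>C y)))\<^sup>2 = (norm x)\<^sup>2 - (cmod (cinner x y))\<^sup>2 / (norm y)\<^sup>2"
    unfolding norm_add_sq by simp
  then have "(cmod (cinner x y))\<^sup>2 / (norm y)\<^sup>2 \<le> (norm x)\<^sup>2"
    by (metis diff_ge_0_iff_ge zero_le_power2)
  then have "(cmod (cinner x y))\<^sup>2 \<le> (norm x * norm y)\<^sup>2"
    using ny by (simp add: field_simps power_mult_distrib)
  then show ?thesis
    by (rule power2_le_imp_le) simp
qed simp

lemma bounded_bilinear_cinner: "bounded_bilinear (cinner :: 'a::complex_hilbert \<Rightarrow> 'a \<Rightarrow> complex)"
  by (rule bounded_bilinear.intro)
    (auto simp: cinner_add_left cinner_add_right cinner_scaleR_left cinner_scaleR_right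
      intro!: exI[of _ 1] cinner_cauchy_schwarz)

lemmas tendsto_cinner = bounded_bilinear.tendsto[OF bounded_bilinear_cinner]

lemma cinner_eqI:
  assumes "\<And>w. cinner w x = cinner w (y::'a::complex_hilbert)"
  shows "x = y"
proof -
  have "cinner (x - y) (x - y) = 0"
    by (simp add: cinner_diff_right assms)
  then show ?thesis
    by (simp add: cinner_self)
qed

lemma bounded_linear_scaleC: "bounded_linear (\<lambda>x::'a::complex_hilbert. c *\<^sub>C x)"
  by (rule bounded_linear_intro[where K = "cmod c"])
    (auto simp: scaleC_add_right mult.commute scaleC_scaleC simp flip: scaleC_of_real)

lemma bounded_clinearI:
  assumes "\<And>x y. A (x + y) = A x + A y" "\<And>c x. A (c *\<^sub>C x) = c *\<^sub>C A x"
    "\<And>x. norm (A x) \<le> K * norm x"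
  shows "bounded_clinear A"
  unfolding bounded_clinear_def
proof safe
  show "bounded_linear A"
    by (rule bounded_linear_intro[where K = K])
      (use assms in \<open>auto simp: mult.commute simp flip: scaleC_of_real\<close>)
qed (fact assms)

lemma bounded_clinearD:
  assumes "bounded_clinear A"
  shows "bounded_linear A" "A (x + y) = A x + A y" "A (x - y) = A x - A y" "A 0 = 0"
    "A (c *\<^sub>C x) = c *\<^sub>C A x"
  using assms unfolding bounded_clinear_def
  by (auto simp: linear_simps)

text \<open>The representing vector minimizes \<open>\<parallel>w\<parallel>\<^sup>2 - 2 Re (L w)\<close>; minimizing sequences are Cauchy by the
  parallelogram law.\<close>

lemma riesz_representation:
  fixes L :: "'a::complex_hilbert \<Rightarrow> complex"
  assumes add: "\<And>x y. L (x + y) = L x + L y"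
    and scale: "\<And>c x. L (c *\<^sub>C x) = cnj c * L x"
    and bound: "\<And>x. cmod (L x) \<le> K * norm x"
  shows "\<exists>u. \<forall>w. L w = cinner w u"
proof -
  define \<phi> where "\<phi> w = (norm w)\<^sup>2 - 2 * Re (L w)" for w
  have LR: "L (r *\<^sub>R x) = r *\<^sub>R L x" for r x
    using scale[of "complex_of_real r" x] by (simp add: scaleC_of_real scaleR_conv_of_real)
  have blL: "bounded_linear L"
    by (rule bounded_linear_intro[where K = K]) (use add LR bound in \<open>auto simp: mult.commute\<close>)
  have lower: "- K\<^sup>2 \<le> \<phi> w" for w
  proof -
    have "Re (L w) \<le> K * norm w"
      using bound[of w] complex_Re_le_cmod[of "L w"] by linarith
    moreover have "0 \<le> (norm w - K)\<^sup>2"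
      by simp
    ultimately show ?thesis
      unfolding \<phi>_def by (simp add: power2_eq_square algebra_simps)
  qed
  define m where "m = (INF w. \<phi> w)"
  have bdd: "bdd_below (range \<phi>)"
    using lower by (auto intro!: bdd_belowI)
  have m_le: "m \<le> \<phi> w" for w
    unfolding m_def by (rule cINF_lower[OF bdd]) simp
  have "\<exists>w. \<phi> w < m + 1 / real (Suc n)" for n
  proof -
    have "(INF w. \<phi> w) < m + 1 / real (Suc n)"
      unfolding m_def[symmetric] by simp
    then show ?thesis
      using cINF_less_iff[OF _ bdd] by auto
  qed
  then obtain w where w: "\<And>n. \<phi> (w n) < m + 1 / real (Suc n)"
    by metis
  have par: "\<phi> a + \<phi> b = 2 * \<phi> ((1/2) *\<^sub>R (a + b)) + (norm (a - b))\<^sup>2 / 2" for a b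
  proof -
    have "(norm (a - b))\<^sup>2 = (norm a)\<^sup>2 + (norm b)\<^sup>2 - 2 * Re (cinner a b)"
      using norm_add_sq[of a "-b"] by (simp add: cinner_minus_right)
    then show ?thesis
      unfolding \<phi>_def
      by (simp add: LR add norm_add_sq power_divide) (simp add: field_simps)
  qed
  have close: "(norm (w i - w j))\<^sup>2 \<le> 2 / real (Suc i) + 2 / real (Suc j)" for i j
    using par[of "w i" "w j"] w[of i] w[of j] m_le[of "(1/2) *\<^sub>R (w i + w j)"] by simp
  have "Cauchy w"
  proof (rule metric_CauchyI)
    fix e :: real assume "e > 0"
    then have "e\<^sup>2 / 4 > 0"
      by simp
    then obtain N where N: "1 / real (Suc N) < e\<^sup>2 / 4"
      using nat_approx_posE by blast
    have "dist (w i) (w j) < e" if ij: "i \<ge> N" "j \<ge> N" for i j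
    proof -
      have "1 / real (Suc i) \<le> 1 / real (Suc N)" "1 / real (Suc j) \<le> 1 / real (Suc N)"
        using ij by (auto simp: frac_le)
      then have "(norm (w i - w j))\<^sup>2 < e\<^sup>2"
        using close[of i j] N by simp
      then show ?thesis
        using \<open>e > 0\<close> by (simp add: dist_norm power2_less_imp_less)
    qed
    then show "\<exists>M. \<forall>i\<ge>M. \<forall>j\<ge>M. dist (w i) (w j) < e"
      by blast
  qed
  then obtain u where u: "w \<longlonglongrightarrow> u"
    using Cauchy_convergent convergent_def by blast
  have "(\<lambda>n. \<phi> (w n)) \<longlonglongrightarrow> \<phi> u"
    unfolding \<phi>_def by (intro tendsto_intros u bounded_linear.tendsto[OF blL])
  moreover have "(\<lambda>n. m + 1 / real (Suc n)) \<longlonglongrightarrow> m + 0"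
    by (intro tendsto_intros LIMSEQ_Suc lim_1_over_n)
  ultimately have "\<phi> u \<le> m"
    using LIMSEQ_le[of "\<lambda>n. \<phi> (w n)" "\<phi> u" "\<lambda>n. m + 1 / real (Suc n)" m] w
    by (metis add.right_neutral less_imp_le)
  then have min: "\<phi> u \<le> \<phi> v" for v
    using m_le[of v] by linarith
  have Re_eq: "Re (L x) = Re (cinner u x)" for x
  proof (rule ccontr)
    assume neq: "Re (L x) \<noteq> Re (cinner u x)"
    define d where "d = Re (L x) - Re (cinner u x)"
    \<comment> \<open>The quadratic in \<open>s\<close> is minimal at \<open>d / (norm x)^2\<close>;
      the added 1 covers \<open>x = 0\<close> and still leaves a strict decrease below the
      minimum.\<close>
    define s where "s = d / ((norm x)\<^sup>2 + 1)"
    have "\<phi> (u + s *\<^sub>R x) = \<phi> u + s\<^sup>2 * (norm x)\<^sup>2 - 2 * s * d"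
      unfolding \<phi>_def norm_add_sq by (simp add: cinner_scaleR_right add LR d_def power_mult_distrib algebra_simps)
    then have "2 * s * d \<le> s\<^sup>2 * (norm x)\<^sup>2"
      using min[of "u + s *\<^sub>R x"] by simp
    moreover have p: "(norm x)\<^sup>2 + 1 > 0"
      by (simp add: add_nonneg_pos)
    have "s * d = s\<^sup>2 * ((norm x)\<^sup>2 + 1)"
      using p by (simp add: s_def power2_eq_square)
    moreover have "s\<^sup>2 > 0"
      using p neq by (simp add: s_def d_def)
    moreover have "s\<^sup>2 * (norm x)\<^sup>2 \<ge> 0"
      by simp
    ultimately show False
      by (simp add: algebra_simps)
  qed
  have "L x = cinner x u" for x
  proof (rule complex_eqI)
    have *: "Re (cinner u y) = Re (cinner y u)" for y
      by (subst cinner_commute) simp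
    show "Re (L x) = Re (cinner x u)"
      using Re_eq * by simp
    \<comment> \<open>Rotating \<open>x\<close> by \<i> turns imaginary parts into real parts, in
      the same way on both sides since both are antilinear.\<close>
    have "Re (L (\<i> *\<^sub>C x)) = Re (cinner (\<i> *\<^sub>C x) u)"
      using Re_eq * by simp
    then show "Im (L x) = Im (cinner x u)"
      by (simp add: scale cinner_scaleC_left)
  qed
  then show ?thesis
    by blast
qed

section \<open>Bounded Borel functions\<close>

text \<open>Boundedness is pointwise rather than essential, so the same class of functions serves
  every spectral measure, and two measures can be compared on it.\<close>

definition bborel :: "(real \<Rightarrow> complex) \<Rightarrow> bool" where
  "bborel f \<longleftrightarrow> f \<in> borel_measurable borel \<and> bounded (range f)"

lemma bborelI:
  assumes "f \<in> borel_measurable borel" "\<And>x. cmod (f x) \<le> C"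
  shows "bborel f"
  using assms unfolding bborel_def bounded_iff by auto

lemma bborelD:
  assumes "bborel f"
  shows "f \<in> borel_measurable borel" "\<exists>C. \<forall>x. cmod (f x) \<le> C"
  using assms unfolding bborel_def bounded_iff by auto

lemma bborel_indicator [simp]: "B \<in> sets borel \<Longrightarrow> bborel (indicator B)"
  by (rule bborelI[where C = 1]) (auto simp: indicator_def)

lemma bborel_const [simp]: "bborel (\<lambda>x. c)"
  by (rule bborelI[where C = "cmod c"]) auto

lemma bborel_add [intro]: "bborel f \<Longrightarrow> bborel g \<Longrightarrow> bborel (\<lambda>x. f x + g x)"
  unfolding bborel_def by (auto simp: bounded_plus_comp)


lemma bborel_mult [intro]:
  assumes f: "bborel f" and g: "bborel g"
  shows "bborel (\<lambda>x. f x * g x)"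
proof -
  obtain C D where C: "\<And>x. cmod (f x) \<le> C" and D: "\<And>x. cmod (g x) \<le> D"
    using bborelD(2)[OF f] bborelD(2)[OF g] by blast
  have "cmod (f x * g x) \<le> C * D" for x
    unfolding norm_mult using C D order_trans[OF norm_ge_zero C] by (intro mult_mono) auto
  then show ?thesis
    using bborelD(1)[OF f] bborelD(1)[OF g] by (intro bborelI) auto
qed

lemma bborel_cnj [intro]: "bborel f \<Longrightarrow> bborel (\<lambda>x. cnj (f x))"
  unfolding bborel_def
  by (auto simp: bounded_iff intro: borel_measurable_continuous_on[OF continuous_on_cnj[OF continuous_on_id]])

lemma bborel_diff [intro]: "bborel f \<Longrightarrow> bborel g \<Longrightarrow> bborel (\<lambda>x. f x - g x)"
  using bborel_add[of f "\<lambda>x. -1 * g x"] bborel_mult[of "\<lambda>x. -1" g] by simp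

lemma bborel_norm2 [intro]: "bborel f \<Longrightarrow> bborel (\<lambda>x. complex_of_real ((cmod (f x))\<^sup>2))"
  unfolding complex_norm_square by auto

lemma bborel_sum [intro]: "(\<And>i. i \<in> I \<Longrightarrow> bborel (f i)) \<Longrightarrow> bborel (\<lambda>x. \<Sum>i\<in>I. f i x)"
  by (induction I rule: infinite_finite_induct) auto

text \<open>Simple functions converging pointwise to \<open>f\<close> can be chosen with modulus at
  most \<open>2 * cmod (f x)\<close>, hence uniformly bounded. Identities of the calculus thereby
  reduce to the projections \<open>E B\<close>, as long as both sides pass to bounded pointwise
  limits.\<close>

lemma bborel_induct [consumes 1, case_names indicator add scale lim]:
  assumes "bborel f"
    and ind: "\<And>B. B \<in> sets borel \<Longrightarrow> P (indicator B)"
    and add: "\<And>f g. bborel f \<Longrightarrow> bborel g \<Longrightarrow> P f \<Longrightarrow> P g \<Longrightarrow> P (\<lambda>x. f x + g x)"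
    and scale: "\<And>c f. bborel f \<Longrightarrow> P f \<Longrightarrow> P (\<lambda>x. c * f x)"
    and lim: "\<And>F f C. \<lbrakk>\<And>n. bborel (F n); bborel f; \<And>n x. cmod (F n x) \<le> C;
      \<And>x. (\<lambda>n::nat. F n x) \<longlonglongrightarrow> f x; \<And>n. P (F n)\<rbrakk> \<Longrightarrow> P f"
  shows "P f"
proof -
  obtain C where C: "\<And>x. cmod (f x) \<le> C" and f: "f \<in> borel_measurable borel"
    using bborelD[OF assms(1)] by blast
  obtain F where F: "\<And>i. simple_function borel (F i)" "\<And>x. (\<lambda>i. F i x) \<longlonglongrightarrow> f x"
    and F_le: "\<And>i x. cmod (F i x) \<le> 2 * cmod (f x)"
    using borel_measurable_implies_sequence_metric[OF f, of 0] by (auto simp: dist_norm)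
  have bF: "cmod (F i x) \<le> 2 * C" for i x
    using F_le[of i x] C[of x] by linarith
  have F_bborel: "bborel (F i)" for i
    using bF F(1) by (auto intro!: bborelI[where C = "2 * C"] borel_measurable_simple_function)
  have "P (F i)" for i
  proof -
    have fin: "finite (range (F i))"
      using simple_functionD(1)[OF F(1)[of i]] by simp
    have B: "F i -` {y} \<in> sets borel" for y
      using simple_functionD(2)[OF F(1)[of i], of "{y}"] by simp
    have "bborel (\<lambda>x. \<Sum>y\<in>Y. y * indicator (F i -` {y}) x) \<and>
        P (\<lambda>x. \<Sum>y\<in>Y. y * indicator (F i -` {y}) x)" if "finite Y" for Y
      using that
    proof (induction Y)
      case empty
      have "P (\<lambda>x. 0 * indicator UNIV x)"
        by (intro scale ind bborel_indicator) auto
      then show ?case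
        by simp
    next
      case (insert y Y)
      have "bborel (\<lambda>x. y * indicator (F i -` {y}) x)" "P (\<lambda>x. y * indicator (F i -` {y}) x)"
        using B by (auto intro!: scale ind)
      then show ?case
        unfolding sum.insert[OF insert.hyps(1,2)] using insert.IH bborel_add add by meson
    qed
    from this[OF fin] have "P (\<lambda>x. \<Sum>y\<in>range (F i). y * indicator (F i -` {y}) x)"
      by blast
    moreover have "(\<Sum>y\<in>range (F i). y * indicator (F i -` {y}) x) = F i x" for x
    proof -
      have "(\<Sum>y\<in>range (F i). y * indicator (F i -` {y}) x)
          = (\<Sum>y\<in>{F i x}. y * indicator (F i -` {y}) x)"
        by (rule sum.mono_neutral_right[OF fin]) (auto simp: indicator_def)
      then show ?thesis
        by simp
    qed
    ultimately show ?thesis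
      by simp
  qed
  then show ?thesis
    using lim[of F f "2 * C"] F_bborel bF F(2) assms(1) by blast
qed

text \<open>A monotone class argument: polynomials in \<open>r\<close>, then continuous functions of \<open>r\<close> by
  Weierstrass, then indicators of half-lines.\<close>

lemma bborel_generated:
  fixes r :: "real \<Rightarrow> real"
  assumes "bborel f"
    and r: "strict_mono r" "\<And>x. \<bar>r x\<bar> \<le> 1" "r \<in> borel_measurable borel"
    and P_r: "P (\<lambda>x. complex_of_real (r x))" and P_one: "P (\<lambda>x. 1)"
    and add: "\<And>f g. bborel f \<Longrightarrow> bborel g \<Longrightarrow> P f \<Longrightarrow> P g \<Longrightarrow> P (\<lambda>x. f x + g x)"
    and mult: "\<And>f g. bborel f \<Longrightarrow> bborel g \<Longrightarrow> P f \<Longrightarrow> P g \<Longrightarrow> P (\<lambda>x. f x * g x)"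
    and scale: "\<And>c f. bborel f \<Longrightarrow> P f \<Longrightarrow> P (\<lambda>x. c * f x)"
    and lim: "\<And>F f C. \<lbrakk>\<And>n. bborel (F n); bborel f; \<And>n x. cmod (F n x) \<le> C;
      \<And>x. (\<lambda>n::nat. F n x) \<longlonglongrightarrow> f x; \<And>n. P (F n)\<rbrakk> \<Longrightarrow> P f"
  shows "P f"
proof -
  have r': "r x \<in> {-1..1}" for x
    using r(2)[of x] by auto
  have bb_cont: "bborel (\<lambda>x. complex_of_real (g (r x)))" if g: "continuous_on {-1..1} g" for g
  proof -
    have "bounded (g ` {-1..1})"
      using compact_continuous_image[OF g] compact_imp_bounded by blast
    then obtain C where "\<And>y. y \<in> {-1..1} \<Longrightarrow> \<bar>g y\<bar> \<le> C"
      unfolding bounded_iff real_norm_def by blast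
    moreover have "(\<lambda>x. g (r x)) \<in> borel_measurable borel"
      by (rule measurable_compose_rev[OF borel_measurable_continuous_on_restrict[OF g]])
        (use r(3) r' in \<open>auto intro!: measurable_restrict_space2\<close>)
    ultimately show ?thesis
      using r' by (intro bborelI[where C = C]) auto
  qed
  have P_const: "P (\<lambda>x. c)" for c
    using scale[OF _ P_one, of c] by simp
  have poly: "bborel (\<lambda>x. complex_of_real (p (r x))) \<and> P (\<lambda>x. complex_of_real (p (r x)))"
    if "real_polynomial_function p" for p
    using that
  proof induction
    case (linear l)
    then obtain c where c: "l = (\<lambda>x. x * c)"
      using real_bounded_linear by blast
    have bb: "bborel (\<lambda>x. complex_of_real (r x))"
      by (rule bb_cont) simp
    then have "bborel (\<lambda>x. complex_of_real c * complex_of_real (r x))"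
      by (intro bborel_mult) auto
    moreover have "P (\<lambda>x. complex_of_real c * complex_of_real (r x))"
      by (rule scale[OF bb P_r])
    ultimately show ?case
      by (simp add: c mult.commute)
  next
    case (const c)
    then show ?case
      by (simp add: P_const)
  next
    case (add f g)
    then show ?case
      using assms(7)[of "\<lambda>x. complex_of_real (f (r x))" "\<lambda>x. complex_of_real (g (r x))"]
      by (simp add: bborel_add)
  next
    case (mult f g)
    then show ?case
      using assms(8)[of "\<lambda>x. complex_of_real (f (r x))" "\<lambda>x. complex_of_real (g (r x))"]
      by (simp add: bborel_mult)
  qed
  have cont: "P (\<lambda>x. complex_of_real (g (r x)))" if g: "continuous_on {-1..1} g" for g
  proof -
    define Q where "Q n p \<longleftrightarrow> real_polynomial_function p \<and>
      (\<forall>x\<in>{-1..1}. \<bar>g x - p x\<bar> < 1 / real (Suc n))" for n p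
    have "\<exists>p. Q n p" for n
    proof -
      have "0 < 1 / real (Suc n)"
        by simp
      then obtain q where "real_polynomial_function q"
          "\<And>x. x \<in> {-1..1} \<Longrightarrow> \<bar>g x - q x\<bar> < 1 / real (Suc n)"
        using Stone_Weierstrass_real_polynomial_function[OF compact_Icc g] by metis
      then show ?thesis
        unfolding Q_def by (intro exI[of _ q]) simp
    qed
    then obtain p where "\<And>n. Q n (p n)"
      by metis
    then have p: "\<And>n. real_polynomial_function (p n)"
        "\<And>n x. x \<in> {-1..1} \<Longrightarrow> \<bar>g x - p n x\<bar> < 1 / real (Suc n)"
      unfolding Q_def by auto
    obtain C where C: "\<And>x. cmod (complex_of_real (g (r x))) \<le> C"
      using bborelD(2)[OF bb_cont[OF g]] by blast
    show ?thesis
    proof (rule lim)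
      show "cmod (complex_of_real (p n (r x))) \<le> C + 1" for n x
      proof -
        have "1 / real (Suc n) \<le> 1"
          by simp
        then show ?thesis
          using C[of x] p(2)[OF r'[of x], of n] unfolding norm_of_real by linarith
      qed
      show "(\<lambda>n. complex_of_real (p n (r x))) \<longlonglongrightarrow> complex_of_real (g (r x))" for x
      proof (rule tendsto_of_real)
        have "(\<lambda>n. p n (r x) - g (r x)) \<longlonglongrightarrow> 0"
        proof (rule Lim_null_comparison)
          show "(\<lambda>n. 1 / real (Suc n)) \<longlonglongrightarrow> 0"
            by (intro LIMSEQ_Suc lim_1_over_n)
          show "\<forall>\<^sub>F n in sequentially. norm (p n (r x) - g (r x)) \<le> 1 / real (Suc n)"
            using p(2)[OF r'[of x]] by (intro always_eventually allI)
              (simp add: abs_minus_commute less_imp_le del: of_nat_Suc)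
        qed
        then show "(\<lambda>n. p n (r x)) \<longlonglongrightarrow> g (r x)"
          using LIM_zero_iff by blast
      qed
    qed (use poly p(1) bb_cont[OF g] in auto)
  qed
  have half: "P (indicator {a<..})" for a
  proof (rule lim)
    \<comment> \<open>Ramps that vanish up to \<open>r a\<close> and rise to 1 with slope
      \<open>n\<close>. Strict monotonicity of \<open>r\<close> gives \<open>r x > r a\<close>
      exactly for \<open>x > a\<close>, so their limit is the indicator of the open
      half-line.\<close>
    let ?g = "\<lambda>n s. min 1 (max 0 (real n * (s - r a)))"
    have cg: "continuous_on {-1..1} (?g n)" for n
      by (intro continuous_intros)
    show "bborel (\<lambda>x. complex_of_real (?g n (r x)))" "P (\<lambda>x. complex_of_real (?g n (r x)))" for n
      by (rule bb_cont[OF cg], rule cont[OF cg])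
    show "cmod (complex_of_real (?g n (r x))) \<le> 1" for n x
      by simp
    show "(\<lambda>n. complex_of_real (?g n (r x))) \<longlonglongrightarrow> indicator {a<..} x" for x
    proof (cases "x > a")
      case True
      then have pos: "r x - r a > 0"
        using r(1) by (simp add: strict_mono_less)
      obtain N where N: "1 / (r x - r a) < real N"
        using reals_Archimedean2 by blast
      have "complex_of_real (?g n (r x)) = indicator {a<..} x" if "n \<ge> N" for n
      proof -
        have "1 / (r x - r a) < real n"
          using N that by linarith
        then have "1 < real n * (r x - r a)"
          using pos by (simp add: field_simps)
        then show ?thesis
          using True by simp
      qed
      then show ?thesis
        by (intro tendsto_eventually) (auto simp: eventually_sequentially)
    next
      case False
      then have "r x - r a \<le> 0"
        using r(1) by (simp add: strict_mono_less_eq)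
      then have "?g n (r x) = 0" for n
        by (simp add: mult_nonneg_nonpos)
      then show ?thesis
        using False by simp
    qed
  qed simp
  \<comment> \<open>Open half-lines form an intersection-stable generator of the Borel sets, so
    Dynkin's theorem leaves only complements and disjoint unions.\<close>
  have ind: "P (indicator B)" if "B \<in> sets borel" for B
  proof -
    have eq: "sets borel = sigma_sets UNIV (range (\<lambda>a::real. {a<..}))"
      by (subst borel_Ioi) simp
    have "Int_stable (range (\<lambda>a::real. {a<..}))"
    proof -
      have "{a<..} \<inter> {b<..} = {max a b<..}" for a b :: real
        by auto
      then show ?thesis
        unfolding Int_stable_def by auto
    qed
    moreover have "range (\<lambda>a::real. {a<..}) \<subseteq> Pow UNIV"
      by simp
    moreover have "B \<in> sigma_sets UNIV (range (\<lambda>a::real. {a<..}))"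
      using that eq by simp
    ultimately show ?thesis
    proof (induction rule: sigma_sets_induct_disjoint)
      case (basic A)
      then show ?case
        using half by auto
    next
      case empty
      then show ?case
        using P_const[of 0] by (simp add: indicator_def)
    next
      case (compl A)
      then have A: "A \<in> sets borel"
        using eq by simp
      have "P (\<lambda>x. 1 + (-1) * indicator A x)"
        by (intro add scale P_one bborel_mult bborel_const bborel_indicator compl.IH A)
      moreover have "(\<lambda>x. 1 + (-1) * indicator A x) = (indicator (UNIV - A) :: real \<Rightarrow> complex)"
        by (auto simp: indicator_def)
      ultimately show ?case
        by simp
    next
      case (union A)
      have A: "A i \<in> sets borel" for i
        using union(2) unfolding eq[symmetric] by auto
      have ind_sum: "(\<lambda>x. \<Sum>i<n. indicator (A i) x) = (indicator (\<Union>i<n. A i) :: real \<Rightarrow> complex)" for n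
        using union(1) by (auto simp: indicator_UN_disjoint disjoint_family_on_def)
      have "P (\<lambda>x. \<Sum>i<n. indicator (A i) x)" for n
      proof (induction n)
        case 0
        then show ?case
          by (simp add: P_const)
      next
        case (Suc n)
        have "bborel (\<lambda>x. \<Sum>i<n. indicator (A i) x)"
          using A by auto
        then show ?case
          using add[OF _ _ Suc union(3)[of n]] A by auto
      qed
      then have P_part: "P (indicator (\<Union>i<n. A i))" for n
        unfolding ind_sum .
      show ?case
      proof (rule lim[where C = 1])
        show "(\<lambda>n. indicator (\<Union>i<n. A i) x :: complex) \<longlonglongrightarrow> indicator (\<Union>i. A i) x" for x
          by (rule LIMSEQ_indicator_UN)
        show "cmod (indicator (\<Union>i<n. A i) x) \<le> 1" for n x
          by (simp add: indicator_def)
      qed (use A P_part in auto)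
    qed
  qed
  show ?thesis
    using assms(1)
  proof (induction rule: bborel_induct)
    case (lim F f C)
    then show ?case
      by (rule assms(10))
  qed (simp_all add: ind add scale)
qed

section \<open>Bounded functional calculus\<close>

text \<open>The weight \<open>\<i> ^ k\<close> cancels the conjugate phase in front of
  \<open>cinner y x\<close>, while \<open>cinner x y\<close> gets the phase
  \<open>\<i> ^ (2 * k)\<close>, which sums to zero. The antilinear slot therefore goes to
  \<open>y\<close>, as in \<open>spectral_form E f w v\<close>.\<close>

lemma polarization:
  "(\<Sum>k<4. \<i> ^ k * cinner (x + \<i> ^ k *\<^sub>C y) (x + \<i> ^ k *\<^sub>C y)) / 4 = cinner y (x::'a::complex_hilbert)"
proof -
  have "\<i> ^ 3 = - \<i>"
    by (simp add: power3_eq_cube)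
  moreover have "{..<4::nat} = {0, 1, 2, 3}"
    by auto
  ultimately show ?thesis
    by (simp add: cinner_add_left cinner_add_right cinner_scaleC_left cinner_scaleC_right
        algebra_simps)
qed

text \<open>The operator \<integral> f dE as a total function on vectors. For bounded Borel
  \<open>f\<close> the choice is made among Riesz vectors and is unique; otherwise the value is
  unspecified.\<close>

definition bcalc ::
  "(real set \<Rightarrow> 'a::complex_hilbert \<Rightarrow> 'a) \<Rightarrow> (real \<Rightarrow> complex) \<Rightarrow> 'a \<Rightarrow> 'a" where
  "bcalc E f v = (SOME u. \<forall>w. cinner w u = spectral_form E f w v)"

locale pvm =
  fixes E :: "real set \<Rightarrow> 'a::complex_hilbert \<Rightarrow> 'a"
  assumes pvm: "projection_valued_measure E"
begin

section \<open>Algebra of the spectral projections\<close>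

lemma E_clinear: "B \<in> sets borel \<Longrightarrow> bounded_clinear (E B)"
  using pvm unfolding projection_valued_measure_def orthogonal_projection_def by blast

lemma E_idem: "B \<in> sets borel \<Longrightarrow> E B (E B x) = E B x"
  using pvm unfolding projection_valued_measure_def orthogonal_projection_def by blast

lemma E_sym: "B \<in> sets borel \<Longrightarrow> cinner x (E B y) = cinner (E B x) y"
  using pvm unfolding projection_valued_measure_def orthogonal_projection_def by blast

lemma E_UNIV [simp]: "E UNIV v = v"
  using pvm unfolding projection_valued_measure_def by blast

lemma E_sums:
  "range B \<subseteq> sets borel \<Longrightarrow> disjoint_family B \<Longrightarrow> (\<lambda>n::nat. E (B n) v) sums E (\<Union>n. B n) v"
  using pvm unfolding projection_valued_measure_def by blast

text \<open>Countably many copies of the empty set are disjoint, so a series with constant terms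
  converges, and its terms must tend to zero.\<close>

lemma E_empty [simp]: "E {} v = 0"
proof -
  have "(\<lambda>n::nat. E {} v) sums E (\<Union>n::nat. {}) v"
    by (rule E_sums) (auto simp: disjoint_family_on_def)
  then have "(\<lambda>n::nat. E {} v) \<longlonglongrightarrow> 0"
    using sums_summable summable_LIMSEQ_zero by blast
  then show ?thesis
    using LIMSEQ_const_iff by blast
qed

lemma E_Un:
  assumes "A \<in> sets borel" "B \<in> sets borel" "A \<inter> B = {}"
  shows "E (A \<union> B) v = E A v + E B v"
proof -
  have "(\<lambda>n. E (binaryset A B n) v) sums E (\<Union>n. binaryset A B n) v"
    by (rule E_sums) (use assms in \<open>auto simp: range_binaryset_eq disjoint_family_on_def binaryset_def\<close>)
  moreover have "(\<lambda>n. E (binaryset A B n) v) sums (\<Sum>n<2. E (binaryset A B n) v)"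
    by (rule sums_finite) (auto simp: binaryset_def)
  ultimately show ?thesis
    using sums_unique2 by (fastforce simp: UN_binaryset_eq binaryset_def numeral_2_eq_2)
qed

text \<open>If \<open>P\<close>, \<open>Q\<close> and \<open>P + Q\<close> are projections then \<open>PQ + QP = 0\<close>; multiplying by \<open>P\<close> on either
  side gives \<open>PQ = QP\<close>.\<close>

lemma E_disjoint:
  assumes A: "A \<in> sets borel" and B: "B \<in> sets borel" and "A \<inter> B = {}"
  shows "E A (E B v) = 0"
proof -
  note lin = bounded_clinearD(2)[OF E_clinear]
  have anti: "E A (E B x) + E B (E A x) = 0" for x
  proof -
    have "E (A \<union> B) (E (A \<union> B) x) = E (A \<union> B) x"
      using A B by (intro E_idem) auto
    then show ?thesis
      unfolding E_Un[OF assms] by (simp add: lin A B E_idem algebra_simps)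
  qed
  have "E A (E B v) + E A (E B (E A v)) = 0"
    using arg_cong[OF anti[of v], of "E A"] by (simp add: lin A E_idem bounded_clinearD(4)[OF E_clinear])
  then have 1: "E A (E B v) = - E A (E B (E A v))"
    by (rule eq_neg_iff_add_eq_0[THEN iffD2])
  have "E B (E A v) + E A (E B (E A v)) = 0"
    using anti[of "E A v"] by (simp add: A E_idem add.commute)
  then have "E B (E A v) = - E A (E B (E A v))"
    by (rule eq_neg_iff_add_eq_0[THEN iffD2])
  with 1 have "E A (E B v) = E B (E A v)"
    by simp
  then have "2 *\<^sub>R E A (E B v) = 0"
    using anti[of v] by (simp add: scaleR_2)
  then show ?thesis
    by simp
qed

text \<open>Split both sets along their intersection; every cross term pairs disjoint sets and
  vanishes.\<close>

lemma E_Int: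
  assumes A: "A \<in> sets borel" and B: "B \<in> sets borel"
  shows "E A (E B v) = E (A \<inter> B) v"
proof -
  have 1: "E A x = E (A \<inter> B) x + E (A - B) x" for x
    using E_Un[of "A \<inter> B" "A - B"] A B by (simp add: Int_Diff_disjoint Int_Diff_Un)
  have 2: "E B v = E (A \<inter> B) v + E (B - A) v"
    using E_Un[of "B \<inter> A" "B - A"] A B
    by (simp add: Int_Diff_disjoint Int_Diff_Un Int_commute[of A B])
  have "E A (E B v) = E (A \<inter> B) (E B v)"
    unfolding 1[of "E B v"] using E_disjoint[of "A - B" B v] A B by auto
  also have "\<dots> = E (A \<inter> B) v"
    unfolding 2 using E_disjoint[of "A \<inter> B" "B - A" v] A B E_idem[of "A \<inter> B"]
    by (auto simp: bounded_clinearD(2)[OF E_clinear])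
  finally show ?thesis .
qed

section \<open>Scalar spectral measures\<close>

lemma cinner_E_E: "B \<in> sets borel \<Longrightarrow> cinner (E B w) (E B v) = cinner w (E B v)"
  by (simp add: E_idem flip: E_sym)

lemma cinner_E_self: "B \<in> sets borel \<Longrightarrow> cinner v (E B v) = complex_of_real ((norm (E B v))\<^sup>2)"
  using cinner_E_E[of B v v] by (simp add: cinner_self)

lemma sets_scalar [simp, measurable_cong]: "sets (scalar_measure E v) = sets borel"
  unfolding scalar_measure_def
  using sets.sigma_sets_eq[of "borel :: real measure"] by (simp add: sets_measure_of_conv)

lemma space_scalar [simp]: "space (scalar_measure E v) = UNIV"
  unfolding scalar_measure_def by (simp add: space_measure_of_conv)

text \<open>\<open>measure_of\<close> has the prescribed values only when these are countably
  additive. Additivity is the image of \<open>E_sums\<close> under the real linear functional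
  \<open>Re (cinner v _)\<close>, and positivity holds because \<open>cinner v (E B v)\<close> is a
  squared norm.\<close>

lemma emeasure_scalar:
  assumes "B \<in> sets borel"
  shows "emeasure (scalar_measure E v) B = ennreal ((norm (E B v))\<^sup>2)"
proof -
  have "emeasure (scalar_measure E v) B = ennreal (Re (cinner v (E B v)))"
    unfolding scalar_measure_def
  proof (rule emeasure_measure_of_sigma[OF _ _ _ assms])
    show "sigma_algebra UNIV (sets (borel :: real measure))"
      using sets.sigma_algebra_axioms[of "borel :: real measure"] by simp
    show "positive (sets borel) (\<lambda>B. ennreal (Re (cinner v (E B v))))"
      by (simp add: positive_def)
    show "countably_additive (sets borel) (\<lambda>B. ennreal (Re (cinner v (E B v))))"
    proof (rule countably_additiveI)
      fix A :: "nat \<Rightarrow> real set"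
      assume A: "range A \<subseteq> sets borel" "disjoint_family A"
      have "bounded_linear (\<lambda>u. Re (cinner v u))"
        by (intro bounded_linear_compose[OF bounded_linear_Re]
            bounded_bilinear.bounded_linear_right[OF bounded_bilinear_cinner])
      from bounded_linear.sums[OF this E_sums[OF A, of v]]
      have "(\<lambda>n. Re (cinner v (E (A n) v))) sums Re (cinner v (E (\<Union>n. A n) v))" .
      moreover have "Re (cinner v (E B v)) \<ge> 0" if "B \<in> sets borel" for B
        using that by (simp add: cinner_E_self)
      ultimately have "(\<lambda>n. ennreal (Re (cinner v (E (A n) v)))) sums ennreal (Re (cinner v (E (\<Union>n. A n) v)))"
        using A(1) by (subst sums_ennreal) auto
      then show "(\<Sum>n. ennreal (Re (cinner v (E (A n) v)))) = ennreal (Re (cinner v (E (\<Union>n. A n) v)))"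
        by (simp add: sums_iff)
    qed
  qed
  then show ?thesis
    by (simp add: cinner_E_self assms)
qed

lemma finite_measure_scalar: "finite_measure (scalar_measure E v)"
  by (rule finite_measureI) (simp add: emeasure_scalar)

lemma measure_scalar: "B \<in> sets borel \<Longrightarrow> measure (scalar_measure E v) B = (norm (E B v))\<^sup>2"
  by (simp add: measure_def emeasure_scalar)

lemma integrable_bborel: "bborel f \<Longrightarrow> integrable (scalar_measure E v) f"
  using bborelD(2)[of f] bborelD(1)[of f]
  by (auto intro!: finite_measure.integrable_const_bound[OF finite_measure_scalar])

lemma integral_bborel_le:
  assumes "bborel f" "\<And>x. cmod (f x) \<le> C"
  shows "cmod (integral\<^sup>L (scalar_measure E v) f) \<le> C * (norm v)\<^sup>2"
proof -
  interpret finite_measure "scalar_measure E v"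
    by (rule finite_measure_scalar)
  have "cmod (integral\<^sup>L (scalar_measure E v) f) \<le> (\<integral>x. C \<partial>scalar_measure E v)"
    using assms by (intro Bochner_Integration.integral_norm_bound_integral integrable_bborel) auto
  also have "\<dots> = C * (norm v)\<^sup>2"
    by (simp add: measure_scalar)
  finally show ?thesis .
qed

lemma integral_bborel_lim:
  assumes "\<And>n. bborel (F n)" "bborel f" "\<And>n x. cmod (F n x) \<le> C" "\<And>x. (\<lambda>n. F n x) \<longlonglongrightarrow> f x"
  shows "(\<lambda>n. integral\<^sup>L (scalar_measure E v) (F n)) \<longlonglongrightarrow> integral\<^sup>L (scalar_measure E v) f"
proof -
  interpret finite_measure "scalar_measure E v"
    by (rule finite_measure_scalar)
  show ?thesis
    by (rule integral_dominated_convergence[where w = "\<lambda>x. C"])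
      (use assms bborelD(1) in auto)
qed

lemma integral_indicator_scalar:
  assumes "B \<in> sets borel"
  shows "integral\<^sup>L (scalar_measure E v) (indicator B) = cinner (E B v) (E B v)"
proof -
  interpret finite_measure "scalar_measure E v"
    by (rule finite_measure_scalar)
  have "integral\<^sup>L (scalar_measure E v) (\<lambda>x. indicator B x *\<^sub>R (1::complex))
      = measure (scalar_measure E v) B *\<^sub>R 1"
    using assms by (intro has_bochner_integral_integral_eq has_bochner_integral_indicator)
      (auto simp: emeasure_scalar)
  moreover have "(\<lambda>x. indicator B x *\<^sub>R (1::complex)) = indicator B"
    by (auto simp: indicator_def)
  ultimately have "integral\<^sup>L (scalar_measure E v) (indicator B)
      = measure (scalar_measure E v) B *\<^sub>R (1::complex)"
    by (simp only:)
  then show ?thesis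
    using assms by (simp add: measure_scalar cinner_self scaleR_conv_of_real)
qed

section \<open>The sesquilinear form of a bounded Borel function\<close>

lemma form_indicator:
  assumes "B \<in> sets borel"
  shows "spectral_form E (indicator B) w v = cinner w (E B v)"
  unfolding spectral_form_def integral_indicator_scalar[OF assms]
    bounded_clinearD(2)[OF E_clinear[OF assms]] bounded_clinearD(5)[OF E_clinear[OF assms]]
    polarization cinner_E_E[OF assms] ..

lemma form_add:
  assumes "bborel f" "bborel g"
  shows "spectral_form E (\<lambda>x. f x + g x) w v = spectral_form E f w v + spectral_form E g w v"
  unfolding spectral_form_def using assms
  by (simp add: integrable_bborel sum.distrib distrib_left add_divide_distrib)

lemma form_scale: "spectral_form E (\<lambda>x. c * f x) w v = c * spectral_form E f w v"
  unfolding spectral_form_def by (simp add: sum_distrib_left mult_ac)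

lemma form_lim:
  assumes "\<And>n. bborel (F n)" "bborel f" "\<And>n x. cmod (F n x) \<le> C" "\<And>x. (\<lambda>n. F n x) \<longlonglongrightarrow> f x"
  shows "(\<lambda>n. spectral_form E (F n) w v) \<longlonglongrightarrow> spectral_form E f w v"
  unfolding spectral_form_def by (intro tendsto_intros integral_bborel_lim[OF assms]) simp

text \<open>On indicators this is the self-adjointness of \<open>E B\<close>. It serves to carry
  linearity in the right slot over to antilinearity in the left slot.\<close>

lemma form_cnj:
  assumes "bborel f"
  shows "spectral_form E (\<lambda>x. cnj (f x)) v w = cnj (spectral_form E f w v)"
  using assms
proof (induction rule: bborel_induct)
  case (indicator B)
  have "(\<lambda>x. cnj (indicator B x)) = indicator B"
    by (auto simp: indicator_def)
  then show ?case
    using indicator cinner_commute[of v "E B w"] by (simp add: form_indicator E_sym)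
next
  case (add f g)
  then show ?case
    by (simp add: form_add bborel_cnj)
next
  case (scale c f)
  then show ?case
    by (simp add: form_scale)
next
  case (lim F f C)
  show ?case
  proof (rule LIMSEQ_unique)
    show "(\<lambda>n. spectral_form E (\<lambda>x. cnj (F n x)) v w) \<longlonglongrightarrow> spectral_form E (\<lambda>x. cnj (f x)) v w"
      using lim by (intro form_lim[where C = C]) (auto intro!: tendsto_intros)
    show "(\<lambda>n. spectral_form E (\<lambda>x. cnj (F n x)) v w) \<longlonglongrightarrow> cnj (spectral_form E f w v)"
      unfolding lim.IH using lim by (intro tendsto_cnj form_lim) auto
  qed
qed

lemma form_add_right:
  assumes "bborel f"
  shows "spectral_form E f w (v + v') = spectral_form E f w v + spectral_form E f w v'"
  using assms
proof (induction rule: bborel_induct)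
  case (lim F f C)
  show ?case
  proof (rule LIMSEQ_unique)
    show "(\<lambda>n. spectral_form E (F n) w (v + v')) \<longlonglongrightarrow> spectral_form E f w (v + v')"
      using lim by (intro form_lim) auto
    show "(\<lambda>n. spectral_form E (F n) w (v + v')) \<longlonglongrightarrow> spectral_form E f w v + spectral_form E f w v'"
      unfolding lim.IH using lim by (intro tendsto_intros form_lim) auto
  qed
qed (simp_all add: form_indicator form_add form_scale cinner_add_right
    bounded_clinearD(2)[OF E_clinear] distrib_left)

lemma form_scaleC_right:
  assumes "bborel f"
  shows "spectral_form E f w (c *\<^sub>C v) = c * spectral_form E f w v"
  using assms
proof (induction rule: bborel_induct)
  case (lim F f C)
  show ?case
  proof (rule LIMSEQ_unique)
    show "(\<lambda>n. spectral_form E (F n) w (c *\<^sub>C v)) \<longlonglongrightarrow> spectral_form E f w (c *\<^sub>C v)"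
      using lim by (intro form_lim) auto
    show "(\<lambda>n. spectral_form E (F n) w (c *\<^sub>C v)) \<longlonglongrightarrow> c * spectral_form E f w v"
      unfolding lim.IH using lim by (intro tendsto_intros form_lim) auto
  qed
qed (simp_all add: form_indicator form_add form_scale cinner_scaleC_right
    bounded_clinearD(5)[OF E_clinear] distrib_left)

lemma form_add_left:
  "bborel f \<Longrightarrow> spectral_form E f (w + w') v = spectral_form E f w v + spectral_form E f w' v"
  using form_cnj[of "\<lambda>x. cnj (f x)"] form_add_right[of "\<lambda>x. cnj (f x)" v w w'] by (simp add: bborel_cnj)

lemma form_scaleC_left:
  "bborel f \<Longrightarrow> spectral_form E f (c *\<^sub>C w) v = cnj c * spectral_form E f w v"
  using form_cnj[of "\<lambda>x. cnj (f x)"] form_scaleC_right[of "\<lambda>x. cnj (f x)" v c w] by (simp add: bborel_cnj)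

text \<open>Polarization alone gives a bound that is not homogeneous in \<open>w\<close>, so
  \<open>w\<close> is first scaled to norm 1. The constant is crude but suffices for Riesz; the
  sharp one comes later from \<open>norm_bcalc\<close>.\<close>

lemma form_bound:
  assumes f: "bborel f" and C: "\<And>x. cmod (f x) \<le> C"
  shows "cmod (spectral_form E f w v) \<le> (C * (norm v + 1)\<^sup>2) * norm w"
proof (cases "w = 0")
  case True
  then show ?thesis
    using form_scaleC_left[OF f, of 0 w v] by simp
next
  case False
  have C0: "C \<ge> 0"
    using order_trans[OF norm_ge_zero C] .
  define u where "u = complex_of_real (1 / norm w) *\<^sub>C w"
  have u: "norm u = 1" "w = complex_of_real (norm w) *\<^sub>C u"
    unfolding u_def using False by (auto simp: scaleC_scaleC norm_divide)
  have "cmod (integral\<^sup>L (scalar_measure E (v + \<i> ^ k *\<^sub>C u)) f) \<le> C * (norm v + 1)\<^sup>2" for k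
  proof -
    have "norm (v + \<i> ^ k *\<^sub>C u) \<le> norm v + 1"
      using norm_triangle_ineq[of v "\<i> ^ k *\<^sub>C u"] u(1) by (simp add: norm_power)
    then have "C * (norm (v + \<i> ^ k *\<^sub>C u))\<^sup>2 \<le> C * (norm v + 1)\<^sup>2"
      using C0 by (intro mult_left_mono power_mono) auto
    then show ?thesis
      using integral_bborel_le[OF f C] order_trans by blast
  qed
  then have "cmod (\<Sum>k<4. \<i> ^ k * integral\<^sup>L (scalar_measure E (v + \<i> ^ k *\<^sub>C u)) f)
      \<le> (\<Sum>k<4::nat. C * (norm v + 1)\<^sup>2)"
    by (intro sum_norm_le) (simp add: norm_mult norm_power)
  then have "cmod (spectral_form E f u v) \<le> C * (norm v + 1)\<^sup>2"
    unfolding spectral_form_def by (simp add: norm_divide)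
  then show ?thesis
    using form_scaleC_left[OF f, of "complex_of_real (norm w)" u v, folded u(2)]
    by (simp add: norm_mult mult.commute mult_left_mono)
qed

section \<open>The operators of the bounded calculus\<close>

lemma cinner_bcalc:
  assumes f: "bborel f"
  shows "cinner w (bcalc E f v) = spectral_form E f w v"
proof -
  obtain C where "\<And>x. cmod (f x) \<le> C"
    using bborelD(2)[OF f] by blast
  then have "\<exists>u. \<forall>w. spectral_form E f w v = cinner w u"
    by (intro riesz_representation[where K = "C * (norm v + 1)\<^sup>2"])
      (auto simp: form_add_left form_scaleC_left f form_bound)
  then have "\<exists>u. \<forall>w. cinner w u = spectral_form E f w v"
    by metis
  from someI_ex[OF this] show ?thesis
    unfolding bcalc_def by blast
qed

lemma bcalc_indicator: "B \<in> sets borel \<Longrightarrow> bcalc E (indicator B) v = E B v"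
  by (rule cinner_eqI) (simp add: cinner_bcalc form_indicator)

lemma bcalc_one: "bcalc E (\<lambda>x. 1) v = v"
  using bcalc_indicator[of UNIV v] by (simp add: indicator_def[abs_def])

lemma bcalc_add_vec: "bborel f \<Longrightarrow> bcalc E f (v + w) = bcalc E f v + bcalc E f w"
  by (rule cinner_eqI) (simp add: cinner_bcalc form_add_right cinner_add_right)

lemma bcalc_scaleC_vec: "bborel f \<Longrightarrow> bcalc E f (c *\<^sub>C v) = c *\<^sub>C bcalc E f v"
  by (rule cinner_eqI) (simp add: cinner_bcalc form_scaleC_right cinner_scaleC_right)

lemma bcalc_add: "bborel f \<Longrightarrow> bborel g \<Longrightarrow> bcalc E (\<lambda>x. f x + g x) v = bcalc E f v + bcalc E g v"
  by (rule cinner_eqI) (simp add: cinner_bcalc form_add cinner_add_right bborel_add)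

lemma bcalc_scale: "bborel f \<Longrightarrow> bcalc E (\<lambda>x. c * f x) v = c *\<^sub>C bcalc E f v"
  by (rule cinner_eqI) (simp add: cinner_bcalc form_scale cinner_scaleC_right bborel_mult)

lemma bcalc_diff:
  assumes "bborel f" "bborel g"
  shows "bcalc E (\<lambda>x. f x - g x) v = bcalc E f v - bcalc E g v"
proof -
  have "bborel (\<lambda>x. - 1 * g x)"
    by (intro bborel_mult bborel_const assms)
  then have "bcalc E (\<lambda>x. f x + - 1 * g x) v = bcalc E f v + (- 1) *\<^sub>C bcalc E g v"
    by (simp only: bcalc_add bcalc_scale assms)
  then show ?thesis
    by (simp add: scaleC_minus_left)
qed

lemma bcalc_weak_lim:
  assumes "\<And>n. bborel (F n)" "bborel f" "\<And>n x. cmod (F n x) \<le> C" "\<And>x. (\<lambda>n. F n x) \<longlonglongrightarrow> f x"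
  shows "(\<lambda>n. cinner w (bcalc E (F n) v)) \<longlonglongrightarrow> cinner w (bcalc E f v)"
  unfolding cinner_bcalc[OF assms(1)] cinner_bcalc[OF assms(2)] by (rule form_lim[OF assms])

lemma cinner_bcalc_left:
  "bborel f \<Longrightarrow> cinner (bcalc E f w) v = cinner w (bcalc E (\<lambda>x. cnj (f x)) v)"
  by (subst cinner_commute) (simp add: cinner_bcalc form_cnj bborel_cnj)

text \<open>The case of multiplicativity with an indicator as left factor, from which
  \<open>bcalc_mult\<close> starts its induction on the other factor. Weak limits suffice, as
  \<open>E B\<close> can be moved to the other side of the inner product.\<close>

lemma E_bcalc:
  assumes "bborel g" and B: "B \<in> sets borel"
  shows "E B (bcalc E g v) = bcalc E (\<lambda>x. indicator B x * g x) v"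
  using assms(1)
proof (induction rule: bborel_induct)
  case (indicator A)
  have "(\<lambda>x. indicator B x * indicator A x :: complex) = indicator (B \<inter> A)"
    by (auto simp: indicator_def)
  then show ?case
    using indicator B by (simp add: bcalc_indicator E_Int)
next
  case (add f g)
  then show ?case
    using B by (simp add: bcalc_add bborel_mult bounded_clinearD(2)[OF E_clinear] distrib_left)
next
  case (scale c f)
  then show ?case
    using B bcalc_scale[of "\<lambda>x. indicator B x * f x" c v]
    by (simp add: bcalc_scale bborel_mult bounded_clinearD(5)[OF E_clinear] mult.left_commute)
next
  case (lim F f C)
  show ?case
  proof (rule cinner_eqI, rule LIMSEQ_unique)
    fix w
    show "(\<lambda>n. cinner w (E B (bcalc E (F n) v))) \<longlonglongrightarrow> cinner w (E B (bcalc E f v))"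
      unfolding E_sym[OF B] using lim by (intro bcalc_weak_lim) auto
    have "cmod (indicator B x * F n x) \<le> C" for n x
      using lim(3)[of n x] order_trans[OF norm_ge_zero lim(3)] by (auto simp: indicator_def)
    then show "(\<lambda>n. cinner w (E B (bcalc E (F n) v))) \<longlonglongrightarrow>
        cinner w (bcalc E (\<lambda>x. indicator B x * f x) v)"
      unfolding lim.IH using lim B by (intro bcalc_weak_lim) (auto intro!: tendsto_intros)
  qed
qed

lemma bcalc_mult:
  assumes "bborel f" and g: "bborel g"
  shows "bcalc E f (bcalc E g v) = bcalc E (\<lambda>x. f x * g x) v"
  using assms(1)
proof (induction rule: bborel_induct)
  case (indicator A)
  then show ?case
    using g by (simp add: bcalc_indicator E_bcalc)
next
  case (add f g)
  then show ?case
    using assms by (simp add: bcalc_add bborel_mult distrib_right)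
next
  case (scale c f)
  then show ?case
    using g bcalc_scale[of "\<lambda>x. f x * g x" c v] by (simp add: bcalc_scale bborel_mult mult.assoc)
next
  case (lim F f C)
  obtain D where D: "\<And>x. cmod (g x) \<le> D"
    using bborelD(2)[OF g] by blast
  show ?case
  proof (rule cinner_eqI, rule LIMSEQ_unique)
    fix w
    show "(\<lambda>n. cinner w (bcalc E (F n) (bcalc E g v))) \<longlonglongrightarrow> cinner w (bcalc E f (bcalc E g v))"
      using lim by (intro bcalc_weak_lim) auto
    have "cmod (F n x * g x) \<le> C * D" for n x
      unfolding norm_mult using lim(3) D order_trans[OF norm_ge_zero lim(3)] by (intro mult_mono) auto
    then show "(\<lambda>n. cinner w (bcalc E (F n) (bcalc E g v))) \<longlonglongrightarrow>
        cinner w (bcalc E (\<lambda>x. f x * g x) v)"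
      unfolding lim.IH using lim g by (intro bcalc_weak_lim) (auto intro!: tendsto_intros)
  qed
qed

text \<open>For \<open>w = v\<close> polarization involves the measures of
  \<open>v + \<i> ^ k *\<^sub>C v\<close>; comparison on indicators shows that they recombine to the
  measure of \<open>v\<close> itself.\<close>

lemma form_diag:
  assumes "bborel f"
  shows "spectral_form E f v v = integral\<^sup>L (scalar_measure E v) f"
  using assms
proof (induction rule: bborel_induct)
  case (indicator B)
  then show ?case
    by (simp add: form_indicator integral_indicator_scalar cinner_E_E)
next
  case (lim F f C)
  show ?case
  proof (rule LIMSEQ_unique)
    show "(\<lambda>n. spectral_form E (F n) v v) \<longlonglongrightarrow> spectral_form E f v v"
      using lim by (intro form_lim) auto
    show "(\<lambda>n. spectral_form E (F n) v v) \<longlonglongrightarrow> integral\<^sup>L (scalar_measure E v) f"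
      unfolding lim.IH using lim by (intro integral_bborel_lim) auto
  qed
qed (simp_all add: form_add form_scale integrable_bborel)

text \<open>Adjoints correspond to conjugates and compositions to products, so the squared norm is
  the diagonal of the form of \<open>cnj f * f\<close>. This isometry turns mean-square convergence
  of functions into strong convergence of operators.\<close>

lemma norm_bcalc:
  assumes f: "bborel f"
  shows "(norm (bcalc E f v))\<^sup>2 = (\<integral>x. (cmod (f x))\<^sup>2 \<partial>scalar_measure E v)"
proof -
  have "complex_of_real ((norm (bcalc E f v))\<^sup>2) = cinner v (bcalc E (\<lambda>x. cnj (f x) * f x) v)"
    unfolding cinner_self[symmetric] using f by (simp add: cinner_bcalc_left bcalc_mult bborel_cnj)
  also have "\<dots> = (\<integral>x. complex_of_real ((cmod (f x))\<^sup>2) \<partial>scalar_measure E v)"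
    using f by (simp add: cinner_bcalc form_diag bborel_mult bborel_cnj)
      (simp add: complex_norm_square[symmetric] mult.commute flip: of_real_power)
  finally show ?thesis
    unfolding integral_complex_of_real of_real_eq_iff .
qed

lemma norm_bcalc_le:
  assumes f: "bborel f" and C: "\<And>x. cmod (f x) \<le> C"
  shows "norm (bcalc E f v) \<le> C * norm v"
proof -
  interpret finite_measure "scalar_measure E v"
    by (rule finite_measure_scalar)
  have C0: "C \<ge> 0"
    using order_trans[OF norm_ge_zero C] .
  have "(norm (bcalc E f v))\<^sup>2 \<le> (\<integral>x. C\<^sup>2 \<partial>scalar_measure E v)"
    unfolding norm_bcalc[OF f]
    using integrable_bborel[OF bborel_norm2[OF f], THEN integrable_Re] C
    by (intro integral_mono) (auto simp: power_mono simp flip: of_real_power)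
  also have "\<dots> = (C * norm v)\<^sup>2"
    by (simp add: measure_scalar power_mult_distrib)
  finally show ?thesis
    by (rule power2_le_imp_le) (use C0 in simp)
qed

lemma bcalc_clinear:
  assumes "bborel f"
  shows "bounded_clinear (bcalc E f)"
proof -
  obtain C where "\<And>x. cmod (f x) \<le> C"
    using bborelD(2)[OF assms] by blast
  then show ?thesis
    using assms by (intro bounded_clinearI[where K = C] bcalc_add_vec bcalc_scaleC_vec norm_bcalc_le)
qed

lemma bcalc_lim:
  assumes F: "\<And>n. bborel (F n)" "bborel f" "\<And>n x. cmod (F n x) \<le> C" "\<And>x. (\<lambda>n. F n x) \<longlonglongrightarrow> f x"
  shows "(\<lambda>n. bcalc E (F n) v) \<longlonglongrightarrow> bcalc E f v"
proof -
  interpret finite_measure "scalar_measure E v"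
    by (rule finite_measure_scalar)
  obtain D where D: "\<And>x. cmod (f x) \<le> D"
    using bborelD(2)[OF F(2)] by blast
  have bb: "bborel (\<lambda>x. F n x - f x)" for n
    using F by auto
  have "(\<lambda>n. \<integral>x. (cmod (F n x - f x))\<^sup>2 \<partial>scalar_measure E v) \<longlonglongrightarrow> (\<integral>x. 0 \<partial>scalar_measure E v)"
  proof (rule integral_dominated_convergence[where w = "\<lambda>x. (C + D)\<^sup>2"])
    show "AE x in scalar_measure E v. (\<lambda>n. (cmod (F n x - f x))\<^sup>2) \<longlonglongrightarrow> 0"
      using tendsto_power[OF tendsto_norm_zero[OF LIM_zero[OF F(4)]], where n = 2] by simp
    have "cmod (F n x - f x) \<le> C + D" for n x
      using norm_triangle_ineq4[of "F n x" "f x"] F(3)[of n x] D[of x] by linarith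
    then show "AE x in scalar_measure E v. norm ((cmod (F n x - f x))\<^sup>2) \<le> (C + D)\<^sup>2" for n
      by (simp add: power_mono)
  qed (use bborelD(1)[OF bb] in auto)
  then have "(\<lambda>n. (norm (bcalc E (F n) v - bcalc E f v))\<^sup>2) \<longlonglongrightarrow> 0"
    unfolding norm_bcalc[OF bb, symmetric] using F by (simp add: bcalc_diff)
  then have "(\<lambda>n. norm (bcalc E (F n) v - bcalc E f v)) \<longlonglongrightarrow> 0"
    using tendsto_real_sqrt by fastforce
  then show ?thesis
    using LIM_zero_iff tendsto_norm_zero_iff by blast
qed

end

section \<open>Unbounded spectral integrals\<close>

text \<open>A cut-off adapted to \<open>f\<close>, so that truncation works for every Borel
  function, wherever it is unbounded.\<close>

definition level_set :: "(real \<Rightarrow> complex) \<Rightarrow> nat \<Rightarrow> real set" where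
  "level_set f n = {x. cmod (f x) \<le> real n}"

lemma level_set_borel [measurable]: "f \<in> borel_measurable borel \<Longrightarrow> level_set f n \<in> sets borel"
  unfolding level_set_def by measurable

lemma bborel_cut:
  assumes "f \<in> borel_measurable borel" "B \<in> sets borel" "\<And>x. x \<in> B \<Longrightarrow> cmod (f x) \<le> C"
  shows "bborel (\<lambda>x. indicator B x * f x)"
proof (rule bborelI[where C = "max C 0"])
  show "(\<lambda>x. indicator B x * f x) \<in> borel_measurable borel"
    using assms(1,2) by measurable
  show "cmod (indicator B x * f x) \<le> max C 0" for x
    using assms(3)[of x] by (auto simp: indicator_def le_max_iff_disj)
qed

lemma bborel_level:
  "f \<in> borel_measurable borel \<Longrightarrow> bborel (\<lambda>x. indicator (level_set f n) x * f x)"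
  by (rule bborel_cut[where C = "real n"]) (auto simp: level_set_def[of f n] intro: level_set_borel[unfolded level_set_def])

lemma level_set_eventually: "\<forall>\<^sub>F n in sequentially. x \<in> level_set f n"
proof -
  obtain N where "cmod (f x) \<le> real N"
    using real_arch_simple by blast
  then have "x \<in> level_set f n" if "n \<ge> N" for n
    using that unfolding level_set_def by auto
  then show ?thesis
    unfolding eventually_sequentially by blast
qed

lemma tendsto_indicator_mult:
  assumes "\<forall>\<^sub>F n in sequentially. x \<in> A n"
  shows "(\<lambda>n. indicator (A n) x * (c::complex)) \<longlonglongrightarrow> c"
  by (rule tendsto_eventually, rule eventually_mono[OF assms]) simp

context pvm
begin

lemma E_lim:
  assumes A: "\<And>n. A n \<in> sets borel" and ev: "\<And>x. \<forall>\<^sub>F n in sequentially. x \<in> A n"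
  shows "(\<lambda>n. E (A n) v) \<longlonglongrightarrow> v"
proof -
  have "(\<lambda>n. bcalc E (indicator (A n)) v) \<longlonglongrightarrow> bcalc E (\<lambda>x. 1) v"
  proof (rule bcalc_lim[where C = 1])
    show "(\<lambda>n. indicator (A n) x) \<longlonglongrightarrow> (1 :: complex)" for x
      using tendsto_indicator_mult[OF ev, of x 1] by simp
    show "cmod (indicator (A n) x) \<le> 1" for n x
      by (simp add: indicator_def)
  qed (use A in auto)
  then show ?thesis
    using A by (simp add: bcalc_indicator bcalc_one)
qed

text \<open>The squared norms of the truncations are integrals of an increasing sequence, so
  monotone convergence makes their boundedness equivalent to integrability. In this form the domain
  is visibly a subspace.\<close>

lemma spectral_domain_iff:
  assumes f: "f \<in> borel_measurable borel"
  shows "v \<in> spectral_domain E f \<longleftrightarrow>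
    (\<exists>C. \<forall>n. norm (bcalc E (\<lambda>x. indicator (level_set f n) x * f x) v) \<le> C)"
proof -
  let ?g = "\<lambda>n x. (cmod (indicator (level_set f n) x * f x))\<^sup>2"
  have g_int: "integrable (scalar_measure E v) (?g n)" for n
    using integrable_bborel[OF bborel_norm2[OF bborel_level[OF f, of n]], THEN integrable_Re] by simp
  have g_le: "?g n x \<le> (cmod (f x))\<^sup>2" for n x
    by (auto simp: indicator_def)
  have g_mono: "?g m x \<le> ?g n x" if "m \<le> n" for m n x
    using that by (auto simp: indicator_def level_set_def)
  have norm_g: "(norm (bcalc E (\<lambda>x. indicator (level_set f n) x * f x) v))\<^sup>2
      = integral\<^sup>L (scalar_measure E v) (?g n)" for n
    by (rule norm_bcalc[OF bborel_level[OF f]])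
  show ?thesis
  proof
    assume "v \<in> spectral_domain E f"
    then have int: "integrable (scalar_measure E v) (\<lambda>x. (cmod (f x))\<^sup>2)"
      by (simp add: spectral_domain_def)
    have "norm (bcalc E (\<lambda>x. indicator (level_set f n) x * f x) v)
        \<le> sqrt (\<integral>x. (cmod (f x))\<^sup>2 \<partial>scalar_measure E v)" for n
      by (rule real_le_rsqrt) (use integral_mono[OF g_int int g_le] norm_g in simp)
    then show "\<exists>C. \<forall>n. norm (bcalc E (\<lambda>x. indicator (level_set f n) x * f x) v) \<le> C"
      by blast
  next
    assume "\<exists>C. \<forall>n. norm (bcalc E (\<lambda>x. indicator (level_set f n) x * f x) v) \<le> C"
    then obtain C where C: "\<And>n. norm (bcalc E (\<lambda>x. indicator (level_set f n) x * f x) v) \<le> C"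
      by blast
    have "incseq (\<lambda>n. integral\<^sup>L (scalar_measure E v) (?g n))"
      unfolding incseq_def using g_mono g_int by (auto intro!: integral_mono)
    moreover have "\<forall>n. integral\<^sup>L (scalar_measure E v) (?g n) \<le> C\<^sup>2"
      unfolding norm_g[symmetric] using C by (simp add: power_mono)
    ultimately obtain L where L: "(\<lambda>n. integral\<^sup>L (scalar_measure E v) (?g n)) \<longlonglongrightarrow> L"
      using incseq_convergent by blast
    have "integrable (scalar_measure E v) (\<lambda>x. (cmod (f x))\<^sup>2)"
    proof (rule integrable_monotone_convergence[OF g_int _ _ L])
      show "AE x in scalar_measure E v. mono (\<lambda>n. ?g n x)"
        using g_mono by (auto simp: mono_def)
      show "AE x in scalar_measure E v. (\<lambda>n. ?g n x) \<longlonglongrightarrow> (cmod (f x))\<^sup>2"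
        by (intro AE_I2 tendsto_intros tendsto_indicator_mult level_set_eventually)
    qed (use f in measurable)
    then show "v \<in> spectral_domain E f"
      by (simp add: spectral_domain_def)
  qed
qed

lemma spectral_domain_add_scaleC:
  assumes f: "f \<in> borel_measurable borel" and "v \<in> spectral_domain E f" "w \<in> spectral_domain E f"
  shows "v + c *\<^sub>C w \<in> spectral_domain E f"
proof -
  obtain C D where
    "\<And>n. norm (bcalc E (\<lambda>x. indicator (level_set f n) x * f x) v) \<le> C"
    "\<And>n. norm (bcalc E (\<lambda>x. indicator (level_set f n) x * f x) w) \<le> D"
    using assms unfolding spectral_domain_iff[OF f] by blast
  then have "norm (bcalc E (\<lambda>x. indicator (level_set f n) x * f x) (v + c *\<^sub>C w)) \<le> C + cmod c * D" for n
    using bborel_level[OF f] by (auto simp: bcalc_add_vec bcalc_scaleC_vec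
        intro!: order_trans[OF norm_triangle_ineq] add_mono mult_left_mono)
  then show ?thesis
    unfolding spectral_domain_iff[OF f] by blast
qed

lemma spectral_domain_E:
  assumes f: "f \<in> borel_measurable borel" and B: "B \<in> sets borel"
    and C: "\<And>x. x \<in> B \<Longrightarrow> cmod (f x) \<le> C"
  shows "E B w \<in> spectral_domain E f"
proof -
  have "norm (bcalc E (\<lambda>x. indicator (level_set f n) x * f x) (E B w)) \<le> max C 0 * norm w" for n
  proof -
    have "bcalc E (\<lambda>x. indicator (level_set f n) x * f x) (E B w) =
        bcalc E (\<lambda>x. indicator (level_set f n) x * f x * indicator B x) w"
      using B f by (simp add: bcalc_mult bborel_level flip: bcalc_indicator)
    also have "norm \<dots> \<le> max C 0 * norm w"
    proof (rule norm_bcalc_le)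
      show "cmod (indicator (level_set f n) x * f x * indicator B x) \<le> max C 0" for x
        using C[of x] by (auto simp: indicator_def le_max_iff_disj)
    qed (use B f in \<open>auto intro!: bborel_mult[OF bborel_level]\<close>)
    finally show ?thesis .
  qed
  then show ?thesis
    unfolding spectral_domain_iff[OF f] by blast
qed

text \<open>Each scalar measure is finite, so \<open>1 + (cmod (f x))^2\<close> dominates the
  truncations; all four vectors of the polarization lie in the domain because it is a
  subspace.\<close>

lemma form_level_lim:
  assumes f: "f \<in> borel_measurable borel" and v: "v \<in> spectral_domain E f" and w: "w \<in> spectral_domain E f"
  shows "(\<lambda>n. spectral_form E (\<lambda>x. indicator (level_set f n) x * f x) w v) \<longlonglongrightarrow> spectral_form E f w v"
proof -
  have "(\<lambda>n. integral\<^sup>L (scalar_measure E y) (\<lambda>x. indicator (level_set f n) x * f x))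
      \<longlonglongrightarrow> integral\<^sup>L (scalar_measure E y) f" if y: "y \<in> spectral_domain E f" for y
  proof (rule integral_dominated_convergence[where w = "\<lambda>x. 1 + (cmod (f x))\<^sup>2"])
    interpret finite_measure "scalar_measure E y"
      by (rule finite_measure_scalar)
    show "integrable (scalar_measure E y) (\<lambda>x. 1 + (cmod (f x))\<^sup>2)"
      using y by (simp add: spectral_domain_def)
    show "AE x in scalar_measure E y. (\<lambda>n. indicator (level_set f n) x * f x) \<longlonglongrightarrow> f x"
      by (intro AE_I2 tendsto_indicator_mult level_set_eventually)
    have "cmod z \<le> 1 + (cmod z)\<^sup>2" for z
    proof -
      have "0 \<le> (cmod z - 1 / 2)\<^sup>2"
        by simp
      then show ?thesis
        by (simp add: power2_eq_square algebra_simps)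
    qed
    moreover have "cmod (indicator (level_set f n) x * f x) \<le> cmod (f x)" for n x
      by (auto simp: indicator_def)
    ultimately have "cmod (indicator (level_set f n) x * f x) \<le> 1 + (cmod (f x))\<^sup>2" for n x
      using order_trans by blast
    then show "AE x in scalar_measure E y. cmod (indicator (level_set f n) x * f x) \<le> 1 + (cmod (f x))\<^sup>2" for n
      by simp
    show "f \<in> borel_measurable (scalar_measure E y)"
      using f by measurable
    show "(\<lambda>x. indicator (level_set f n) x * f x) \<in> borel_measurable (scalar_measure E y)" for n
      using bborelD(1)[OF bborel_level[OF f, of n]] by measurable
  qed
  from this[OF spectral_domain_add_scaleC[OF f v w]] show ?thesis
    unfolding spectral_form_def by (intro tendsto_intros) auto
qed

text \<open>Trades the weak definition of the graph for countably many equations between bounded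
  operators, with no mention of domains.\<close>

lemma spectral_integral_iff:
  assumes f: "f \<in> borel_measurable borel"
  shows "(v, u) \<in> spectral_integral E f \<longleftrightarrow>
    (\<forall>n. E (level_set f n) u = bcalc E (\<lambda>x. indicator (level_set f n) x * f x) v)"
proof safe
  fix n
  let ?L = "level_set f"
  have L: "?L m \<in> sets borel" for m
    using f by simp
  assume "(v, u) \<in> spectral_integral E f"
  then have v: "v \<in> spectral_domain E f"
    and u: "\<And>w. w \<in> spectral_domain E f \<Longrightarrow> cinner w u = spectral_form E f w v"
    unfolding spectral_integral_def by auto
  show "E (?L n) u = bcalc E (\<lambda>x. indicator (?L n) x * f x) v"
  proof (rule cinner_eqI)
    fix w
    have dom: "E (?L n) w \<in> spectral_domain E f"
      by (rule spectral_domain_E[OF f L, where C = "real n"]) (simp add: level_set_def)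
    \<comment> \<open>The test vector lies in the range of \<open>E (?L n)\<close>, so truncating
      \<open>f\<close> at any higher level \<open>m\<close> changes nothing, and the limit in
      \<open>m\<close> is attained.\<close>
    have "spectral_form E (\<lambda>x. indicator (?L m) x * f x) (E (?L n) w) v
        = cinner w (bcalc E (\<lambda>x. indicator (?L n) x * f x) v)" if "m \<ge> n" for m
    proof -
      have "spectral_form E (\<lambda>x. indicator (?L m) x * f x) (E (?L n) w) v
          = cinner w (bcalc E (\<lambda>x. indicator (?L n) x * (indicator (?L m) x * f x)) v)"
        using bborel_level[OF f] L by (simp add: E_bcalc flip: cinner_bcalc E_sym)
      also have "(\<lambda>x. indicator (?L n) x * (indicator (?L m) x * f x)) = (\<lambda>x. indicator (?L n) x * f x)"
        using that by (auto simp: indicator_def level_set_def)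
      finally show ?thesis .
    qed
    then have "(\<lambda>m. spectral_form E (\<lambda>x. indicator (?L m) x * f x) (E (?L n) w) v)
        \<longlonglongrightarrow> cinner w (bcalc E (\<lambda>x. indicator (?L n) x * f x) v)"
      by (intro tendsto_eventually) (auto simp: eventually_sequentially)
    from LIMSEQ_unique[OF form_level_lim[OF f v dom] this]
    show "cinner w (E (?L n) u) = cinner w (bcalc E (\<lambda>x. indicator (?L n) x * f x) v)"
      using u[OF dom] L by (simp add: E_sym)
  qed
next
  let ?L = "level_set f"
  have L: "?L m \<in> sets borel" for m
    using f by simp
  assume *: "\<forall>n. E (?L n) u = bcalc E (\<lambda>x. indicator (?L n) x * f x) v"
  \<comment> \<open>The assumed equations bound all truncations by \<open>norm u\<close>, which is
    the domain criterion for \<open>v\<close>.\<close>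
  have "norm (E (?L n) u) \<le> 1 * norm u" for n
    unfolding bcalc_indicator[OF L, symmetric]
    by (rule norm_bcalc_le) (use L in \<open>auto simp: indicator_def\<close>)
  then have v: "v \<in> spectral_domain E f"
    unfolding spectral_domain_iff[OF f] * [rule_format, symmetric] by blast
  moreover have "cinner w u = spectral_form E f w v" if w: "w \<in> spectral_domain E f" for w
  proof (rule LIMSEQ_unique)
    show "(\<lambda>n. cinner w (E (?L n) u)) \<longlonglongrightarrow> spectral_form E f w v"
      using form_level_lim[OF f v w] by (simp add: * cinner_bcalc bborel_level f)
    show "(\<lambda>n. cinner w (E (?L n) u)) \<longlonglongrightarrow> cinner w u"
      by (intro tendsto_cinner tendsto_const E_lim L level_set_eventually)
  qed
  ultimately show "(v, u) \<in> spectral_integral E f"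
    unfolding spectral_integral_def by auto
qed

lemma spectral_integralD:
  assumes f: "f \<in> borel_measurable borel" and "(v, u) \<in> spectral_integral E f"
    and B: "B \<in> sets borel" "\<And>x. x \<in> B \<Longrightarrow> cmod (f x) \<le> C"
  shows "E B u = bcalc E (\<lambda>x. indicator B x * f x) v"
proof -
  obtain n where n: "C \<le> real n"
    using real_arch_simple by blast
  then have sub: "B \<subseteq> level_set f n"
    using B(2) by (fastforce simp: level_set_def)
  have "E B u = E B (E (level_set f n) u)"
    using E_Int[OF B(1) level_set_borel[OF f]] sub by (simp add: Int_absorb2)
  also have "\<dots> = E B (bcalc E (\<lambda>x. indicator (level_set f n) x * f x) v)"
    using assms(2) spectral_integral_iff[OF f] by simp
  also have "\<dots> = bcalc E (\<lambda>x. indicator B x * (indicator (level_set f n) x * f x)) v"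
    by (rule E_bcalc[OF bborel_level[OF f] B(1)])
  also have "(\<lambda>x. indicator B x * (indicator (level_set f n) x * f x)) = (\<lambda>x. indicator B x * f x)"
    by (rule ext) (use sub in \<open>auto simp: indicator_def\<close>)
  finally show ?thesis .
qed

text \<open>Source of explicit graph elements: cutting a vector to a set where \<open>f\<close> is
  bounded moves it into the domain.\<close>

lemma spectral_integral_restrict:
  assumes f: "f \<in> borel_measurable borel" and B: "B \<in> sets borel" "\<And>x. x \<in> B \<Longrightarrow> cmod (f x) \<le> C"
  shows "(E B v, bcalc E (\<lambda>x. indicator B x * f x) v) \<in> spectral_integral E f"
proof -
  have "E (level_set f n) (bcalc E (\<lambda>x. indicator B x * f x) v)
      = bcalc E (\<lambda>x. indicator (level_set f n) x * (indicator B x * f x)) v" for n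
    by (rule E_bcalc[OF bborel_cut[OF f B]]) (use f in auto)
  moreover have "bcalc E (\<lambda>x. indicator (level_set f n) x * f x) (E B v)
      = bcalc E (\<lambda>x. indicator (level_set f n) x * f x * indicator B x) v" for n
    using B(1) f by (simp add: bcalc_mult bborel_level flip: bcalc_indicator)
  ultimately show ?thesis
    unfolding spectral_integral_iff[OF f] by (simp add: mult_ac)
qed

end

section \<open>Spectral measures on the positive half-line\<close>

text \<open>The shift by 1 avoids division by zero and makes \<open>slab 0\<close> the single point
  1. The interval is invariant under \<open>x -> 1/x\<close>, and the logarithm is bounded on it by
  \<open>ln (real n + 1)\<close>, which bounds all complex powers.\<close>

definition slab :: "nat \<Rightarrow> real set" where
  "slab n = {1 / (real n + 1)..real n + 1}"

lemma slab_borel [simp, measurable]: "slab n \<in> sets borel"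
  by (simp add: slab_def)

lemma slab_pos: "x \<in> slab n \<Longrightarrow> 0 < x"
  unfolding slab_def by (metis atLeastAtMost_iff less_le_trans of_nat_0_le_iff zero_less_divide_1_iff
      add_nonneg_pos zero_less_one)

lemma slab_le: "x \<in> slab n \<Longrightarrow> x \<le> real n + 1"
  by (simp add: slab_def)

lemma slab_inverse: "1 / x \<in> slab n \<longleftrightarrow> x \<in> slab n"
proof -
  have "1 / y \<in> slab n" if y: "y \<in> slab n" for y
    using slab_pos[OF y] y by (simp add: slab_def field_simps)
  from this[of x] this[of "1 / x"] show ?thesis
    by auto
qed

lemma slab_eventually:
  assumes "x > 0"
  shows "\<forall>\<^sub>F n in sequentially. x \<in> slab n"
proof -
  obtain N where N: "max x (1 / x) \<le> real N"
    using real_arch_simple by blast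
  have "x \<in> slab n" if "n \<ge> N" for n
  proof -
    have "x \<le> real n" "1 / x \<le> real n"
      using N that by auto
    then show ?thesis
      using assms unfolding slab_def by (auto simp: field_simps)
  qed
  then show ?thesis
    unfolding eventually_sequentially by blast
qed

locale pos_pvm = pvm +
  assumes E_nonpos: "E {..0} v = 0"
begin

lemma E_pos: "E {0<..} v = v"
proof -
  have "E ({..0} \<union> {0<..}) v = E {..0} v + E {0<..} v"
    by (rule E_Un) auto
  moreover have "{..0} \<union> {0<..} = (UNIV :: real set)"
    by auto
  ultimately show ?thesis
    by (simp add: E_nonpos)
qed

text \<open>Inserting \<open>E {0<..}\<close>, which is the identity, allows exchanging functions
  that differ only at nonpositive arguments, where \<open>1 / x\<close> and \<open>powr\<close> take
  values without spectral meaning.\<close>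

lemma bcalc_cong_pos:
  assumes f: "bborel f" and g: "bborel g" and eq: "\<And>x. x > 0 \<Longrightarrow> f x = g x"
  shows "bcalc E f v = bcalc E g v"
proof -
  have "bcalc E f v = bcalc E (\<lambda>x. indicator {0<..} x * f x) v"
    using E_bcalc[OF f, of "{0<..}" v] by (simp add: E_pos)
  also have "(\<lambda>x. indicator {0<..} x * f x) = (\<lambda>x. indicator {0<..} x * g x)"
    using eq by (auto simp: indicator_def)
  also have "bcalc E \<dots> v = bcalc E g v"
    using E_bcalc[OF g, of "{0<..}" v] by (simp add: E_pos)
  finally show ?thesis .
qed

lemma bcalc_lim_pos:
  assumes F: "\<And>n. bborel (F n)" "bborel f" "\<And>n x. cmod (F n x) \<le> C"
    and lim: "\<And>x. x > 0 \<Longrightarrow> (\<lambda>n. F n x) \<longlonglongrightarrow> f x"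
  shows "(\<lambda>n. bcalc E (F n) v) \<longlonglongrightarrow> bcalc E f v"
proof -
  let ?I = "indicator {0<..} :: real \<Rightarrow> complex"
  have "(\<lambda>n. bcalc E (\<lambda>x. ?I x * F n x) v) \<longlonglongrightarrow> bcalc E (\<lambda>x. ?I x * f x) v"
  proof (rule bcalc_lim)
    show "cmod (?I x * F n x) \<le> C" for n x
      using F(3)[of n x] order_trans[OF norm_ge_zero F(3)] by (auto simp: indicator_def)
    show "(\<lambda>n. ?I x * F n x) \<longlonglongrightarrow> ?I x * f x" for x
      using lim by (cases "x > 0") auto
  qed (use F in auto)
  moreover have "bcalc E (\<lambda>x. ?I x * g x) v = bcalc E g v" if "bborel g" for g
    using E_bcalc[OF that, of "{0<..}" v] by (simp add: E_pos)
  ultimately show ?thesis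
    using F by simp
qed

lemma slab_lim: "(\<lambda>n. E (slab n) v) \<longlonglongrightarrow> v"
proof -
  have "(\<lambda>n. bcalc E (indicator (slab n)) v) \<longlonglongrightarrow> bcalc E (\<lambda>x. 1) v"
  proof (rule bcalc_lim_pos[where C = 1])
    show "(\<lambda>n. indicator (slab n) x) \<longlonglongrightarrow> (1 :: complex)" if "x > 0" for x
      using tendsto_indicator_mult[OF slab_eventually[OF that], of 1] by simp
    show "cmod (indicator (slab n) x) \<le> 1" for n x
      by (simp add: indicator_def)
  qed auto
  then show ?thesis
    by (simp add: bcalc_indicator bcalc_one)
qed

lemma eq_on_slabs:
  assumes "\<And>n. E (slab n) x = E (slab n) y"
  shows "x = y"
  using LIMSEQ_unique[OF slab_lim[of x]] slab_lim[of y] assms by simp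

text \<open>The criterion \<open>spectral_integral_iff\<close> with cut-offs independent of
  \<open>f\<close>, so that different powers can be compared. The projections of slabs and level
  sets commute, and each family exhausts the space.\<close>

lemma spectral_integral_slab_iff:
  assumes f: "f \<in> borel_measurable borel" and bd: "\<And>n x. x \<in> slab n \<Longrightarrow> cmod (f x) \<le> C n"
  shows "(v, u) \<in> spectral_integral E f \<longleftrightarrow>
    (\<forall>n. E (slab n) u = bcalc E (\<lambda>x. indicator (slab n) x * f x) v)"
proof
  assume "(v, u) \<in> spectral_integral E f"
  then show "\<forall>n. E (slab n) u = bcalc E (\<lambda>x. indicator (slab n) x * f x) v"
    using spectral_integralD[OF f _ slab_borel bd] by blast
next
  assume *: "\<forall>n. E (slab n) u = bcalc E (\<lambda>x. indicator (slab n) x * f x) v"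
  show "(v, u) \<in> spectral_integral E f"
    unfolding spectral_integral_iff[OF f]
  proof
    fix m
    have L: "level_set f m \<in> sets borel"
      using f by simp
    show "E (level_set f m) u = bcalc E (\<lambda>x. indicator (level_set f m) x * f x) v"
    proof (rule eq_on_slabs)
      fix n
      have "E (slab n) (E (level_set f m) u) = E (level_set f m) (E (slab n) u)"
        using L by (simp add: E_Int Int_commute)
      also have "\<dots> = bcalc E (\<lambda>x. indicator (level_set f m) x * (indicator (slab n) x * f x)) v"
        unfolding * [rule_format] by (rule E_bcalc[OF bborel_cut[OF f slab_borel bd] L])
      also have "\<dots> = E (slab n) (bcalc E (\<lambda>x. indicator (level_set f m) x * f x) v)"
        unfolding E_bcalc[OF bborel_level[OF f] slab_borel] by (simp add: mult.left_commute)
      finally show "E (slab n) (E (level_set f m) u) =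
          E (slab n) (bcalc E (\<lambda>x. indicator (level_set f m) x * f x) v)" .
    qed
  qed
qed

lemma spectral_integral_bborel:
  assumes f: "bborel f"
  shows "(v, u) \<in> spectral_integral E f \<longleftrightarrow> u = bcalc E f v"
proof -
  obtain C where C: "\<And>x. cmod (f x) \<le> C"
    using bborelD(2)[OF f] by blast
  have "(v, u) \<in> spectral_integral E f \<longleftrightarrow> (\<forall>n. E (slab n) u = E (slab n) (bcalc E f v))"
    unfolding E_bcalc[OF f slab_borel]
    by (rule spectral_integral_slab_iff[OF bborelD(1)[OF f], of "\<lambda>_. C"]) (rule C)
  also have "\<dots> \<longleftrightarrow> u = bcalc E f v"
    using eq_on_slabs by blast
  finally show ?thesis .
qed

end

section \<open>The resolvent and its graph\<close>

text \<open>\<open>r = h / (1 + h)\<close> on the half-line, so \<open>1 - r(A)\<close> is the resolvent \<open>(1 + h(A))\<^sup>-\<^sup>1\<close>.\<close>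

definition squash :: "(real \<Rightarrow> real) \<Rightarrow> real \<Rightarrow> real" where
  "squash h x = h x / (1 + \<bar>h x\<bar>)"

lemma squash_abs_le: "\<bar>squash h x\<bar> \<le> 1"
  unfolding squash_def by (simp add: divide_le_eq)

lemma strict_mono_borel:
  fixes h :: "real \<Rightarrow> real"
  assumes "strict_mono h"
  shows "h \<in> borel_measurable borel"
  by (rule borel_measurable_mono) (simp add: assms strict_mono_mono)

text \<open>The absolute value in \<open>squash\<close> keeps it strictly increasing and bounded
  also where \<open>h\<close> is negative, as \<open>bborel_generated\<close> asks on the whole
  line.\<close>

lemma strict_mono_squash:
  assumes "strict_mono h"
  shows "strict_mono (squash h)"
proof (rule strict_monoI)
  fix x y :: real assume "x < y"
  then have "h x < h y"
    using assms by (simp add: strict_mono_less)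
  moreover have "a / (1 + \<bar>a\<bar>) < b / (1 + \<bar>b\<bar>)" if "a < b" for a b :: real
  proof -
    have "a * (1 + \<bar>b\<bar>) < b * (1 + \<bar>a\<bar>)"
    proof (cases "a \<ge> 0")
      case True
      then show ?thesis
        using that by (simp add: algebra_simps)
    next
      case a: False
      show ?thesis
      proof (cases "b \<ge> 0")
        case True
        have "a * \<bar>b\<bar> \<le> 0" "b * \<bar>a\<bar> \<ge> 0"
          using a True by (auto simp: mult_nonpos_nonneg mult_nonneg_nonpos2 mult.commute)
        then show ?thesis
          using that by (simp add: algebra_simps)
      next
        case False
        then show ?thesis
          using a that by (simp add: algebra_simps)
      qed
    qed
    then show ?thesis
      by (simp add: divide_less_eq less_divide_eq field_simps add_pos_nonneg)
  qed
  ultimately show "squash h x < squash h y"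
    unfolding squash_def by blast
qed

lemma bborel_squash:
  assumes "strict_mono h"
  shows "bborel (\<lambda>x. complex_of_real (squash h x))"
  by (rule bborelI[where C = 1])
    (use strict_mono_borel[OF strict_mono_squash[OF assms]] squash_abs_le in auto)

context pos_pvm
begin

text \<open>Write \<open>B\<close> for \<integral> h dE and \<open>R\<close> for the operator of
  \<open>squash h\<close>. Then \<open>R = B (1 + B)^(-1)\<close>, and
  \<open>(v, u) -> v + u\<close> maps the graph of \<open>B\<close> bijectively onto the space, with
  inverse \<open>y -> (y - R y, R y)\<close>. The graph thus determines the bounded operator
  \<open>R\<close>.\<close>

lemma
  assumes h: "strict_mono h" and pos: "\<And>x. x > 0 \<Longrightarrow> h x > 0"
  shows squash_in_graph: "(y - bcalc E (\<lambda>x. complex_of_real (squash h x)) y,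
      bcalc E (\<lambda>x. complex_of_real (squash h x)) y) \<in> spectral_integral E (\<lambda>x. complex_of_real (h x))"
    and squash_of_graph: "(v, u) \<in> spectral_integral E (\<lambda>x. complex_of_real (h x)) \<Longrightarrow>
      u = bcalc E (\<lambda>x. complex_of_real (squash h x)) (v + u)"
proof -
  let ?r = "\<lambda>x. complex_of_real (squash h x)" and ?h = "\<lambda>x. complex_of_real (h x)"
  note r = bborel_squash[OF h]
  have hb: "?h \<in> borel_measurable borel"
    using strict_mono_borel[OF h] by simp
  have bd: "cmod (?h x) \<le> h (real n + 1)" if "x \<in> slab n" for n x
    using pos[OF slab_pos[OF that]] slab_le[OF that] h by (simp add: strict_mono_less_eq)
  have cut: "bborel (\<lambda>x. indicator (slab n) x * ?h x)" for n
    by (rule bborel_cut[OF hb slab_borel bd])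
  have rh: "?h x * (1 - ?r x) = ?r x" "?r x * (1 + ?h x) = ?h x" if "x > 0" for x
  proof -
    have "1 + h x \<noteq> 0"
      using pos[OF that] by linarith
    then have "h x * (1 - squash h x) = squash h x" "squash h x * (1 + h x) = h x"
      using pos[OF that] by (auto simp: squash_def field_simps)
    then show "?h x * (1 - ?r x) = ?r x" "?r x * (1 + ?h x) = ?h x"
      by (metis of_real_1 of_real_diff of_real_mult, metis of_real_1 of_real_add of_real_mult)
  qed
  have graph: "(v, u) \<in> spectral_integral E ?h \<longleftrightarrow>
      (\<forall>n. E (slab n) u = bcalc E (\<lambda>x. indicator (slab n) x * ?h x) v)" for v u
    by (rule spectral_integral_slab_iff[OF hb, of "\<lambda>n. h (real n + 1)"]) (rule bd)
  show "(y - bcalc E ?r y, bcalc E ?r y) \<in> spectral_integral E ?h"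
    unfolding graph
  proof
    fix n
    have "bcalc E (\<lambda>x. indicator (slab n) x * ?h x) (y - bcalc E ?r y)
        = bcalc E (\<lambda>x. indicator (slab n) x * ?h x) (bcalc E (\<lambda>x. 1 - ?r x) y)"
      using r by (simp add: bcalc_diff bcalc_one)
    also have "\<dots> = bcalc E (\<lambda>x. indicator (slab n) x * ?h x * (1 - ?r x)) y"
      by (rule bcalc_mult[OF cut]) (use r in auto)
    also have "(\<lambda>x. indicator (slab n) x * ?h x * (1 - ?r x)) = (\<lambda>x. indicator (slab n) x * ?r x)"
    proof
      show "indicator (slab n) x * ?h x * (1 - ?r x) = indicator (slab n) x * ?r x" for x
        using rh(1)[OF slab_pos[of x n]]
        by (cases "x \<in> slab n") (simp_all only: indicator_simps not_False_eq_True mult_1_left mult_zero_left)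
    qed
    finally show "E (slab n) (bcalc E ?r y) = bcalc E (\<lambda>x. indicator (slab n) x * ?h x) (y - bcalc E ?r y)"
      by (simp add: E_bcalc r)
  qed
  assume "(v, u) \<in> spectral_integral E ?h"
  then have vu: "E (slab n) u = bcalc E (\<lambda>x. indicator (slab n) x * ?h x) v" for n
    unfolding graph by blast
  show "u = bcalc E ?r (v + u)"
  proof (rule eq_on_slabs)
    fix n
    have sw: "E (slab n) (bcalc E ?r w) = bcalc E ?r (E (slab n) w)" for w
      using r by (simp add: bcalc_mult mult.commute flip: bcalc_indicator)
    have "E (slab n) (bcalc E ?r (v + u)) = bcalc E ?r (bcalc E (indicator (slab n)) v
        + bcalc E (\<lambda>x. indicator (slab n) x * ?h x) v)"
      unfolding sw bounded_clinearD(2)[OF E_clinear[OF slab_borel]] vu bcalc_indicator[OF slab_borel] ..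
    also have "\<dots> = bcalc E (\<lambda>x. ?r x * (indicator (slab n) x + indicator (slab n) x * ?h x)) v"
      using r cut by (simp add: bcalc_mult bborel_add flip: bcalc_add)
    also have "(\<lambda>x. ?r x * (indicator (slab n) x + indicator (slab n) x * ?h x))
        = (\<lambda>x. indicator (slab n) x * ?h x)"
    proof
      show "?r x * (indicator (slab n) x + indicator (slab n) x * ?h x) = indicator (slab n) x * ?h x" for x
        using rh(2)[OF slab_pos[of x n]] by (cases "x \<in> slab n")
          (simp_all only: indicator_simps not_False_eq_True mult_1_left mult_zero_left mult_zero_right add_0_left)
    qed
    finally show "E (slab n) u = E (slab n) (bcalc E ?r (v + u))"
      by (simp add: vu)
  qed
qed

end

text \<open>On the real axis the principal logarithm is a real logarithm plus a jump by
  \<open>\<i> * pi\<close>; measurability and the modulus of the power can be read off from this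
  form.\<close>

lemma of_real_powr_eq:
  "complex_of_real x powr z =
    (if x = 0 then 0 else exp (z * (complex_of_real (ln \<bar>x\<bar>) + (if x < 0 then \<i> * pi else 0))))"
  using Ln_of_real'[of x] by (simp add: powr_def mult.commute)

lemma of_real_powr_borel [measurable]: "(\<lambda>x. complex_of_real x powr z) \<in> borel_measurable borel"
proof -
  have [measurable]: "(exp :: complex \<Rightarrow> complex) \<in> borel_measurable borel"
    by (intro borel_measurable_continuous_onI continuous_intros)
  show ?thesis
    unfolding of_real_powr_eq by measurable
qed

lemma bborel_comp_inverse:
  assumes "bborel f"
  shows "bborel (\<lambda>x. f (1 / x))"
proof -
  have "(\<lambda>x::real. 1 / x) \<in> borel_measurable borel"
    by measurable
  from measurable_compose[OF this bborelD(1)[OF assms]] show ?thesis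
    using bborelD(2)[OF assms] by (auto intro: bborelI)
qed

text \<open>On a bounded set of negative numbers away from zero the quadratic form of the operator
  is at most a negative multiple of the squared norm, so positivity kills the projection. Such sets
  exhaust the negative half-line; the point zero is excluded by injectivity.\<close>

lemma (in pvm) pos_pvm_of_strictly_positive:
  assumes pos: "strictly_positive_op (spectral_integral E complex_of_real)"
  shows "pos_pvm E"
proof
  fix v
  define B where "B n = {- real n..- (1 / (real n + 1))}" for n
  have B [simp]: "B n \<in> sets borel" for n
    unfolding B_def by simp
  have B_neg: "x \<in> B n \<Longrightarrow> x \<le> - (1 / (real n + 1))" for x n
    unfolding B_def by simp
  have B_bd: "cmod (complex_of_real x) \<le> real n" if "x \<in> B n" for x n
  proof -
    have "0 \<le> 1 / (real n + 1)"
      by simp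
    then have "x \<le> 0" "- real n \<le> x"
      using that unfolding B_def atLeastAtMost_iff by linarith+
    then show ?thesis
      by simp
  qed
  have zero: "E (B n) v = 0" for n
  proof -
    interpret finite_measure "scalar_measure E v"
      by (rule finite_measure_scalar)
    let ?g = "\<lambda>x. indicator (B n) x * complex_of_real x"
    have g: "bborel ?g"
      by (rule bborel_cut[OF _ B B_bd]) auto
    have g_eq: "?g = (\<lambda>x. complex_of_real (indicator (B n) x * x))"
      by (auto simp: indicator_def)
    have "(E (B n) v, bcalc E ?g v) \<in> spectral_integral E complex_of_real"
      by (rule spectral_integral_restrict[OF _ B B_bd]) auto
    then have "0 \<le> Re (cinner (E (B n) v) (bcalc E ?g v))"
      using pos unfolding strictly_positive_op_def by blast
    also have "cinner (E (B n) v) (bcalc E ?g v) = cinner v (bcalc E (\<lambda>x. indicator (B n) x * ?g x) v)"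
      by (simp add: E_bcalc g flip: E_sym)
    also have "(\<lambda>x. indicator (B n) x * ?g x) = ?g"
      by (auto simp: indicator_def)
    also have "cinner v (bcalc E ?g v) = integral\<^sup>L (scalar_measure E v) ?g"
      by (simp add: cinner_bcalc form_diag g)
    also have "Re \<dots> = (\<integral>x. indicator (B n) x * x \<partial>scalar_measure E v)"
      unfolding g_eq integral_complex_of_real Re_complex_of_real ..
    also have "\<dots> \<le> (\<integral>x. - (1 / (real n + 1)) * indicator (B n) x \<partial>scalar_measure E v)"
    proof (rule integral_mono)
      show "integrable (scalar_measure E v) (\<lambda>x. indicator (B n) x * x)"
        using integrable_Re[OF integrable_bborel[OF g[unfolded g_eq], of v]]
        unfolding Re_complex_of_real .
      show "integrable (scalar_measure E v) (\<lambda>x. - (1 / (real n + 1)) * indicator (B n) x)"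
        by (intro integrable_mult_right) (simp add: emeasure_scalar)
      show "indicator (B n) x * x \<le> - (1 / (real n + 1)) * indicator (B n) x" for x
        using B_neg[of x n] by (auto simp: indicator_def)
    qed
    also have "\<dots> = - (1 / (real n + 1)) * (norm (E (B n) v))\<^sup>2"
      by (simp add: measure_scalar)
    finally have "(norm (E (B n) v))\<^sup>2 / (real n + 1) \<le> 0"
      by simp
    then have "(norm (E (B n) v))\<^sup>2 \<le> 0"
      by (simp add: divide_le_0_iff)
    then show ?thesis
      by simp
  qed
  have "(\<lambda>n. bcalc E (indicator (B n)) v) \<longlonglongrightarrow> bcalc E (indicator {..<0}) v"
  proof (rule bcalc_lim[where C = 1])
    fix x :: real
    show "(\<lambda>n. indicator (B n) x) \<longlonglongrightarrow> (indicator {..<0} x :: complex)"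
    proof (cases "x < 0")
      case True
      then obtain N where N: "max (- x) (1 / (- x)) \<le> real N"
        using real_arch_simple by blast
      have "x \<in> B n" if "n \<ge> N" for n
      proof -
        have "- x \<le> real n" "1 / (- x) \<le> real n"
          using N that by auto
        then have "- real n \<le> x" "1 / (real n + 1) \<le> - x"
          using True by (auto simp: field_simps)
        then show ?thesis
          unfolding B_def by simp
      qed
      then show ?thesis
        using True by (intro tendsto_eventually) (auto simp: eventually_sequentially indicator_def intro!: exI[of _ N])
    next
      case False
      have "x \<notin> B n" for n
      proof
        assume "x \<in> B n"
        then have "x \<le> - (1 / (real n + 1))"
          by (rule B_neg)
        moreover have "1 / (real n + 1) > 0"
          by simp
        ultimately show False
          using False by linarith
      qed
      then show ?thesis
        using False by simp
    qed
  qed (auto simp: indicator_def[of "B _"])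
  then have neg: "E {..<0} v = 0"
    by (simp add: bcalc_indicator zero LIMSEQ_const_iff)
  \<comment> \<open>The operator vanishes on the range of \<open>E {0}\<close>, which therefore lies
    in its trivial kernel.\<close>
  have "(E {0} v, bcalc E (\<lambda>x. indicator {0} x * complex_of_real x) v) \<in> spectral_integral E complex_of_real"
    by (rule spectral_integral_restrict[where C = 0]) auto
  moreover have "(\<lambda>x. indicator {0} x * complex_of_real x) = (\<lambda>x. 0 * indicator UNIV x)"
    by (auto simp: indicator_def)
  then have "bcalc E (\<lambda>x. indicator {0} x * complex_of_real x) v = 0"
    using bcalc_scale[of "indicator UNIV" 0 v] by simp
  ultimately have "E {0} v = 0"
    using pos unfolding strictly_positive_op_def by auto
  moreover have "{..0} = {..<0} \<union> {0::real}"
    by auto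
  ultimately show "E {..0} v = 0"
    using E_Un[of "{..<0}" "{0}" v] neg by simp
qed

text \<open>The graph of \<open>\<integral> h dE\<close> determines the resolvent, and the resolvent generates the calculus.\<close>

lemma bcalc_unique:
  assumes "pos_pvm E" "pos_pvm E'"
    and h: "strict_mono h" "\<And>x. x > 0 \<Longrightarrow> h x > 0"
    and eq: "spectral_integral E (\<lambda>x. complex_of_real (h x)) = spectral_integral E' (\<lambda>x. complex_of_real (h x))"
    and f: "bborel f"
  shows "bcalc E f v = bcalc E' f v"
proof -
  interpret E: pos_pvm E by fact
  interpret E': pos_pvm E' by fact
  have "\<forall>v. bcalc E f v = bcalc E' f v"
    using f
  proof (rule bborel_generated[where r = "squash h"])
    show "strict_mono (squash h)" "squash h \<in> borel_measurable borel"
      using strict_mono_squash[OF h(1)] strict_mono_borel by auto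
    show "\<bar>squash h x\<bar> \<le> 1" for x
      by (rule squash_abs_le)
    show "\<forall>v. bcalc E (\<lambda>x. complex_of_real (squash h x)) v = bcalc E' (\<lambda>x. complex_of_real (squash h x)) v"
    proof
      fix v
      show "bcalc E (\<lambda>x. complex_of_real (squash h x)) v = bcalc E' (\<lambda>x. complex_of_real (squash h x)) v"
        using E'.squash_of_graph[OF h E.squash_in_graph[OF h, of v, unfolded eq]] by simp
    qed
  next
    fix F f and C :: real
    assume F: "\<And>n. bborel (F n)" "bborel f" "\<And>n x. cmod (F n x) \<le> C" "\<And>x. (\<lambda>n. F n x) \<longlonglongrightarrow> f x"
      and *: "\<And>n. \<forall>v. bcalc E (F n) v = bcalc E' (F n) v"
    show "\<forall>v. bcalc E f v = bcalc E' f v"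
    proof
      fix v
      show "bcalc E f v = bcalc E' f v"
        using LIMSEQ_unique[OF E.bcalc_lim[OF F, of v]] E'.bcalc_lim[OF F, of v] * by simp
    qed
  qed (simp_all add: E.bcalc_one E'.bcalc_one E.bcalc_add E'.bcalc_add E.bcalc_scale E'.bcalc_scale
      flip: E.bcalc_mult E'.bcalc_mult)
  then show ?thesis
    by blast
qed

lemma spectral_measure_pos_pvm:
  assumes "strictly_positive_op A" "spectral_measure_of A E"
  shows "pos_pvm E"
proof -
  interpret pvm E
    using assms unfolding spectral_measure_of_def by unfold_locales blast
  show ?thesis
    by (rule pos_pvm_of_strictly_positive) (use assms in \<open>simp add: spectral_measure_of_def\<close>)
qed

text \<open>The union defining the left side runs over all spectral measures of \<open>A\<close>. By
  \<open>bcalc_unique\<close> with \<open>h\<close> the identity they have the same projections, so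
  the union is over equal sets, and \<open>E\<close> itself makes it nonempty.\<close>

lemma functional_calculus_eq:
  assumes A: "strictly_positive_op A" and E: "spectral_measure_of A E" and f: "f \<in> borel_measurable borel"
  shows "functional_calculus A f = spectral_integral E f"
proof -
  have "spectral_integral E' f = spectral_integral E f" if E': "spectral_measure_of A E'" for E'
  proof -
    interpret E: pos_pvm E
      by (rule spectral_measure_pos_pvm[OF A E])
    interpret E': pos_pvm E'
      by (rule spectral_measure_pos_pvm[OF A E'])
    have eq: "bcalc E' g v = bcalc E g v" if "bborel g" for g v
    proof (rule bcalc_unique[where h = "\<lambda>x. x"])
      show "spectral_integral E' (\<lambda>x. complex_of_real x) = spectral_integral E (\<lambda>x. complex_of_real x)"
        using E E' by (simp add: spectral_measure_of_def)
    qed (use that in \<open>auto simp: strict_mono_def E.pos_pvm_axioms E'.pos_pvm_axioms\<close>)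
    have "E' B v = E B v" if "B \<in> sets borel" for B v
      using eq[OF bborel_indicator[OF that]] that by (simp add: E.bcalc_indicator E'.bcalc_indicator)
    then show ?thesis
      using f by (auto simp: E.spectral_integral_iff E'.spectral_integral_iff eq bborel_level)
  qed
  then have "functional_calculus A f = (\<Union>E'\<in>{E'. spectral_measure_of A E'}. spectral_integral E f)"
    unfolding functional_calculus_def by (intro SUP_cong refl) blast
  also have "\<dots> = spectral_integral E f"
    using E by blast
  finally show ?thesis .
qed

section \<open>Conjugation of the calculus by \<open>J\<close>\<close>

lemma antiunitary_involutionD:
  assumes "antiunitary_involution J"
  shows "J (x + y) = J x + J y" "J (c *\<^sub>C x) = cnj c *\<^sub>C J x" "cinner (J x) (J y) = cinner y x"
    "J (J x) = x" "norm (J x) = norm x" "bounded_linear J"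
proof -
  show add: "J (x + y) = J x + J y" for x y
    using assms by (simp add: antiunitary_involution_def)
  show scale: "J (c *\<^sub>C x) = cnj c *\<^sub>C J x" for c x
    using assms by (simp add: antiunitary_involution_def)
  show inner: "cinner (J x) (J y) = cinner y x" for x y
    using assms by (simp add: antiunitary_involution_def)
  show "J (J x) = x"
    using assms by (simp add: antiunitary_involution_def)
  show norm: "norm (J x) = norm x" for x
  proof -
    have "(norm (J x))\<^sup>2 = (norm x)\<^sup>2"
      by (simp add: inner flip: Re_cinner_self)
    then show ?thesis
      by simp
  qed
  show "bounded_linear J"
    by (rule bounded_linear_intro[where K = 1])
      (use add scale[of "complex_of_real _"] norm in \<open>auto simp: scaleC_of_real\<close>)
qed

text \<open>\<open>J\<close> exchanges the graphs of \<open>\<Delta>\<^sup>1\<^sup>/\<^sup>2\<close> and its inverse, hence conjugates one resolvent into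
  the other: \<open>J \<Delta> J = \<Delta>\<^sup>-\<^sup>1\<close>.\<close>

lemma (in pos_pvm) J_bcalc:
  assumes J: "antiunitary_involution J"
    and flip: "\<And>v u. (v, u) \<in> spectral_integral E (\<lambda>x. complex_of_real (sqrt x)) \<Longrightarrow>
      (J u, J v) \<in> spectral_integral E (\<lambda>x. complex_of_real (sqrt x))"
    and f: "bborel f"
  shows "J (bcalc E f v) = bcalc E (\<lambda>x. cnj (f (1 / x))) (J v)"
proof -
  note J_simps = antiunitary_involutionD[OF J]
  have J_diff: "J (x - y) = J x - J y" for x y
    using J_simps(6) by (rule linear_simps)
  have h: "strict_mono sqrt" "\<And>x. x > 0 \<Longrightarrow> sqrt x > 0"
    by (auto simp: strict_mono_def)
  note bb = bborel_cnj[OF bborel_comp_inverse]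
  have "\<forall>v. J (bcalc E f v) = bcalc E (\<lambda>x. cnj (f (1 / x))) (J v)"
    using f
  proof (rule bborel_generated[where r = "squash sqrt"])
    show "strict_mono (squash sqrt)" "squash sqrt \<in> borel_measurable borel"
      using strict_mono_squash[OF h(1)] strict_mono_borel by auto
    show "\<bar>squash sqrt x\<bar> \<le> 1" for x
      by (rule squash_abs_le)
    let ?r = "\<lambda>x. complex_of_real (squash sqrt x)"
    have r: "bborel ?r"
      by (rule bborel_squash[OF h(1)])
    show "\<forall>v. J (bcalc E ?r v) = bcalc E (\<lambda>x. cnj (?r (1 / x))) (J v)"
    proof
      fix v
      \<comment> \<open>The flipped pair \<open>(J (R v), J (v - R v))\<close>, with
        \<open>R\<close> the operator of \<open>?r\<close>, is in the graph and its components add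
        up to \<open>J v\<close>; \<open>squash_of_graph\<close> reads off the second
        component.\<close>
      have "J (v - bcalc E ?r v) = bcalc E ?r (J v)"
        using squash_of_graph[OF h flip[OF squash_in_graph[OF h, of v]]] by (simp add: J_diff)
      then have "J (bcalc E ?r v) = J v - bcalc E ?r (J v)"
        by (simp add: J_diff algebra_simps)
      also have "\<dots> = bcalc E (\<lambda>x. 1 - ?r x) (J v)"
        using r by (simp add: bcalc_diff bcalc_one)
      also have "\<dots> = bcalc E (\<lambda>x. cnj (?r (1 / x))) (J v)"
      proof (rule bcalc_cong_pos)
        fix x :: real assume x: "x > 0"
        have "1 + sqrt x > 0"
          using x by (simp add: add_pos_nonneg)
        \<comment> \<open>With \<open>s = sqrt x\<close>, both sides are
          \<open>1 / (1 + s)\<close>.\<close>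
        then have "1 - squash sqrt x = squash sqrt (1 / x)"
          using x by (simp add: squash_def real_sqrt_divide field_simps)
        then show "1 - ?r x = cnj (?r (1 / x))"
          by (metis complex_cnj_complex_of_real of_real_1 of_real_diff)
      qed (use r bb[OF r] in auto)
      finally show "J (bcalc E ?r v) = bcalc E (\<lambda>x. cnj (?r (1 / x))) (J v)" .
    qed
  next
    fix F f and C :: real
    assume F: "\<And>n. bborel (F n)" "bborel f" "\<And>n x. cmod (F n x) \<le> C" "\<And>x. (\<lambda>n. F n x) \<longlonglongrightarrow> f x"
      and *: "\<And>n. \<forall>v. J (bcalc E (F n) v) = bcalc E (\<lambda>x. cnj (F n (1 / x))) (J v)"
    show "\<forall>v. J (bcalc E f v) = bcalc E (\<lambda>x. cnj (f (1 / x))) (J v)"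
    proof
      fix v
      have "(\<lambda>n. bcalc E (\<lambda>x. cnj (F n (1 / x))) (J v)) \<longlonglongrightarrow> bcalc E (\<lambda>x. cnj (f (1 / x))) (J v)"
        by (rule bcalc_lim[where C = C]) (use F bb in \<open>auto intro: tendsto_cnj\<close>)
      with bounded_linear.tendsto[OF J_simps(6) bcalc_lim[OF F, of v]]
      show "J (bcalc E f v) = bcalc E (\<lambda>x. cnj (f (1 / x))) (J v)"
        unfolding * [rule_format] by (rule LIMSEQ_unique)
    qed
  qed (simp_all add: bcalc_one bcalc_add bcalc_scale J_simps(1,2) bb flip: bcalc_mult)
  then show ?thesis
    by blast
qed

section \<open>Analytic functions on the strip\<close>

text \<open>Phragmen-Lindeloef: multiply by \<open>exp (- e * z\<^sup>2)\<close> and use the maximum modulus principle on a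
  large rectangle.\<close>

lemma strip_maximum_modulus:
  assumes cont: "continuous_on {z. 0 \<le> Im z \<and> Im z \<le> 1/2} F"
    and bdd: "\<And>z. 0 \<le> Im z \<Longrightarrow> Im z \<le> 1/2 \<Longrightarrow> cmod (F z) \<le> M"
    and hol: "F holomorphic_on {z. 0 < Im z \<and> Im z < 1/2}"
    and lower: "\<And>t. cmod (F (complex_of_real t)) \<le> B"
    and upper: "\<And>t. cmod (F (complex_of_real t + \<i>/2)) \<le> B"
    and z: "0 \<le> Im z" "Im z \<le> 1/2"
  shows "cmod (F z) \<le> B"
proof -
  have B0: "B \<ge> 0"
    using order_trans[OF norm_ge_zero lower] .
  have M0: "M \<ge> 0"
    using order_trans[OF norm_ge_zero bdd[of 0]] by simp
  \<comment> \<open>The horizontal sides carry the bound \<open>B\<close>, the vertical ones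
    \<open>M\<close> damped by \<open>exp (- (e * n^2))\<close>; the sum covers the whole frontier.
    The factor \<open>exp (e / 4)\<close> is the growth of the multiplier in the imaginary
    direction, as \<open>(Im w)^2\<close> is at most 1/4.\<close>
  have step: "cmod (F z * exp (- (of_real e * z\<^sup>2))) \<le> exp (e / 4) * (B + M * exp (- (e * (real n)\<^sup>2)))"
    if e: "e > 0" and n: "\<bar>Re z\<bar> \<le> real n" for e n
  proof -
    let ?R = "cbox (Complex (- real n) 0) (Complex (real n) (1/2))"
    let ?G = "\<lambda>z. F z * exp (- (of_real e * z\<^sup>2))"
    have R_sub: "?R \<subseteq> {z. 0 \<le> Im z \<and> Im z \<le> 1/2}"
      by (auto simp: in_cbox_complex_iff)
    have int: "interior ?R = box (Complex (- real n) 0) (Complex (real n) (1/2))"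
      by simp
    have exp_le: "cmod (exp (- (of_real e * w\<^sup>2))) \<le> exp (e / 4) * exp (- (e * (Re w)\<^sup>2))"
      if "0 \<le> Im w" "Im w \<le> 1/2" for w
    proof -
      have "(Im w)\<^sup>2 \<le> (1/2)\<^sup>2"
        using that by (intro power_mono) auto
      then have "e * (Im w)\<^sup>2 \<le> e * (1/4)"
        using e by (intro mult_left_mono) (auto simp: power2_eq_square)
      moreover have "cmod (exp (- (of_real e * w\<^sup>2))) = exp (e * (Im w)\<^sup>2 - e * (Re w)\<^sup>2)"
        by (simp add: norm_exp_eq_Re power2_eq_square algebra_simps)
      ultimately show ?thesis
        by (simp flip: exp_add)
    qed
    show ?thesis
    proof (rule maximum_modulus_frontier[of ?G ?R])
      show "?G holomorphic_on interior ?R"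
        unfolding int
        by (intro holomorphic_intros holomorphic_on_subset[OF hol]) (auto simp: in_box_complex_iff)
      show "continuous_on (closure ?R) ?G"
        using R_sub by (intro continuous_intros continuous_on_subset[OF cont]) simp
      show "z \<in> ?R"
        using z n by (auto simp: in_cbox_complex_iff)
    next
      fix w assume "w \<in> frontier ?R"
      then have w: "w \<in> ?R" and nw: "w \<notin> box (Complex (- real n) 0) (Complex (real n) (1/2))"
        unfolding frontier_def int by auto
      have Im_w: "0 \<le> Im w" "Im w \<le> 1/2"
        using w by (auto simp: in_cbox_complex_iff)
      consider "Im w = 0 \<or> Im w = 1/2" | "\<bar>Re w\<bar> = real n"
        using w nw by (force simp: in_cbox_complex_iff in_box_complex_iff)
      then show "cmod (?G w) \<le> exp (e / 4) * (B + M * exp (- (e * (real n)\<^sup>2)))"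
      proof cases
        case 1
        have "w = complex_of_real (Re w) \<or> w = complex_of_real (Re w) + \<i>/2"
          using 1 by (auto simp: complex_eq_iff)
        then have "cmod (F w) \<le> B"
          using lower upper by metis
        moreover have "exp (- (e * (Re w)\<^sup>2)) \<le> 1"
          using e by simp
        then have "cmod (exp (- (of_real e * w\<^sup>2))) \<le> exp (e / 4)"
          using exp_le[OF Im_w] by (smt (verit) exp_gt_zero mult_left_le)
        ultimately have "cmod (?G w) \<le> B * exp (e / 4)"
          unfolding norm_mult using B0 by (intro mult_mono) auto
        then show ?thesis
          using M0 by (smt (verit) exp_gt_zero mult.commute mult_left_mono mult_nonneg_nonneg)
      next
        case 2
        then have "(Re w)\<^sup>2 = (real n)\<^sup>2"
          by (metis power2_abs)
        then have "cmod (?G w) \<le> M * (exp (e / 4) * exp (- (e * (real n)\<^sup>2)))"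
          unfolding norm_mult using M0 bdd[OF Im_w] exp_le[OF Im_w] by (intro mult_mono) auto
        then show ?thesis
          using B0 by (simp add: distrib_left mult_ac) (smt (verit) exp_gt_zero mult_nonneg_nonneg)
      qed
    qed (rule bounded_cbox)
  qed
  \<comment> \<open>For fixed \<open>e\<close> the vertical sides recede to infinity and the term
    with \<open>M\<close> disappears; only afterwards does \<open>e\<close> tend to 0, removing the
    multiplier and the factor \<open>exp (e / 4)\<close>.\<close>
  have eps: "cmod (F z * exp (- (of_real e * z\<^sup>2))) \<le> exp (e / 4) * B" if e: "e > 0" for e
  proof -
    have "(\<lambda>n. exp (- (e * (real n)\<^sup>2))) \<longlonglongrightarrow> 0"
    proof (rule Lim_null_comparison)
      show "(\<lambda>n. exp (- e) ^ n) \<longlonglongrightarrow> 0"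
        using e by (intro LIMSEQ_realpow_zero) auto
      have "e * real n \<le> e * (real n)\<^sup>2" for n
        using e le_square[of n] by (intro mult_left_mono) (auto simp: power2_eq_square simp flip: of_nat_mult)
      then show "\<forall>\<^sub>F n in sequentially. norm (exp (- (e * (real n)\<^sup>2))) \<le> exp (- e) ^ n"
        by (simp add: mult.commute flip: exp_of_nat_mult)
    qed
    then have "(\<lambda>n. exp (e / 4) * (B + M * exp (- (e * (real n)\<^sup>2)))) \<longlonglongrightarrow> exp (e / 4) * (B + M * 0)"
      by (intro tendsto_intros)
    moreover obtain N where "\<bar>Re z\<bar> \<le> real N"
      using real_arch_simple by blast
    then have "\<forall>n\<ge>N. cmod (F z * exp (- (of_real e * z\<^sup>2))) \<le> exp (e / 4) * (B + M * exp (- (e * (real n)\<^sup>2)))"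
      using step[OF e] by auto
    ultimately show ?thesis
      using LIMSEQ_le_const by fastforce
  qed
  have 1: "((\<lambda>e. cmod (F z * exp (- (of_real e * z\<^sup>2)))) \<longlongrightarrow> cmod (F z * exp (- (of_real 0 * z\<^sup>2)))) (at_right 0)"
    by (intro tendsto_intros)
  have 2: "((\<lambda>e. exp (e / 4) * B) \<longlongrightarrow> exp (0 / 4) * B) (at_right 0)"
    by (intro tendsto_intros) simp
  have "\<forall>\<^sub>F e in at_right 0. cmod (F z * exp (- (of_real e * z\<^sup>2))) \<le> exp (e / 4) * B"
    by (rule eventually_mono[OF eventually_at_right_less]) (rule eps)
  from tendsto_le[OF trivial_limit_at_right_real 2 1 this] show ?thesis
    by simp
qed

text \<open>Differences of the extensions satisfy the maximum principle, so uniform convergence on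
  the boundary lines makes the extensions uniformly Cauchy on the closed strip.\<close>

lemma strip_extension_uniform_limit:
  assumes ext: "\<And>n. strip_extension (f n) (g n)"
    and f: "uniform_limit UNIV f f' sequentially" and g: "uniform_limit UNIV g g' sequentially"
  shows "strip_extension f' g'"
proof -
  let ?S = "{z. 0 \<le> Im z \<and> Im z \<le> 1/2}" and ?S' = "{z. 0 < Im z \<and> Im z < 1/2}"
  have S': "open ?S'"
    using open_Collect_conj[OF open_halfspace_Im_gt[of 0] open_halfspace_Im_lt[of "1/2"]]
    by simp
  define Q where "Q n F \<longleftrightarrow> continuous_on ?S F \<and> bounded (F ` ?S) \<and> F holomorphic_on ?S' \<and>
    (\<forall>t. F (complex_of_real t) = f n t) \<and> (\<forall>t. F (complex_of_real t + \<i>/2) = g n t)" for n F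
  have "\<exists>F. Q n F" for n
    using ext[of n] unfolding strip_extension_def analytic_on_open[OF S'] Q_def .
  then obtain F where "\<And>n. Q n (F n)"
    by metis
  then have F: "\<And>n. continuous_on ?S (F n)" "\<And>n. bounded (F n ` ?S)" "\<And>n. F n holomorphic_on ?S'"
      "\<And>n t. F n (complex_of_real t) = f n t" "\<And>n t. F n (complex_of_real t + \<i>/2) = g n t"
    unfolding Q_def by auto
  have "uniformly_Cauchy_on ?S F"
    unfolding uniformly_Cauchy_on_def
  proof safe
    fix e :: real assume "e > 0"
    then have "e / 4 > 0"
      by simp
    then obtain N where
      N: "\<And>n t. n \<ge> N \<Longrightarrow> dist (f n t) (f' t) < e / 4" "\<And>n t. n \<ge> N \<Longrightarrow> dist (g n t) (g' t) < e / 4"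
      using eventually_conj[OF uniform_limitD[OF f] uniform_limitD[OF g]]
      unfolding eventually_sequentially by blast
    have "dist (F m z) (F n z) < e" if mn: "m \<ge> N" "n \<ge> N" and z: "0 \<le> Im z" "Im z \<le> 1/2" for m n z
    proof -
      \<comment> \<open>These bounds may depend on \<open>m\<close> and \<open>n\<close>: they only
        make the maximum principle applicable and do not enter the estimate by
        \<open>e / 2\<close>.\<close>
      obtain C D where CD: "\<And>z. z \<in> ?S \<Longrightarrow> cmod (F m z) \<le> C" "\<And>z. z \<in> ?S \<Longrightarrow> cmod (F n z) \<le> D"
        using F(2)[of m] F(2)[of n] unfolding bounded_iff by auto
      have "cmod (F m z - F n z) \<le> e / 2"
      proof (rule strip_maximum_modulus[where F = "\<lambda>z. F m z - F n z" and M = "C + D"])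
        show "cmod (F m w - F n w) \<le> C + D" if "0 \<le> Im w" "Im w \<le> 1/2" for w
          using CD[of w] that norm_triangle_ineq4[of "F m w" "F n w"] by simp
        show "cmod (F m (complex_of_real t) - F n (complex_of_real t)) \<le> e / 2" for t
          using N(1)[OF mn(1), of t] N(1)[OF mn(2), of t] dist_triangle2[of "f m t" "f n t" "f' t"]
          by (simp add: F dist_norm)
        show "cmod (F m (complex_of_real t + \<i>/2) - F n (complex_of_real t + \<i>/2)) \<le> e / 2" for t
          using N(2)[OF mn(1), of t] N(2)[OF mn(2), of t] dist_triangle2[of "g m t" "g n t" "g' t"]
          by (simp add: F dist_norm)
      qed (use z F in \<open>auto intro: continuous_on_diff holomorphic_on_diff\<close>)
      then show ?thesis
        using \<open>e > 0\<close> by (simp add: dist_norm)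
    qed
    then show "\<exists>M. \<forall>x\<in>?S. \<forall>m\<ge>M. \<forall>n\<ge>M. dist (F m x) (F n x) < e"
      by blast
  qed
  then obtain G where G: "uniform_limit ?S F G sequentially"
    using Cauchy_uniformly_convergent uniformly_convergent_on_def by blast
  have pt: "(\<lambda>n. F n z) \<longlonglongrightarrow> G z" if "z \<in> ?S" for z
    using tendsto_uniform_limitI[OF G that] .
  have "continuous_on ?S G"
    by (rule uniform_limit_theorem[OF _ G]) (use F(1) in auto)
  moreover have "bounded (G ` ?S)"
  proof -
    obtain N where N: "\<And>z. z \<in> ?S \<Longrightarrow> dist (F N z) (G z) < 1"
      using uniform_limitD[OF G zero_less_one] unfolding eventually_sequentially by blast
    obtain C where C: "\<And>z. z \<in> ?S \<Longrightarrow> cmod (F N z) \<le> C"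
      using F(2)[of N] unfolding bounded_iff by auto
    have "cmod (G z) \<le> C + 1" if "z \<in> ?S" for z
      using N[OF that] C[OF that] norm_triangle_ineq2[of "G z" "F N z"]
      by (simp add: dist_norm norm_minus_commute)
    then show ?thesis
      unfolding bounded_iff by blast
  qed
  moreover have "G holomorphic_on ?S'"
  proof (rule holomorphic_uniform_sequence[OF S' F(3)])
    fix x assume "x \<in> ?S'"
    then obtain d where d: "d > 0" "cball x d \<subseteq> ?S'"
      using S' open_contains_cball by blast
    moreover have "uniform_limit (cball x d) F G sequentially"
      by (rule uniform_limit_on_subset[OF G]) (use d in force)
    ultimately show "\<exists>d>0. cball x d \<subseteq> ?S' \<and> uniform_limit (cball x d) F G sequentially"
      by blast
  qed
  moreover have "G (complex_of_real t) = f' t" for t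
    using LIMSEQ_unique[OF pt[of "complex_of_real t"] ] tendsto_uniform_limitI[OF f UNIV_I, of t]
    by (simp add: F)
  moreover have "G (complex_of_real t + \<i>/2) = g' t" for t
    using LIMSEQ_unique[OF pt[of "complex_of_real t + \<i>/2"]] tendsto_uniform_limitI[OF g UNIV_I, of t]
    by (simp add: F)
  ultimately show ?thesis
    unfolding strip_extension_def analytic_on_open[OF S'] by blast
qed

section \<open>Tensor products\<close>

lemma hilbert_tensorD:
  assumes "hilbert_tensor tens"
  shows "tens (x + x') y = tens x y + tens x' y" "tens x (y + y') = tens x y + tens x y'"
    "tens (c *\<^sub>C x) y = c *\<^sub>C tens x y" "tens x (c *\<^sub>C y) = c *\<^sub>C tens x y"
    "cinner (tens x y) (tens x' y') = cinner x x' * cinner y y'"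
    "closure (span {tens x y | x y. True}) = UNIV"
  using assms unfolding hilbert_tensor_def by auto

lemma norm_tensor:
  assumes "hilbert_tensor tens"
  shows "norm (tens x y) = norm x * norm y"
proof -
  have "(norm (tens x y))\<^sup>2 = (norm x * norm y)\<^sup>2"
    unfolding Re_cinner_self[symmetric] hilbert_tensorD(5)[OF assms]
    by (simp add: cinner_self power_mult_distrib flip: of_real_power of_real_mult)
  then show ?thesis
    by (simp add: power2_eq_iff_nonneg)
qed

lemma bounded_bilinear_tensor:
  assumes "hilbert_tensor tens"
  shows "bounded_bilinear tens"
  by (rule bounded_bilinear.intro)
    (auto simp: hilbert_tensorD[OF assms] norm_tensor[OF assms] intro!: exI[of _ 1] simp flip: scaleC_of_real)

lemma tensor_ext:
  assumes tens: "hilbert_tensor tens" and A: "bounded_linear A" and B: "bounded_linear B"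
    and eq: "\<And>x y. A (tens x y) = B (tens x y)"
  shows "A = B"
proof
  fix v
  have "closed {v. A v = B v}"
    by (intro closed_Collect_eq linear_continuous_on A B)
  moreover have "span {tens x y | x y. True} \<subseteq> {v. A v = B v}"
    using linear_eq_on_span[of A B "{tens x y | x y. True}"] eq A B
    by (auto simp: bounded_linear.linear)
  ultimately have "closure (span {tens x y | x y. True}) \<subseteq> {v. A v = B v}"
    by (rule closure_minimal[rotated])
  then show "A v = B v"
    unfolding hilbert_tensorD(6)[OF tens] by blast
qed

text \<open>The operator is obtained as the closure of its graph, on which both projections have the same
  norm.\<close>

lemma isometry_extension:
  fixes g :: "'i \<Rightarrow> 'a::complex_hilbert" and g' :: "'i \<Rightarrow> 'b::complex_hilbert"
  assumes total: "closure (span (range g)) = UNIV"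
    and gram: "\<And>i j. cinner (g' i) (g' j) = cinner (g i) (g j)"
    and scale: "\<And>c i. \<exists>k. g k = c *\<^sub>C g i \<and> g' k = c *\<^sub>C g' i"
  shows "\<exists>R. bounded_clinear R \<and> (\<forall>i. R (g i) = g' i)"
proof -
  define G0 where "G0 = span (range (\<lambda>i. (g i, g' i)))"
  define G where "G = closure G0"
  have inner0: "cinner (snd p) (g' j) = cinner (fst p) (g j)" if "p \<in> G0" for p j
    using that unfolding G0_def
    by (induction rule: span_induct_alt) (auto simp: gram cinner_add_left cinner_scaleR_left)
  have inner: "cinner (snd p) (snd q) = cinner (fst p) (fst q)" if p: "p \<in> G0" and q: "q \<in> G0" for p q
    using q unfolding G0_def
    by (induction rule: span_induct_alt) (auto simp: inner0[OF p] cinner_add_right cinner_scaleR_right)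
  have norm0: "norm (snd p) = norm (fst p)" if "p \<in> G0" for p
  proof -
    have "(norm (snd p))\<^sup>2 = (norm (fst p))\<^sup>2"
      unfolding Re_cinner_self[symmetric] inner[OF that that] ..
    then show ?thesis
      by simp
  qed
  have "closed {p :: 'a \<times> 'b. norm (snd p) = norm (fst p)}"
    by (intro closed_Collect_eq continuous_intros)
  then have "G \<subseteq> {p. norm (snd p) = norm (fst p)}"
    unfolding G_def by (intro closure_minimal) (use norm0 in auto)
  then have normG: "norm (snd p) = norm (fst p)" if "p \<in> G" for p
    using that by blast
  \<comment> \<open>\<open>span\<close> is real, so complex homogeneity is separate: a complex
    multiple of a generating pair is again a generating pair.\<close>
  have scale0: "(c *\<^sub>C fst p, c *\<^sub>C snd p) \<in> G0" if "p \<in> G0" for c p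
    using that unfolding G0_def
  proof (induction rule: span_induct_alt)
    case base
    then show ?case
      by (simp add: span_zero flip: zero_prod_def)
  next
    case (step r p q)
    then obtain i where "p = (g i, g' i)"
      by auto
    moreover obtain k where "g k = c *\<^sub>C g i" "g' k = c *\<^sub>C g' i"
      using scale by blast
    ultimately have "(c *\<^sub>C fst p, c *\<^sub>C snd p) = (g k, g' k)"
      by simp
    then have "(c *\<^sub>C fst p, c *\<^sub>C snd p) \<in> span (range (\<lambda>i. (g i, g' i)))"
      using span_base[OF rangeI[of "\<lambda>i. (g i, g' i)" k]] by simp
    from span_add[OF span_scale[OF this, of r] step(2)] show ?case
      by (simp add: scaleC_add_right scaleC_scaleC mult.commute flip: scaleC_of_real)
  qed
  have subG: "subspace G"
  proof (rule subspaceI)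
    show "0 \<in> G"
      unfolding G_def G0_def using span_zero closure_subset by blast
    fix p assume "p \<in> G"
    then obtain s where s: "\<And>n. s n \<in> G0" "s \<longlonglongrightarrow> p"
      unfolding G_def closure_sequential by blast
    show "r *\<^sub>R p \<in> G" for r
      unfolding G_def
    proof (rule closed_sequentially[OF closed_closure])
      show "(\<lambda>n. r *\<^sub>R s n) \<longlonglongrightarrow> r *\<^sub>R p"
        by (intro tendsto_intros s)
      have "r *\<^sub>R s n \<in> G0" for n
        using s(1) unfolding G0_def by (intro span_scale)
      then show "r *\<^sub>R s n \<in> closure G0" for n
        using closure_subset[of G0] by blast
    qed
    fix q assume "q \<in> G"
    then obtain t where t: "\<And>n. t n \<in> G0" "t \<longlonglongrightarrow> q"
      unfolding G_def closure_sequential by blast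
    show "p + q \<in> G"
      unfolding G_def
    proof (rule closed_sequentially[OF closed_closure])
      show "(\<lambda>n. s n + t n) \<longlonglongrightarrow> p + q"
        by (intro tendsto_intros s t)
      have "s n + t n \<in> G0" for n
        using s(1) t(1) unfolding G0_def by (intro span_add)
      then show "s n + t n \<in> closure G0" for n
        using closure_subset[of G0] by blast
    qed
  qed
  have scaleG: "(c *\<^sub>C fst p, c *\<^sub>C snd p) \<in> G" if p: "p \<in> G" for c p
  proof -
    obtain q where q: "\<And>n. q n \<in> G0" "q \<longlonglongrightarrow> p"
      using p unfolding G_def closure_sequential by blast
    have "(\<lambda>n. (c *\<^sub>C fst (q n), c *\<^sub>C snd (q n))) \<longlonglongrightarrow> (c *\<^sub>C fst p, c *\<^sub>C snd p)"
      by (intro tendsto_intros bounded_linear.tendsto[OF bounded_linear_scaleC] q)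
    moreover have "(c *\<^sub>C fst (q n), c *\<^sub>C snd (q n)) \<in> closure G0" for n
      using closure_subset scale0[OF q(1)] by (rule subsetD)
    ultimately show ?thesis
      unfolding G_def by (rule closed_sequentially[OF closed_closure, rotated])
  qed
  \<comment> \<open>The difference of the two pairs is \<open>(0, y - y')\<close>, whose components
    have equal norms.\<close>
  have unique: "y = y'" if "(x, y) \<in> G" "(x, y') \<in> G" for x y y'
    using normG[OF subspace_diff[OF subG that]] by simp
  have exists: "\<exists>y. (x, y) \<in> G" for x
  proof -
    have "fst ` G0 = span (fst ` range (\<lambda>i. (g i, g' i)))"
      unfolding G0_def by (rule linear_span_image[symmetric]) (rule linear_fst)
    also have "fst ` range (\<lambda>i. (g i, g' i)) = range g"
      by (simp add: image_image)
    finally have "x \<in> closure (fst ` G0)"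
      using total by simp
    then obtain x' where x': "\<And>n. x' n \<in> fst ` G0" "x' \<longlonglongrightarrow> x"
      unfolding closure_sequential by blast
    then have "\<exists>y. (x' n, y) \<in> G0" for n
      by force
    then obtain y' where y': "\<And>n. (x' n, y' n) \<in> G0"
      by metis
    \<comment> \<open>Equal norms make the second components Cauchy together with the first, and
      completeness puts the limit into the closed graph.\<close>
    have "dist (y' m) (y' n) = dist (x' m) (x' n)" for m n
      using norm0[of "(x' m - x' n, y' m - y' n)"] span_diff[OF y'[of m, unfolded G0_def] y'[of n, unfolded G0_def]]
      by (simp add: dist_norm G0_def)
    then have "Cauchy y'"
      using LIMSEQ_imp_Cauchy[OF x'(2)] unfolding Cauchy_def by simp
    then obtain y where "y' \<longlonglongrightarrow> y"
      using Cauchy_convergent convergent_def by blast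
    then have "(\<lambda>n. (x' n, y' n)) \<longlonglongrightarrow> (x, y)"
      by (intro tendsto_intros x')
    moreover have "(x' n, y' n) \<in> closure G0" for n
      using closure_subset y' by (rule subsetD)
    ultimately have "(x, y) \<in> G"
      unfolding G_def by (rule closed_sequentially[OF closed_closure, rotated])
    then show ?thesis ..
  qed
  define R where "R x = (SOME y. (x, y) \<in> G)" for x
  have R: "(x, R x) \<in> G" for x
    unfolding R_def using exists by (rule someI_ex)
  have "bounded_clinear R"
  proof (rule bounded_clinearI[where K = 1])
    show "R (x + y) = R x + R y" for x y
      by (rule unique[OF R]) (use subspace_add[OF subG R R] in simp)
    show "R (c *\<^sub>C x) = c *\<^sub>C R x" for c x
      by (rule unique[OF R]) (use scaleG[OF R] in simp)
    show "norm (R x) \<le> 1 * norm x" for x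
      using normG[OF R[of x]] by simp
  qed
  moreover have "R (g i) = g' i" for i
  proof (rule unique[OF R])
    have "(g i, g' i) \<in> G0"
      unfolding G0_def by (rule span_base) simp
    then show "(g i, g' i) \<in> G"
      unfolding G_def using closure_subset by blast
  qed
  ultimately show ?thesis
    by blast
qed

text \<open>If \<open>A\<close> and \<open>B\<close> preserve inner products, the tensors
  \<open>tens (A x) (B y)\<close> have the same Gram matrix as \<open>tens x y\<close>, so
  \<open>isometry_extension\<close> gives existence; density gives uniqueness. Scalars are absorbed
  into the first factor, hence homogeneity is asked of \<open>A\<close> alone.\<close>

lemma
  assumes tens: "hilbert_tensor tens"
    and A: "\<And>x y. cinner (A x) (A y) = cinner x y" "\<And>c x. A (c *\<^sub>C x) = c *\<^sub>C A x"
    and B: "\<And>x y. cinner (B x) (B y) = cinner x y"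
  shows bounded_clinear_tensor_op: "bounded_clinear (tensor_op tens A B)"
    and tensor_op_tensor: "tensor_op tens A B (tens x y) = tens (A x) (B y)"
proof -
  have "\<exists>!R. bounded_clinear R \<and> (\<forall>x y. R (tens x y) = tens (A x) (B y))"
  proof (rule ex_ex1I)
    let ?g = "\<lambda>(x, y). tens x y" and ?g' = "\<lambda>(x, y). tens (A x) (B y)"
    have "\<exists>R. bounded_clinear R \<and> (\<forall>i. R (?g i) = ?g' i)"
    proof (rule isometry_extension)
      have "range ?g = {tens x y | x y. True}"
        by auto
      then show "closure (span (range ?g)) = UNIV"
        using hilbert_tensorD(6)[OF tens] by simp
      show "cinner (?g' i) (?g' j) = cinner (?g i) (?g j)" for i j
        by (simp add: hilbert_tensorD(5)[OF tens] A B split: prod.split)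
      show "\<exists>k. ?g k = c *\<^sub>C ?g i \<and> ?g' k = c *\<^sub>C ?g' i" for c i
        by (rule exI[of _ "(c *\<^sub>C fst i, snd i)"])
          (simp add: hilbert_tensorD(3)[OF tens] A split: prod.split)
    qed
    then show "\<exists>R. bounded_clinear R \<and> (\<forall>x y. R (tens x y) = tens (A x) (B y))"
      by auto
  next
    fix R R' assume "bounded_clinear R \<and> (\<forall>x y. R (tens x y) = tens (A x) (B y))"
      "bounded_clinear R' \<and> (\<forall>x y. R' (tens x y) = tens (A x) (B y))"
    then show "R = R'"
      by (intro tensor_ext[OF tens]) (auto simp: bounded_clinear_def)
  qed
  from theI'[OF this] show "bounded_clinear (tensor_op tens A B)" "tensor_op tens A B (tens x y) = tens (A x) (B y)"
    unfolding tensor_op_def by auto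
qed

text \<open>The crossing relation fixes the matrix elements of \<open>R\<close> between elementary
  tensors of domain vectors; both domains are dense and everything is continuous in each
  vector.\<close>

lemma crossing_partner_unique:
  assumes tens: "hilbert_tensor tens"
    and dense: "closure (Domain S) = UNIV" "closure (Domain (antilinear_adjoint S)) = UNIV"
    and R: "crossing_partner tens S T R" and R': "crossing_partner tens S T R'"
  shows "R = R'"
proof (rule tensor_ext[OF tens])
  show bl: "bounded_linear R" "bounded_linear R'"
    using R R' unfolding crossing_partner_def bounded_clinear_def by auto
  fix b1 b2
  \<comment> \<open>These maps are antilinear in \<open>w\<close>, but real linear, which is all
    that \<open>tensor_ext\<close> asks.\<close>
  have "(\<lambda>w. cinner w (R (tens b1 b2))) = (\<lambda>w. cinner w (R' (tens b1 b2)))"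
  proof (rule tensor_ext[OF tens])
    fix a1 a2
    have "\<exists>s. (\<forall>n. s n \<in> Domain S) \<and> s \<longlonglongrightarrow> x"
      "\<exists>s. (\<forall>n. s n \<in> Domain (antilinear_adjoint S)) \<and> s \<longlonglongrightarrow> x" for x
      using dense UNIV_I[of x] unfolding closure_sequential[symmetric] by auto
    then obtain s1 s2 t1 t2 where
      s: "\<And>n. s1 n \<in> Domain S" "s1 \<longlonglongrightarrow> a1" "\<And>n. s2 n \<in> Domain (antilinear_adjoint S)" "s2 \<longlonglongrightarrow> a2"
        "\<And>n. t1 n \<in> Domain S" "t1 \<longlonglongrightarrow> b1" "\<And>n. t2 n \<in> Domain (antilinear_adjoint S)" "t2 \<longlonglongrightarrow> b2"
      by metis
    note lim = tendsto_cinner bounded_bilinear.tendsto[OF bounded_bilinear_tensor[OF tens]]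
    have "(\<lambda>n. cinner (tens (s1 n) (s2 n)) (R (tens (t1 n) (t2 n)))) \<longlonglongrightarrow> cinner (tens a1 a2) (R (tens b1 b2))"
      by (intro lim bounded_linear.tendsto[OF bl(1)] s)
    moreover have "(\<lambda>n. cinner (tens (s1 n) (s2 n)) (R' (tens (t1 n) (t2 n)))) \<longlonglongrightarrow> cinner (tens a1 a2) (R' (tens b1 b2))"
      by (intro lim bounded_linear.tendsto[OF bl(2)] s)
    moreover have "cinner (tens (s1 n) (s2 n)) (R (tens (t1 n) (t2 n)))
        = cinner (tens (s1 n) (s2 n)) (R' (tens (t1 n) (t2 n)))" for n
      using R R' s unfolding crossing_partner_def by metis
    ultimately show "cinner (tens a1 a2) (R (tens b1 b2)) = cinner (tens a1 a2) (R' (tens b1 b2))"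
      using LIMSEQ_unique by simp
  qed (auto intro: bounded_bilinear.bounded_linear_left[OF bounded_bilinear_cinner])
  then show "R (tens b1 b2) = R' (tens b1 b2)"
    by (intro cinner_eqI) (rule fun_cong)
qed

lemma crossing_partner_Cr:
  assumes tens: "hilbert_tensor tens"
    and dense: "closure (Domain S) = UNIV" "closure (Domain (antilinear_adjoint S)) = UNIV"
    and T: "crossable tens S T"
  shows "crossing_partner tens S T (Cr tens S T)"
proof -
  obtain R where R: "crossing_partner tens S T R"
    using T unfolding crossable_def by blast
  show ?thesis
    unfolding Cr_def by (rule theI[where P = "crossing_partner tens S T", OF R]) (rule crossing_partner_unique[OF tens dense _ R])
qed

section \<open>Complex powers on slabs\<close>

text \<open>The power \<open>x^(iz)\<close> cut to a slab. Writing it with \<open>exp\<close> and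
  the real logarithm makes it visibly entire in \<open>z\<close>, with modulus at most
  \<open>(n + 1)^\<bar>Im z\<bar>\<close>.\<close>

definition slab_power :: "nat \<Rightarrow> complex \<Rightarrow> real \<Rightarrow> complex" where
  "slab_power n z x = indicator (slab n) x * exp (\<i> * z * complex_of_real (ln x))"

lemma slab_ln:
  assumes "x \<in> slab n"
  shows "\<bar>ln x\<bar> \<le> ln (real n + 1)"
proof -
  have "ln x \<le> ln (real n + 1)"
    using slab_pos[OF assms] slab_le[OF assms] by simp
  moreover have "1 / x \<in> slab n"
    using assms slab_inverse by blast
  then have "ln (1 / x) \<le> ln (real n + 1)"
    using slab_pos[of "1 / x" n] slab_le[of "1 / x" n] by (simp only: ln_le_cancel_iff)
  then have "- ln x \<le> ln (real n + 1)"
    using slab_pos[OF assms] by (simp add: ln_div)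
  ultimately show ?thesis
    by linarith
qed

lemma exp_ln_borel [measurable]: "(\<lambda>x. exp (z * complex_of_real (ln x))) \<in> borel_measurable borel"
proof -
  have [measurable]: "(exp :: complex \<Rightarrow> complex) \<in> borel_measurable borel"
    by (intro borel_measurable_continuous_onI continuous_intros)
  show ?thesis
    by measurable
qed

lemma norm_slab_power: "cmod (slab_power n z x) \<le> exp (\<bar>Im z\<bar> * ln (real n + 1))"
proof (cases "x \<in> slab n")
  case True
  have "- (Im z * ln x) \<le> \<bar>Im z\<bar> * \<bar>ln x\<bar>"
    by (metis abs_ge_minus_self abs_mult)
  also have "\<dots> \<le> \<bar>Im z\<bar> * ln (real n + 1)"
    by (intro mult_left_mono slab_ln True) simp
  finally show ?thesis
    using True by (simp add: slab_power_def norm_exp_eq_Re)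
qed (simp add: slab_power_def)

lemma bborel_slab_power [simp]: "bborel (slab_power n z)"
  by (rule bborelI[OF _ norm_slab_power]) (unfold slab_power_def, measurable)

lemma slab_power_0: "slab_power n 0 = indicator (slab n)"
  by (auto simp: slab_power_def)

text \<open>Conjugation and inversion both reverse the phase \<open>t * ln x\<close> and cancel.
  Through \<open>J_bcalc\<close> this says that \<open>J\<close> commutes with
  \<open>\<Delta>^(it)\<close>.\<close>

lemma cnj_slab_power_inverse: "cnj (slab_power n (complex_of_real t) (1 / x)) = slab_power n (complex_of_real t) x"
proof (cases "x \<in> slab n")
  case True
  then show ?thesis
    using slab_pos[OF True] by (simp add: slab_power_def slab_inverse ln_div exp_cnj)
qed (simp add: slab_power_def slab_inverse indicator_def)

lemma sqrt_eq_exp_ln: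
  assumes "x > 0"
  shows "complex_of_real (sqrt x) = exp (complex_of_real (ln x) / 2)"
proof -
  have "sqrt x = exp (ln x / 2)"
    using assms by (metis exp_ln powr_def powr_half_sqrt less_imp_le less_irrefl mult.commute mult_1 times_divide_eq_left)
  then have "complex_of_real (sqrt x) = complex_of_real (exp (ln x / 2))"
    by simp
  also have "\<dots> = exp (complex_of_real (ln x) / 2)"
    unfolding exp_of_real[symmetric] by simp
  finally show ?thesis .
qed

text \<open>\<open>\<i> * (t - \<i>/2) = \<i> * t + 1/2\<close>, so a square root shifts the
  exponent to the lower line.\<close>

lemma sqrt_slab_power:
  "indicator (slab n) x * complex_of_real (sqrt x) * slab_power n (complex_of_real t) x
    = slab_power n (complex_of_real t - \<i>/2) x"
proof (cases "x \<in> slab n")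
  case True
  then show ?thesis
    by (simp add: slab_power_def sqrt_eq_exp_ln[OF slab_pos[OF True]] algebra_simps flip: exp_add)
qed (simp add: slab_power_def)

text \<open>The real part of the exponent survives conjugation but changes sign under inversion, so
  \<open>J\<close> carries the lower line to the upper one.\<close>

lemma cnj_sqrt_slab_power_inverse:
  "cnj (slab_power n (complex_of_real t - \<i>/2) (1 / x)) = slab_power n (complex_of_real t + \<i>/2) x"
proof (cases "x \<in> slab n")
  case True
  then show ?thesis
    using slab_pos[OF True]
    by (simp add: slab_power_def slab_inverse ln_div exp_cnj algebra_simps)
qed (simp add: slab_power_def slab_inverse indicator_def)

lemma bborel_imaginary_power: "bborel (\<lambda>x. complex_of_real x powr (\<i> * complex_of_real t))"
proof (rule bborelI[OF of_real_powr_borel])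
  \<comment> \<open>For negative \<open>x\<close> the branch of the logarithm contributes
    \<open>exp (- (t * pi))\<close>; for positive \<open>x\<close> the modulus is 1.\<close>
  show "cmod (complex_of_real x powr (\<i> * complex_of_real t)) \<le> exp (\<bar>t\<bar> * pi)" for x
  proof -
    have "- (t * pi) \<le> \<bar>t\<bar> * pi"
      using abs_ge_minus_self[of t] mult_right_mono[of "- t" "\<bar>t\<bar>" pi] by simp
    then show ?thesis
      by (auto simp: of_real_powr_eq norm_exp_eq_Re)
  qed
qed

lemma of_real_powr_pos: "x > 0 \<Longrightarrow> complex_of_real x powr z = exp (z * complex_of_real (ln x))"
  by (simp add: of_real_powr_eq)

section \<open>The unitary flow and its entire extension on slabs\<close>

context pos_pvm
begin

definition flow :: "real \<Rightarrow> 'a \<Rightarrow> 'a" where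
  "flow t = bcalc E (\<lambda>x. complex_of_real x powr (\<i> * complex_of_real t))"

lemma flow_clinear: "bounded_clinear (flow t)"
  unfolding flow_def by (rule bcalc_clinear[OF bborel_imaginary_power])

lemma flow_adjoint: "cinner v (flow (- t) w) = cinner (flow t v) w"
proof -
  have "cinner (flow t v) w = cinner v (bcalc E (\<lambda>x. cnj (complex_of_real x powr (\<i> * complex_of_real t))) w)"
    unfolding flow_def by (rule cinner_bcalc_left[OF bborel_imaginary_power])
  also have "bcalc E (\<lambda>x. cnj (complex_of_real x powr (\<i> * complex_of_real t))) w = flow (- t) w"
    unfolding flow_def
    by (rule bcalc_cong_pos[OF bborel_cnj[OF bborel_imaginary_power] bborel_imaginary_power])
      (simp add: of_real_powr_pos exp_cnj)
  finally show ?thesis ..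
qed

lemma flow_inverse: "flow (- t) (flow t v) = v"
proof -
  have "flow (- t) (flow t v) = bcalc E (\<lambda>x. complex_of_real x powr (\<i> * complex_of_real (- t)) *
      complex_of_real x powr (\<i> * complex_of_real t)) v"
    unfolding flow_def by (rule bcalc_mult[OF bborel_imaginary_power bborel_imaginary_power])
  also have "\<dots> = bcalc E (\<lambda>x. 1) v"
    by (rule bcalc_cong_pos[OF bborel_mult[OF bborel_imaginary_power bborel_imaginary_power] bborel_const])
      (simp add: of_real_powr_pos flip: exp_add)
  finally show ?thesis
    by (simp add: bcalc_one)
qed

lemma flow_cinner: "cinner (flow t v) (flow t w) = cinner v w"
  by (simp add: flow_inverse flip: flow_adjoint)

lemma norm_flow: "norm (flow t v) = norm v"
proof -
  have "(norm (flow t v))\<^sup>2 = (norm v)\<^sup>2"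
    by (simp add: flow_cinner flip: Re_cinner_self)
  then show ?thesis
    by simp
qed

lemma flow_slab: "flow t (E (slab n) v) = bcalc E (slab_power n (complex_of_real t)) v"
proof -
  have "flow t (E (slab n) v) = bcalc E (\<lambda>x. complex_of_real x powr (\<i> * complex_of_real t) * indicator (slab n) x) v"
    unfolding flow_def bcalc_indicator[OF slab_borel, symmetric]
    by (rule bcalc_mult[OF bborel_imaginary_power]) simp
  also have "(\<lambda>x. complex_of_real x powr (\<i> * complex_of_real t) * indicator (slab n) x)
      = slab_power n (complex_of_real t)"
    using slab_pos by (auto simp: slab_power_def of_real_powr_pos indicator_def)
  finally show ?thesis .
qed

lemma flow_slab_uniform_limit:
  "uniform_limit UNIV (\<lambda>n t. flow t (E (slab n) v)) (\<lambda>t. flow t v) sequentially"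
proof (rule uniform_limitI)
  fix e :: real assume "e > 0"
  have "dist (flow t (E (slab n) v)) (flow t v) = dist (E (slab n) v) v" for n t
    by (simp add: dist_norm norm_flow flip: bounded_clinearD(3)[OF flow_clinear])
  then show "\<forall>\<^sub>F n in sequentially. \<forall>t\<in>UNIV. dist (flow t (E (slab n) v)) (flow t v) < e"
    using tendstoD[OF slab_lim \<open>e > 0\<close>] by simp
qed

lemma slab_power_norm_le: "norm (bcalc E (slab_power n z) v) \<le> exp (\<bar>Im z\<bar> * ln (real n + 1)) * norm v"
  by (rule norm_bcalc_le[OF bborel_slab_power norm_slab_power])

text \<open>The bounded operators \<open>(ln \<Delta>)^k E(slab n)\<close>, which are the Taylor
  coefficients of \<open>\<Delta>^(iz) E(slab n)\<close> up to \<open>\<i>^k / k!\<close>.\<close>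

definition slab_ln_power :: "nat \<Rightarrow> nat \<Rightarrow> 'a \<Rightarrow> 'a" where
  "slab_ln_power n k = bcalc E (\<lambda>x. indicator (slab n) x * complex_of_real (ln x) ^ k)"

lemma bborel_slab_ln_power: "bborel (\<lambda>x. indicator (slab n) x * complex_of_real (ln x) ^ k)"
proof (rule bborel_cut[where C = "ln (real n + 1) ^ k"])
  show "cmod (complex_of_real (ln x) ^ k) \<le> ln (real n + 1) ^ k" if "x \<in> slab n" for x
    using slab_ln[OF that] by (simp add: norm_power power_mono)
qed auto

text \<open>The scalar Taylor remainder of \<open>exp\<close>, uniform over the slab and the disc,
  becomes a vector estimate by \<open>norm_bcalc_le\<close>. Polynomial approximants are what makes
  holomorphy accessible.\<close>

lemma slab_power_series:
  "uniform_limit (cball 0 \<rho>) (\<lambda>N z. \<Sum>k\<le>N. ((\<i> * z) ^ k / fact k) *\<^sub>C slab_ln_power n k v)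
    (\<lambda>z. bcalc E (slab_power n z) v) sequentially"
proof (rule uniform_limitI)
  fix e :: real assume "e > 0"
  \<comment> \<open>Bounds the modulus of \<open>\<i> * z * ln x\<close> for \<open>z\<close> in the
    disc and \<open>x\<close> in the slab.\<close>
  define M where "M = \<bar>\<rho>\<bar> * ln (real n + 1)"
  have M0: "M \<ge> 0"
    unfolding M_def by simp
  have "(\<lambda>N. inverse (fact N) * M ^ N) \<longlonglongrightarrow> 0"
    by (rule summable_LIMSEQ_zero[OF summable_exp])
  then have "(\<lambda>N. exp M * M * (inverse (fact N) * M ^ N) * norm v) \<longlonglongrightarrow> exp M * M * 0 * norm v"
    by (intro tendsto_intros)
  then have "(\<lambda>N. exp M * M ^ Suc N / fact N * norm v) \<longlonglongrightarrow> 0"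
    by (simp add: field_simps)
  from tendstoD[OF this \<open>e > 0\<close>]
  have "\<forall>\<^sub>F N in sequentially. exp M * M ^ Suc N / fact N * norm v < e"
    by (rule eventually_mono) (unfold dist_norm real_norm_def diff_0_right, rule le_less_trans[OF abs_ge_self])
  moreover have "\<forall>\<^sub>F N in sequentially. \<forall>z\<in>cball 0 \<rho>.
      dist (\<Sum>k\<le>N. ((\<i> * z) ^ k / fact k) *\<^sub>C slab_ln_power n k v) (bcalc E (slab_power n z) v)
        \<le> exp M * M ^ Suc N / fact N * norm v"
  proof (intro always_eventually allI ballI)
    fix N and z :: complex assume z: "z \<in> cball 0 \<rho>"
    let ?p = "\<lambda>N x. \<Sum>k\<le>N. (\<i> * z) ^ k / fact k * (indicator (slab n) x * complex_of_real (ln x) ^ k)"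
    have p: "bborel (?p N)" for N
      by (intro bborel_sum bborel_mult bborel_const bborel_slab_ln_power)
    have sum_eq: "(\<Sum>k\<le>N. ((\<i> * z) ^ k / fact k) *\<^sub>C slab_ln_power n k v) = bcalc E (?p N) v" for N
    proof (induction N)
      case 0
      show ?case
        using bcalc_scale[OF bborel_slab_ln_power, of "(\<i> * z) ^ 0 / fact 0" n 0 v]
        by (simp add: slab_ln_power_def)
    next
      case (Suc N)
      have "bborel (\<lambda>x. (\<i> * z) ^ Suc N / fact (Suc N) * (indicator (slab n) x * complex_of_real (ln x) ^ Suc N))"
        by (intro bborel_mult[OF bborel_const] bborel_slab_ln_power)
      from bcalc_add[OF p[of N] this, of v] show ?case
        unfolding sum.atMost_Suc Suc bcalc_scale[OF bborel_slab_ln_power] by (simp only: slab_ln_power_def)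
    qed
    have "cmod (?p N x - slab_power n z x) \<le> exp M * M ^ Suc N / fact N" for x
    proof (cases "x \<in> slab n")
      case True
      let ?w = "\<i> * z * complex_of_real (ln x)"
      have "cmod ?w \<le> M"
        unfolding M_def norm_mult using slab_ln[OF True] z by (auto intro!: mult_mono)
      then have "exp (cmod ?w) * (cmod ?w ^ Suc N) / fact N \<le> exp M * M ^ Suc N / fact N"
        by (intro divide_right_mono mult_mono power_mono) auto
      moreover have "?p N x = (\<Sum>k\<le>N. ?w ^ k / fact k)"
        using True by (simp add: power_mult_distrib mult_ac)
      ultimately show ?thesis
        using Taylor_exp_field[of ?w N] True by (simp add: slab_power_def norm_minus_commute)
    next
      case False
      then show ?thesis
        using M0 by (simp add: slab_power_def)
    qed
    then show "dist (\<Sum>k\<le>N. ((\<i> * z) ^ k / fact k) *\<^sub>C slab_ln_power n k v) (bcalc E (slab_power n z) v)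
        \<le> exp M * M ^ Suc N / fact N * norm v"
      unfolding sum_eq dist_norm bcalc_diff[OF p bborel_slab_power, symmetric]
      using p by (intro norm_bcalc_le) auto
  qed
  ultimately show "\<forall>\<^sub>F N in sequentially. \<forall>z\<in>cball 0 \<rho>.
      dist (\<Sum>k\<le>N. ((\<i> * z) ^ k / fact k) *\<^sub>C slab_ln_power n k v) (bcalc E (slab_power n z) v) < e"
    by eventually_elim (meson order_le_less_trans)
qed

lemma slab_power_bounded: "bounded ((\<lambda>z. bcalc E (slab_power n z) v) ` cball 0 \<rho>)"
proof -
  have "norm (bcalc E (slab_power n z) v) \<le> exp (\<rho> * ln (real n + 1)) * norm v" if "z \<in> cball 0 \<rho>" for z
  proof -
    have "\<bar>Im z\<bar> \<le> \<rho>"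
      using that abs_Im_le_cmod[of z] by simp
    then have "exp (\<bar>Im z\<bar> * ln (real n + 1)) \<le> exp (\<rho> * ln (real n + 1))"
      by (simp add: mult_right_mono)
    then show ?thesis
      using slab_power_norm_le[of n z v] by (meson mult_right_mono norm_ge_zero order_trans)
  qed
  then show ?thesis
    unfolding bounded_iff by blast
qed

text \<open>The conjugate in the first slot undoes the antilinearity there:
  \<open>cnj ((\<i> * cnj z)^k) = (- \<i> * z)^k\<close>. Replacing both powers by Taylor sums thus
  gives polynomials in \<open>z\<close>, and these converge locally uniformly.\<close>

lemma slab_power_holomorphic:
  fixes \<Phi> :: "'a \<Rightarrow> 'a \<Rightarrow> complex"
  assumes \<Phi>: "bounded_bilinear \<Phi>"
    and scale: "\<And>c x y. \<Phi> (c *\<^sub>C x) y = cnj c * \<Phi> x y" "\<And>c x y. \<Phi> x (c *\<^sub>C y) = c * \<Phi> x y"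
  shows "(\<lambda>z. \<Phi> (bcalc E (slab_power n (cnj z)) v) (bcalc E (slab_power n z) w)) holomorphic_on UNIV"
proof (rule holomorphic_uniform_sequence)
  let ?s = "\<lambda>v N z. \<Sum>k\<le>N. ((\<i> * z) ^ k / fact k) *\<^sub>C slab_ln_power n k v"
  interpret bounded_bilinear \<Phi>
    by fact
  show "(\<lambda>z. \<Phi> (?s v N (cnj z)) (?s w N z)) holomorphic_on UNIV" for N
  proof -
    have "\<Phi> (?s v N (cnj z)) (?s w N z) = (\<Sum>j\<le>N. (\<i> * z) ^ j / fact j * (\<Sum>k\<le>N. (- \<i> * z) ^ k / fact k
        * \<Phi> (slab_ln_power n k v) (slab_ln_power n j w)))" for z
      by (simp add: sum_left sum_right scale)
    then show ?thesis
      by (simp only:) (intro holomorphic_intros; simp)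
  qed
  fix z0 :: complex
  \<comment> \<open>A disc about 0 is invariant under conjugation; this one contains the unit disc
    about \<open>z0\<close>.\<close>
  let ?\<rho> = "cmod z0 + 1"
  have "uniform_limit (cball 0 ?\<rho>) (\<lambda>N z. \<Phi> (?s v N (cnj z)) (?s w N z))
      (\<lambda>z. \<Phi> (bcalc E (slab_power n (cnj z)) v) (bcalc E (slab_power n z) w)) sequentially"
  proof (rule bounded_uniform_limit[OF _ slab_power_series slab_power_bounded])
    show "uniform_limit (cball 0 ?\<rho>) (\<lambda>N z. ?s v N (cnj z)) (\<lambda>z. bcalc E (slab_power n (cnj z)) v) sequentially"
      by (rule uniform_limit_compose'[OF slab_power_series[where \<rho> = ?\<rho>]]) auto
    have "(\<lambda>z. bcalc E (slab_power n (cnj z)) v) ` cball 0 ?\<rho> \<subseteq> (\<lambda>z. bcalc E (slab_power n z) v) ` cball 0 ?\<rho>"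
      by auto
    then show "bounded ((\<lambda>z. bcalc E (slab_power n (cnj z)) v) ` cball 0 ?\<rho>)"
      using slab_power_bounded bounded_subset by blast
  qed
  moreover have "cball z0 1 \<subseteq> cball 0 ?\<rho>"
    by (simp add: cball_subset_cball_iff)
  ultimately have "uniform_limit (cball z0 1) (\<lambda>N z. \<Phi> (?s v N (cnj z)) (?s w N z))
      (\<lambda>z. \<Phi> (bcalc E (slab_power n (cnj z)) v) (bcalc E (slab_power n z) w)) sequentially"
    using uniform_limit_on_subset by blast
  then show "\<exists>d>0. cball z0 d \<subseteq> UNIV \<and> uniform_limit (cball z0 d) (\<lambda>N z. \<Phi> (?s v N (cnj z)) (?s w N z))
      (\<lambda>z. \<Phi> (bcalc E (slab_power n (cnj z)) v) (bcalc E (slab_power n z) w)) sequentially"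
    by (intro exI[of _ 1]) simp
qed simp

end

section \<open>Crossing and the modular flow\<close>

text \<open>Both sides are bounded and linear in \<open>k\<close>, so elementary tensors suffice.
  This moves \<open>\<Delta>^(-it)\<close> onto the left vector without forming an adjoint on the
  tensor product.\<close>

lemma tensor_op_adjoint:
  assumes tens: "hilbert_tensor tens"
    and A: "\<And>x y. cinner (A x) (A y) = cinner x y" "\<And>c x. A (c *\<^sub>C x) = c *\<^sub>C A x"
    and B: "\<And>x y. cinner (B x) (B y) = cinner x y"
    and adj: "\<And>x y. cinner x (A y) = cinner (A' x) y" "\<And>x y. cinner x (B y) = cinner (B' x) y"
  shows "cinner (tens x y) (tensor_op tens A B k) = cinner (tens (A' x) (B' y)) k"
proof -
  note bl = bounded_clinearD(1)[OF bounded_clinear_tensor_op[OF tens A B]]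
  have "(\<lambda>k. cinner (tens x y) (tensor_op tens A B k)) = cinner (tens (A' x) (B' y))"
  proof (rule tensor_ext[OF tens])
    note right = bounded_bilinear.bounded_linear_right[OF bounded_bilinear_cinner]
    show "bounded_linear (\<lambda>k. cinner (tens x y) (tensor_op tens A B k))"
      by (rule bounded_linear_compose[OF right bl])
    show "bounded_linear (cinner (tens (A' x) (B' y)))"
      by (rule right)
    show "cinner (tens x y) (tensor_op tens A B (tens a b)) = cinner (tens (A' x) (B' y)) (tens a b)" for a b
      by (simp add: tensor_op_tensor[OF tens A B] hilbert_tensorD(5)[OF tens] adj)
  qed
  then show ?thesis
    by (rule fun_cong)
qed

locale modular = pos_pvm +
  fixes J :: "'a \<Rightarrow> 'a" and S :: "'a unbounded_op"
  assumes J: "antiunitary_involution J"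
    and S: "closed_antilinear_involution S"
    and S_eq: "S = {(v, J u) | v u. (v, u) \<in> spectral_integral E (\<lambda>x. complex_of_real (sqrt x))}"
begin

lemmas J_simps = antiunitary_involutionD[OF J]

lemma S_iff: "(v, y) \<in> S \<longleftrightarrow> (v, J y) \<in> spectral_integral E (\<lambda>x. complex_of_real (sqrt x))"
  unfolding S_eq using J_simps(4) by (auto, metis)

text \<open>If \<open>\<Delta>^(1/2) v = u\<close> then \<open>S v = J u\<close>, and
  \<open>S (J u) = v\<close> reads \<open>\<Delta>^(1/2) (J u) = J v\<close>: the involution
  property is exactly the flip hypothesis of \<open>J_bcalc\<close>.\<close>

lemma J_calc: "bborel f \<Longrightarrow> J (bcalc E f v) = bcalc E (\<lambda>x. cnj (f (1 / x))) (J v)"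
proof (rule J_bcalc[OF J])
  fix v u assume "(v, u) \<in> spectral_integral E (\<lambda>x. complex_of_real (sqrt x))"
  then have "(v, J u) \<in> S"
    by (simp add: S_iff J_simps(4))
  then have "(J u, v) \<in> S"
    using S unfolding closed_antilinear_involution_def by blast
  then show "(J u, J v) \<in> spectral_integral E (\<lambda>x. complex_of_real (sqrt x))"
    by (simp add: S_iff)
qed

lemma sqrt_borel: "(\<lambda>x. complex_of_real (sqrt x)) \<in> borel_measurable borel"
  by measurable

lemma sqrt_bound: "x \<in> slab n \<Longrightarrow> cmod (complex_of_real (sqrt x)) \<le> sqrt (real n + 1)"
  using slab_pos[of x n] slab_le[of x n] by simp

lemma sqrt_bborel: "bborel (\<lambda>x. indicator (slab n) x * complex_of_real (sqrt x))"
  by (rule bborel_cut[OF sqrt_borel slab_borel sqrt_bound])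

lemma indicator_slab_power: "(\<lambda>x. indicator (slab n) x * slab_power n z x) = slab_power n z"
proof
  show "indicator (slab n) x * slab_power n z x = slab_power n z x" for x
    by (cases "x \<in> slab n") (simp_all add: slab_power_def)
qed

text \<open>\<open>J \<Delta>^(1/2 + it) J = \<Delta>^(-1/2 + it)\<close> on slabs, and the exponent
  on the right is \<open>\<i> * (t + \<i>/2)\<close>.\<close>

lemma slab_power_in_S:
  "(bcalc E (slab_power n (complex_of_real t)) (J v), bcalc E (slab_power n (complex_of_real t + \<i>/2)) v) \<in> S"
proof -
  let ?w = "bcalc E (slab_power n (complex_of_real t)) (J v)"
  have "E (slab n) ?w = ?w"
    by (simp add: E_bcalc indicator_slab_power)
  moreover have "(E (slab n) ?w, bcalc E (\<lambda>x. indicator (slab n) x * complex_of_real (sqrt x)) ?w)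
      \<in> spectral_integral E (\<lambda>x. complex_of_real (sqrt x))"
    by (rule spectral_integral_restrict[OF sqrt_borel slab_borel sqrt_bound])
  moreover have "bcalc E (\<lambda>x. indicator (slab n) x * complex_of_real (sqrt x)) ?w
      = bcalc E (slab_power n (complex_of_real t - \<i>/2)) (J v)"
    by (simp add: bcalc_mult sqrt_bborel sqrt_slab_power)
  moreover have "\<dots> = J (bcalc E (slab_power n (complex_of_real t + \<i>/2)) v)"
    using J_calc[OF bborel_slab_power, of n "complex_of_real t - \<i>/2" "J v"]
    by (simp add: cnj_sqrt_slab_power_inverse J_simps(4)) (metis J_simps(4))
  ultimately show ?thesis
    unfolding S_iff by simp
qed

text \<open>Here \<open>J y = \<Delta>^(1/2) x\<close>, so moving \<open>J\<close> and then the
  square root across the inner product produces the power \<open>1/2 + it\<close>. The slab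
  projection is inserted before that move, so that only a bounded operator is transferred.\<close>

lemma slab_power_in_adjoint:
  "(bcalc E (slab_power n (complex_of_real t)) (J v), bcalc E (slab_power n (complex_of_real t - \<i>/2)) v)
    \<in> antilinear_adjoint S"
  unfolding antilinear_adjoint_def
proof safe
  fix x y assume "(x, y) \<in> S"
  then have xy: "(x, J y) \<in> spectral_integral E (\<lambda>x. complex_of_real (sqrt x))"
    by (simp add: S_iff)
  let ?p = "slab_power n (complex_of_real t)"
  have "cinner (bcalc E ?p (J v)) y = cinner (J y) (J (bcalc E ?p (J v)))"
    by (simp add: J_simps)
  also have "J (bcalc E ?p (J v)) = bcalc E ?p v"
    by (simp add: J_calc cnj_slab_power_inverse J_simps)
  also have "\<dots> = E (slab n) (bcalc E ?p v)"
    by (simp add: E_bcalc indicator_slab_power)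
  also have "cinner (J y) \<dots> = cinner (E (slab n) (J y)) (bcalc E ?p v)"
    by (rule E_sym) simp
  also have "E (slab n) (J y) = bcalc E (\<lambda>x. indicator (slab n) x * complex_of_real (sqrt x)) x"
    by (rule spectral_integralD[OF sqrt_borel xy slab_borel sqrt_bound])
  also have "cinner \<dots> (bcalc E ?p v)
      = cinner x (bcalc E (\<lambda>x. cnj (indicator (slab n) x * complex_of_real (sqrt x))) (bcalc E ?p v))"
    by (rule cinner_bcalc_left[OF sqrt_bborel])
  also have "(\<lambda>x. cnj (indicator (slab n) x * complex_of_real (sqrt x)))
      = (\<lambda>x. indicator (slab n) x * complex_of_real (sqrt x))"
    by (auto simp: indicator_def)
  also have "bcalc E \<dots> (bcalc E ?p v) = bcalc E (slab_power n (complex_of_real t - \<i>/2)) v"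
    by (simp add: bcalc_mult sqrt_bborel sqrt_slab_power)
  finally show "cinner (bcalc E ?p (J v)) y = cinner x (bcalc E (slab_power n (complex_of_real t - \<i>/2)) v)" .
qed

lemma slab_in_Domain:
  "E (slab n) v \<in> Domain S" "E (slab n) v \<in> Domain (antilinear_adjoint S)"
  using slab_power_in_S[of n 0 "J v"] slab_power_in_adjoint[of n 0 "J v"]
  by (auto simp: slab_power_0 bcalc_indicator J_simps)

lemma dense_S: "closure (Domain S) = UNIV"
  using S unfolding closed_antilinear_involution_def densely_defined_def by blast

lemma dense_adjoint: "closure (Domain (antilinear_adjoint S)) = UNIV"
proof (intro UNIV_eq_I[symmetric])
  show "x \<in> closure (Domain (antilinear_adjoint S))" for x
    unfolding closure_sequential
    by (intro exI[of _ "\<lambda>n. E (slab n) x"] conjI allI slab_in_Domain slab_lim)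
qed

lemma S_apply:
  assumes "(v, u) \<in> S"
  shows "S \<rhd> v = u"
proof -
  have "single_valued S"
    using S unfolding closed_antilinear_involution_def antilinear_op_def by blast
  then show ?thesis
    unfolding op_apply_def
    by (intro the_equality[of "\<lambda>u. (v, u) \<in> S", OF assms]) (rule single_valuedD[OF _ _ assms])
qed

text \<open>Two values of the adjoint at \<open>v\<close> differ by a vector orthogonal to the dense
  domain of \<open>S\<close>.\<close>

lemma adjoint_apply:
  assumes "(v, u) \<in> antilinear_adjoint S"
  shows "antilinear_adjoint S \<rhd> v = u"
  unfolding op_apply_def
proof (rule the_equality[of "\<lambda>u. (v, u) \<in> antilinear_adjoint S", OF assms])
  fix u' assume "(v, u') \<in> antilinear_adjoint S"
  then have "cinner x (u' - u) = 0" if "x \<in> Domain S" for x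
    using assms that unfolding antilinear_adjoint_def by (fastforce simp: cinner_diff_right)
  moreover obtain s where s: "\<And>n. s n \<in> Domain S" "s \<longlonglongrightarrow> u' - u"
    using dense_S closure_sequential[of "u' - u" "Domain S"] by auto
  ultimately have "(\<lambda>n. 0) \<longlonglongrightarrow> cinner (u' - u) (u' - u)"
    using tendsto_cinner[OF s(2) tendsto_const[of "u' - u"]] by simp
  then have "cinner (u' - u) (u' - u) = 0"
    by (simp add: LIMSEQ_const_iff)
  then show "u' = u"
    by (simp add: cinner_self)
qed

text \<open>The vectors \<open>a\<close> and \<open>d\<close> carry no power but are cut off as
  well, because the crossing relation asks \<open>\<phi>2\<close> to lie in the domain of the
  adjoint and \<open>\<psi>1\<close> in that of \<open>S\<close>.\<close>

lemma strip_extension_slab: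
  assumes tens: "hilbert_tensor tens" and T: "bounded_clinear T" and R: "crossing_partner tens S T R"
  shows "strip_extension
    (\<lambda>t. cinner (tens (E (slab n) a) (flow t (E (slab n) b))) (T (tens (flow t (E (slab n) c)) (E (slab n) d))))
    (\<lambda>t. cinner (tens (flow t (E (slab n) (J c))) (E (slab n) a)) (R (tens (E (slab n) d) (flow t (E (slab n) (J b))))))"
proof -
  let ?V = "\<lambda>z. bcalc E (slab_power n z)" and ?Q = "E (slab n)"
  define \<Phi> where "\<Phi> x y = cinner (tens (?Q a) x) (T (tens y (?Q d)))" for x y
  define F where "F z = \<Phi> (?V (cnj z) b) (?V z c)" for z
  have T_bl: "bounded_linear T"
    using T by (rule bounded_clinearD)
  obtain K where K: "\<And>v. norm (T v) \<le> norm v * K"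
    using bounded_linear.bounded[OF T_bl] by blast
  have \<Phi>_scale: "\<Phi> (c *\<^sub>C x) y = cnj c * \<Phi> x y" "\<Phi> x (c *\<^sub>C y) = c * \<Phi> x y" for c x y
    unfolding \<Phi>_def by (simp_all add: hilbert_tensorD[OF tens] cinner_scaleC_left cinner_scaleC_right
        bounded_clinearD(5)[OF T])
  have \<Phi>: "bounded_bilinear \<Phi>"
    unfolding \<Phi>_def
    by (intro bounded_bilinear.comp[OF bounded_bilinear_cinner] bounded_linear_compose[OF T_bl]
        bounded_bilinear.bounded_linear_left[OF bounded_bilinear_tensor[OF tens]]
        bounded_bilinear.bounded_linear_right[OF bounded_bilinear_tensor[OF tens]])
  have hol: "F holomorphic_on UNIV"
    unfolding F_def by (rule slab_power_holomorphic[OF \<Phi> \<Phi>_scale])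
  show ?thesis
    unfolding strip_extension_def
  proof (intro exI[of _ F] conjI allI)
    show "continuous_on {z. 0 \<le> Im z \<and> Im z \<le> 1/2} F"
      using holomorphic_on_imp_continuous_on[OF hol] continuous_on_subset by blast
    have "F analytic_on UNIV"
      using hol by (simp add: analytic_on_open)
    then show "F analytic_on {z. 0 < Im z \<and> Im z < 1/2}"
      using analytic_on_subset by blast
    obtain L where L: "\<And>x y. cmod (\<Phi> x y) \<le> norm x * norm y * L" "L > 0"
      using bounded_bilinear.pos_bounded[OF \<Phi>] by blast
    \<comment> \<open>The square root of \<open>n + 1\<close>, the largest modulus of a slab power
      on the strip; it depends on \<open>n\<close>, which a fixed cut-off permits.\<close>
    let ?m = "exp (1/2 * ln (real n + 1))"
    have V_le: "norm (?V z v) \<le> ?m * norm v" if "\<bar>Im z\<bar> \<le> 1/2" for z v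
    proof -
      have "exp (\<bar>Im z\<bar> * ln (real n + 1)) \<le> ?m"
        using that by (simp only: exp_le_cancel_iff) (intro mult_right_mono, auto)
      then show ?thesis
        using slab_power_norm_le[of n z v] by (meson mult_right_mono norm_ge_zero order_trans)
    qed
    have "cmod (F z) \<le> ?m * norm b * (?m * norm c) * L" if "0 \<le> Im z \<and> Im z \<le> 1/2" for z
    proof -
      have "norm (?V (cnj z) b) * norm (?V z c) \<le> ?m * norm b * (?m * norm c)"
        using that by (intro mult_mono V_le) auto
      then show ?thesis
        unfolding F_def using L order_trans mult_right_mono less_imp_le by meson
    qed
    then show "bounded (F ` {z. 0 \<le> Im z \<and> Im z \<le> 1/2})"
      unfolding bounded_iff by blast
    show "F (complex_of_real t) = cinner (tens (?Q a) (flow t (?Q b))) (T (tens (flow t (?Q c)) (?Q d)))" for t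
      by (simp add: F_def \<Phi>_def flow_slab)
    show "F (complex_of_real t + \<i>/2) = cinner (tens (flow t (?Q (J c))) (?Q a)) (R (tens (?Q d) (flow t (?Q (J b)))))" for t
    proof -
      have conj: "cnj (complex_of_real t + \<i>/2) = complex_of_real t - \<i>/2"
        by simp
      have "F (complex_of_real t + \<i>/2) = cinner (tens (?Q a) (antilinear_adjoint S \<rhd> flow t (?Q (J b))))
          (T (tens (S \<rhd> flow t (?Q (J c))) (?Q d)))"
        unfolding F_def \<Phi>_def conj flow_slab
          S_apply[OF slab_power_in_S] adjoint_apply[OF slab_power_in_adjoint] ..
      also have "\<dots> = cinner (tens (flow t (?Q (J c))) (?Q a)) (R (tens (?Q d) (flow t (?Q (J b)))))"
        using R slab_in_Domain slab_power_in_S slab_power_in_adjoint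
        unfolding crossing_partner_def flow_slab by blast
      finally show ?thesis .
    qed
  qed
qed

text \<open>Uniform limits pass through the bilinear maps \<open>tens\<close> and
  \<open>cinner\<close> when the limit functions are bounded in \<open>t\<close>, which they are
  because the flow preserves norms.\<close>

lemma strip_extension_flow:
  fixes tens :: "'a \<Rightarrow> 'a \<Rightarrow> 'k::complex_hilbert"
  assumes tens: "hilbert_tensor tens" and T: "bounded_clinear T" and R: "crossing_partner tens S T R"
  shows "strip_extension (\<lambda>t. cinner (tens a (flow t b)) (T (tens (flow t c) d)))
    (\<lambda>t. cinner (tens (flow t (J c)) a) (R (tens d (flow t (J b)))))"
proof -
  have bl: "bounded_linear T" "bounded_linear R"
    using T R unfolding crossing_partner_def by (auto simp: bounded_clinear_def)
  have bd: "bounded (range (\<lambda>t. flow t v))" for v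
    unfolding bounded_iff by (auto simp: norm_flow)
  have const: "uniform_limit UNIV (\<lambda>n (t::real). E (slab n) v) (\<lambda>t. v) sequentially" for v
    by (rule uniform_limitI) (use tendstoD[OF slab_lim] in simp)
  have bdc: "bounded (range (\<lambda>t::real. v))" for v :: "'z::real_normed_vector"
    by simp
  note tens_lim = bounded_bilinear.bounded_uniform_limit[OF bounded_bilinear_tensor[OF tens]]
  have bdt: "bounded (range (\<lambda>t. tens (p t) (q t)))"
    if p: "bounded (range p)" and q: "bounded (range q)" for p q :: "real \<Rightarrow> 'a"
  proof -
    obtain C D where CD: "\<And>t. norm (p t) \<le> C" "\<And>t. norm (q t) \<le> D"
      using p q unfolding bounded_iff by auto
    have "norm (tens (p t) (q t)) \<le> C * D" for t
      unfolding norm_tensor[OF tens] using CD order_trans[OF norm_ge_zero CD(1)] by (intro mult_mono) auto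
    then show ?thesis
      unfolding bounded_iff by auto
  qed
  have bdl: "bounded (range (\<lambda>t. A (p t)))" if "bounded (range p)" "bounded_linear A"
    for p :: "real \<Rightarrow> 'k" and A :: "'k \<Rightarrow> 'k"
    using bounded_linear_image[OF that] by (simp add: image_image)
  note cinner_lim = bounded_bilinear.bounded_uniform_limit[OF bounded_bilinear_cinner]
  have "uniform_limit UNIV
      (\<lambda>n t. cinner (tens (E (slab n) a) (flow t (E (slab n) b))) (T (tens (flow t (E (slab n) c)) (E (slab n) d))))
      (\<lambda>t. cinner (tens a (flow t b)) (T (tens (flow t c) d))) sequentially"
    by (rule cinner_lim[OF tens_lim[OF const flow_slab_uniform_limit bd bdc]
          bounded_linear.uniform_limit[OF bl(1) tens_lim[OF flow_slab_uniform_limit const bdc bd]]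
          bdl[OF bdt[OF bd bdc] bl(1)] bdt[OF bdc bd]])
  moreover have "uniform_limit UNIV
      (\<lambda>n t. cinner (tens (flow t (E (slab n) (J c))) (E (slab n) a)) (R (tens (E (slab n) d) (flow t (E (slab n) (J b))))))
      (\<lambda>t. cinner (tens (flow t (J c)) a) (R (tens d (flow t (J b))))) sequentially"
    by (rule cinner_lim[OF tens_lim[OF flow_slab_uniform_limit const bdc bd]
          bounded_linear.uniform_limit[OF bl(2) tens_lim[OF const flow_slab_uniform_limit bd bdc]]
          bdl[OF bdt[OF bdc bd] bl(2)] bdt[OF bd bdc]])
  ultimately show ?thesis
    by (rule strip_extension_uniform_limit[OF strip_extension_slab[OF tens T R]])
qed

end

section \<open>From the polar decomposition to the boundary values\<close>

lemma modularI:
  assumes S: "closed_antilinear_involution S" and polar: "polar_decomposition S J \<Delta>"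
  obtains E where "modular E J S" "spectral_measure_of \<Delta> E"
proof -
  have J: "antiunitary_involution J" and \<Delta>: "strictly_positive_op \<Delta>"
    and S_eq: "S = {(v, J u) | v u. (v, u) \<in> op_power \<Delta> (1/2)}"
    using polar unfolding polar_decomposition_def by auto
  have "(0, 0) \<in> S"
    using S unfolding closed_antilinear_involution_def antilinear_op_def by blast
  then obtain E where E: "spectral_measure_of \<Delta> E"
    unfolding S_eq op_power_def functional_calculus_def by auto
  interpret pos_pvm E
    by (rule spectral_measure_pos_pvm[OF \<Delta> E])
  have eq: "complex_of_real x powr (1/2) = complex_of_real (sqrt x)" if "x \<in> slab n" for x n
    using slab_pos[OF that] powr_of_real[of x "1/2"] by (simp add: powr_half_sqrt)
  have bd: "cmod (complex_of_real (sqrt x)) \<le> sqrt (real n + 1)" if "x \<in> slab n" for x n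
    using slab_pos[OF that] slab_le[OF that] by simp
  have ind: "(\<lambda>x. indicator (slab n) x * complex_of_real x powr (1/2))
      = (\<lambda>x. indicator (slab n) x * complex_of_real (sqrt x))" for n
    using eq[of _ n] by (auto simp: indicator_def)
  have "op_power \<Delta> (1/2) = spectral_integral E (\<lambda>x. complex_of_real x powr (1/2))"
    unfolding op_power_def by (rule functional_calculus_eq[OF \<Delta> E of_real_powr_borel])
  \<comment> \<open>Off the positive half-line \<open>powr\<close> and \<open>sqrt\<close> disagree,
    but the slab criterion sees positive arguments only.\<close>
  also have "\<dots> = spectral_integral E (\<lambda>x. complex_of_real (sqrt x))"
  proof (rule set_eqI)
    fix p :: "'a \<times> 'a"
    obtain v u where p: "p = (v, u)"
      by fastforce
    have "(v, u) \<in> spectral_integral E (\<lambda>x. complex_of_real x powr (1/2)) \<longleftrightarrow>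
        (\<forall>n. E (slab n) u = bcalc E (\<lambda>x. indicator (slab n) x * complex_of_real x powr (1/2)) v)"
      by (rule spectral_integral_slab_iff[OF of_real_powr_borel, where C = "\<lambda>n. sqrt (real n + 1)"]) (use eq bd in force)
    moreover have "(v, u) \<in> spectral_integral E (\<lambda>x. complex_of_real (sqrt x)) \<longleftrightarrow>
        (\<forall>n. E (slab n) u = bcalc E (\<lambda>x. indicator (slab n) x * complex_of_real (sqrt x)) v)"
      by (rule spectral_integral_slab_iff[where C = "\<lambda>n. sqrt (real n + 1)"]) (use bd in auto)
    ultimately show "p \<in> spectral_integral E (\<lambda>x. complex_of_real x powr (1/2)) \<longleftrightarrow>
        p \<in> spectral_integral E (\<lambda>x. complex_of_real (sqrt x))"
      unfolding p ind by blast
  qed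
  finally have "modular E J S"
    using J S S_eq by unfold_locales auto
  then show ?thesis
    using E that by blast
qed

lemma (in pos_pvm) imaginary_power_eq_flow:
  assumes "strictly_positive_op \<Delta>" "spectral_measure_of \<Delta> E"
  shows "imaginary_power \<Delta> t = flow t"
proof
  fix v
  have "(v, u) \<in> op_power \<Delta> (\<i> * complex_of_real t) \<longleftrightarrow> u = flow t v" for u
    unfolding op_power_def functional_calculus_eq[OF assms of_real_powr_borel] flow_def
    by (rule spectral_integral_bborel[OF bborel_imaginary_power])
  then show "imaginary_power \<Delta> t v = flow t v"
    unfolding imaginary_power_def op_apply_def by simp
qed

theorem proposition2p5:
  fixes tens :: "'h::complex_hilbert \<Rightarrow> 'h \<Rightarrow> 'k::complex_hilbert" (infixr "\<otimes>" 70)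
    and S \<Delta> :: "'h unbounded_op"
    and J :: "'h \<Rightarrow> 'h"
    and T :: "'k \<Rightarrow> 'k"
    and \<psi>1 \<psi>2 \<psi>3 \<psi>4 :: 'h
  assumes separable: "\<exists>D :: 'h set. countable D \<and> closure D = UNIV"
    and tensor: "hilbert_tensor (\<otimes>)"
    and S: "closed_antilinear_involution S"
    and polar: "polar_decomposition S J \<Delta>"
    and T: "crossable (\<otimes>) S T"
  shows "strip_extension
    (\<lambda>t. cinner (\<psi>1 \<otimes> \<psi>2)
           ((tensor_op (\<otimes>) id (imaginary_power \<Delta> (- t)) \<circ> T \<circ>
             tensor_op (\<otimes>) (imaginary_power \<Delta> t) id) (\<psi>3 \<otimes> \<psi>4)))
    (\<lambda>t. cinner (J \<psi>3 \<otimes> \<psi>1)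
           ((tensor_op (\<otimes>) (imaginary_power \<Delta> (- t)) id \<circ> Cr (\<otimes>) S T \<circ>
             tensor_op (\<otimes>) id (imaginary_power \<Delta> t)) (\<psi>4 \<otimes> J \<psi>2)))"
proof -
  obtain E where "modular E J S" and E: "spectral_measure_of \<Delta> E"
    using modularI[OF S polar] .
  then interpret modular E J S
    by simp
  have \<Delta>: "strictly_positive_op \<Delta>"
    using polar by (simp add: polar_decomposition_def)
  have T_bl: "bounded_clinear T"
    using T by (simp add: crossable_def)
  note R = crossing_partner_Cr[OF tensor dense_S dense_adjoint T]
  have "tensor_op (\<otimes>) (flow t) id (\<psi>3 \<otimes> \<psi>4) = flow t \<psi>3 \<otimes> \<psi>4"
    "tensor_op (\<otimes>) id (flow t) (\<psi>4 \<otimes> J \<psi>2) = \<psi>4 \<otimes> flow t (J \<psi>2)" for t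
    by (subst tensor_op_tensor[OF tensor]; simp add: flow_cinner bounded_clinearD(5)[OF flow_clinear])+
  \<comment> \<open>The outer factors \<open>\<Delta>^(-it)\<close> reappear as
    \<open>\<Delta>^(it)\<close> on the left vectors, which leaves exactly the two functions of
    \<open>strip_extension_flow\<close>.\<close>
  moreover have "cinner (\<psi>1 \<otimes> \<psi>2) (tensor_op (\<otimes>) id (flow (- t)) k) = cinner (\<psi>1 \<otimes> flow t \<psi>2) k"
    "cinner (J \<psi>3 \<otimes> \<psi>1) (tensor_op (\<otimes>) (flow (- t)) id k) = cinner (flow t (J \<psi>3) \<otimes> \<psi>1) k" for t k
    using tensor_op_adjoint[where tens = tens and A = id and A' = id and x = \<psi>1 and y = \<psi>2 and k = k,
        OF tensor _ _ flow_cinner _ flow_adjoint]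
      tensor_op_adjoint[where tens = tens and B = id and B' = id and x = "J \<psi>3" and y = \<psi>1 and k = k,
        OF tensor flow_cinner bounded_clinearD(5)[OF flow_clinear] _ flow_adjoint]
    by simp_all
  ultimately show ?thesis
    using strip_extension_flow[OF tensor T_bl R, of \<psi>1 \<psi>2 \<psi>3 \<psi>4]
    by (simp add: imaginary_power_eq_flow[OF \<Delta> E])
qed

end
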